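(* Let $H$ be a complex Hilbert space and let $R_{z_1,z_2}$ be an operator-valued function depending on complex parameters $z_1,z_2\in\mathbb{T}_e$, whose values are bounded linear operators defined on the whole of $H$. The function $R_{z_1,z_2}$ is a generalized resolvent of some pair of closed isometric operators $V_1,V_2$ in $H$ satisfying the commutativity relation $$V_1V_2h=V_2V_1h,\qquad h\in D(V_1V_2)\cap D(V_2V_1),$$ if and only if the following conditions are satisfied: 1) $R_{0,0}=E_H$; 2) $R_{z_1,z_2}^*=R_{\frac{1}{\overline{z_1}},\frac{1}{\overline{z_2}}}$ for all $z_1,z_2\in\mathbb{T}_e\setminus\{0\}$; 3) for every $h\in H$, for the function $f(z_1,z_2):=(R_{z_1,z_2}h,h)_H$, $z_1,z_2\in\mathbb{T}_e$, there exist the limits $$f(\infty,z_2):=\lim_{z_1\to\infty}f(z_1,z_2),\quad f(z_1,\infty):=\lim_{z_2\to\infty}f(z_1,z_2),\quad z_1,z_2\in\mathbb{T}_e;$$ $$f(\infty,\infty)=\lim_{z_2\to\infty}\lim_{z_1\to\infty}f(z_1,z_2),$$ and the function $f(z_1,z_2)$, $z_1,z_2\in\mathbb{T}_e\cup\{\infty\}$, extended by these relations, belongs to the class $H_2$.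
   Context: Notation: $\mathbb{T}_e=\{z\in\mathbb{C}:|z|\neq 1\}$. $E_H$ is the identity operator on $H$. Hilbert spaces are not necessarily separable; operators are linear. $D(A)$ is the domain of an operator $A$. A closed isometric operator $V$ in $H$ is a closed linear operator with domain $D(V)\subseteq H$ a (not necessarily dense, possibly zero) subspace, with $\|Vh\|=\|h\|$ for $h\in D(V)$. $P^{\widetilde H}_H$ is the orthogonal projection of a Hilbert space $\widetilde H\supseteq H$ onto its closed subspace $H$. Generalized resolvent of a pair: let $V_1,V_2$ be closed isometric operators in $H$ with $V_1V_2h=V_2V_1h$ for $h\in D(V_1V_2)\cap D(V_2V_1)$. An operator-valued function $R_{z_1,z_2}$ ($z_1,z_2\in\mathbb{T}_e$) is called a generalized resolvent of the pair $V_1,V_2$ if there exist a Hilbert space $\widetilde H\supseteq H$ and commuting unitary operators $U_1,U_2$ in $\widetilde H$ with $U_1\supseteq V_1$, $U_2\supseteq V_2$, such that $$R_{z_1,z_2}=P^{\widetilde H}_H(E_{\widetilde H}+z_1U_1)(E_{\widetilde H}-z_1U_1)^{-1}(E_{\widetilde H}+z_2U_2)(E_{\widetilde H}-z_2U_2)^{-1}\big|_H,\qquad z_1,z_2\in\mathbb{T}_e.$$ The class $H_2$ (introduced by Korányi; not a Hardy space) is the class of functions $f$ of two complex variables $z_1,z_2$ defined and holomorphic for all $|z_1|,|z_2|\neq 1$ (including $\infty$, where holomorphy at an infinite value of a variable is understood via $u=1/z$) and satisfying, with the convention $\overline{0}^{-1}=\infty$, $\overline{\infty}^{-1}=0$: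 (a) $f(\overline{z_1}^{-1},\overline{z_2}^{-1})=\overline{f(z_1,z_2)}$ for all $|z_1|,|z_2|\neq1$; (b) $f(z_1,z_2)-f(\overline{z_1}^{-1},z_2)-f(z_1,\overline{z_2}^{-1})+f(\overline{z_1}^{-1},\overline{z_2}^{-1})\geq0$ for $|z_1|,|z_2|<1$; (c) $f(z_1,0)+f(z_1,\infty)=0$ and $f(0,z_2)+f(\infty,z_2)=0$ for all $|z_1|\neq1$ and $|z_2|\neq1$. *)

theory Defs
  imports "HOL-Analysis.Analysis"
begin

section \<open>Complex Hilbert spaces\<close>

class complex_vector = real_vector +
  fixes scaleC :: "complex \<Rightarrow> 'a \<Rightarrow> 'a"  (infixr \<open>*\<^sub>C\<close> 75)
  assumes scaleC_add_right: "c *\<^sub>C (x + y) = c *\<^sub>C x + c *\<^sub>C y"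
    and scaleC_add_left: "(c + d) *\<^sub>C x = c *\<^sub>C x + d *\<^sub>C x"
    and scaleC_scaleC: "c *\<^sub>C d *\<^sub>C x = (c * d) *\<^sub>C x"
    and scaleC_one: "1 *\<^sub>C x = x"
    and scaleR_scaleC: "r *\<^sub>R x = complex_of_real r *\<^sub>C x"

text \<open>The inner product is linear in its first argument.\<close>

class complex_inner = complex_vector + real_normed_vector +
  fixes cinner :: "'a \<Rightarrow> 'a \<Rightarrow> complex"
  assumes cinner_commute: "cinner x y = cnj (cinner y x)"
    and cinner_add_left: "cinner (x + y) z = cinner x z + cinner y z"
    and cinner_scaleC_left: "cinner (c *\<^sub>C x) y = c * cinner x y"
    and cinner_norm: "cinner x x = complex_of_real ((norm x)\<^sup>2)"

class chilbert_space = complex_inner + complete_space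

subclass (in chilbert_space) banach ..

section \<open>Operators\<close>

definition csubspace :: "'a::complex_vector set \<Rightarrow> bool" where
  "csubspace S \<longleftrightarrow> 0 \<in> S \<and> (\<forall>x\<in>S. \<forall>y\<in>S. x + y \<in> S) \<and> (\<forall>c. \<forall>x\<in>S. c *\<^sub>C x \<in> S)"

definition clinear_map :: "('a::complex_vector \<Rightarrow> 'b::complex_vector) \<Rightarrow> bool" where
  "clinear_map A \<longleftrightarrow> (\<forall>x y. A (x + y) = A x + A y) \<and> (\<forall>c x. A (c *\<^sub>C x) = c *\<^sub>C A x)"

definition bounded_clinear :: "('a::complex_inner \<Rightarrow> 'b::complex_inner) \<Rightarrow> bool" where
  "bounded_clinear A \<longleftrightarrow> clinear_map A \<and> (\<exists>K. \<forall>x. norm (A x) \<le> K * norm x)"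

definition cadjoint :: "('a::complex_inner \<Rightarrow> 'b::complex_inner) \<Rightarrow> 'b \<Rightarrow> 'a" where
  "cadjoint A = (SOME B. \<forall>x y. cinner (A x) y = cinner x (B y))"

definition unitary :: "('a::complex_inner \<Rightarrow> 'a) \<Rightarrow> bool" where
  "unitary U \<longleftrightarrow> clinear_map U \<and> surj U \<and> (\<forall>x y. cinner (U x) (U y) = cinner x y)"

definition orth_projection :: "'a::complex_inner set \<Rightarrow> 'a \<Rightarrow> 'a" where
  "orth_projection M x = (THE y. y \<in> M \<and> (\<forall>m\<in>M. cinner (x - y) m = 0))"

text \<open>An operator that need not be defined everywhere is a partial map \<open>V\<close>; its domain
  \<open>D(V)\<close> is \<^term>\<open>dom V\<close>.\<close>

definition linear_operator :: "('a::complex_vector \<rightharpoonup> 'b::complex_vector) \<Rightarrow> bool" where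
  "linear_operator V \<longleftrightarrow> csubspace (dom V) \<and>
     (\<forall>x\<in>dom V. \<forall>y\<in>dom V. the (V (x + y)) = the (V x) + the (V y)) \<and>
     (\<forall>c. \<forall>x\<in>dom V. the (V (c *\<^sub>C x)) = c *\<^sub>C the (V x))"

definition closed_isometric :: "('a::complex_inner \<rightharpoonup> 'a) \<Rightarrow> bool" where
  "closed_isometric V \<longleftrightarrow> linear_operator V \<and> closed (Map.graph V) \<and>
     (\<forall>h\<in>dom V. norm (the (V h)) = norm h)"

text \<open>The domain of \<^term>\<open>V1 \<circ>\<^sub>m V2\<close> is the natural one,
  \<open>{h \<in> D(V2). V2 h \<in> D(V1)}\<close>.\<close>

definition commuting_on_common_domain :: "('a \<rightharpoonup> 'a) \<Rightarrow> ('a \<rightharpoonup> 'a) \<Rightarrow> bool" where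
  "commuting_on_common_domain V1 V2 \<longleftrightarrow>
     (\<forall>h \<in> dom (V1 \<circ>\<^sub>m V2) \<inter> dom (V2 \<circ>\<^sub>m V1). (V1 \<circ>\<^sub>m V2) h = (V2 \<circ>\<^sub>m V1) h)"

section \<open>Generalized resolvents of a pair\<close>

definition Te :: "complex set" where
  "Te = {z. cmod z \<noteq> 1}"

definition cayley_factor :: "complex \<Rightarrow> ('a::complex_vector \<Rightarrow> 'a) \<Rightarrow> 'a \<Rightarrow> 'a" where
  "cayley_factor z U = (\<lambda>x. x + z *\<^sub>C U x) \<circ> inv (\<lambda>x. x - z *\<^sub>C U x)"

text \<open>The larger Hilbert space is the type \<open>'b\<close>, in which the given space \<open>'a\<close> is contained by means
  of a linear isometry \<open>J\<close>.\<close>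

definition generalized_resolvent ::
  "'b::chilbert_space itself \<Rightarrow> ('a::chilbert_space \<rightharpoonup> 'a) \<Rightarrow> ('a \<rightharpoonup> 'a) \<Rightarrow>
     (complex \<Rightarrow> complex \<Rightarrow> 'a \<Rightarrow> 'a) \<Rightarrow> bool" where
  "generalized_resolvent T V1 V2 R \<longleftrightarrow>
     (\<exists>(J :: 'a \<Rightarrow> 'b) U1 U2.
        clinear_map J \<and> (\<forall>x y. cinner (J x) (J y) = cinner x y) \<and>
        unitary U1 \<and> unitary U2 \<and> U1 \<circ> U2 = U2 \<circ> U1 \<and>
        (\<forall>h\<in>dom V1. U1 (J h) = J (the (V1 h))) \<and>
        (\<forall>h\<in>dom V2. U2 (J h) = J (the (V2 h))) \<and>
        (\<forall>z1\<in>Te. \<forall>z2\<in>Te. \<forall>h.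
           J (R z1 z2 h) =
             orth_projection (range J) (cayley_factor z1 U1 (cayley_factor z2 U2 (J h)))))"

definition generalized_resolvent_of_some_pair ::
  "'b::chilbert_space itself \<Rightarrow> (complex \<Rightarrow> complex \<Rightarrow> 'a::chilbert_space \<Rightarrow> 'a) \<Rightarrow> bool" where
  "generalized_resolvent_of_some_pair T R \<longleftrightarrow>
     (\<exists>V1 V2. closed_isometric V1 \<and> closed_isometric V2 \<and>
        commuting_on_common_domain V1 V2 \<and> generalized_resolvent T V1 V2 R)"

section \<open>The class \<open>H\<^sub>2\<close>\<close>

datatype ecomplex = Fin complex | Infty

fun reflect :: "ecomplex \<Rightarrow> ecomplex" where
  "reflect (Fin z) = (if z = 0 then Infty else Fin (inverse (cnj z)))"
| "reflect Infty = Fin 0"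

definition Te_ext :: "ecomplex set" where
  "Te_ext = insert Infty (Fin ` Te)"

text \<open>Coordinate around infinity: \<open>u = 1/z\<close>.\<close>

definition chart_infty :: "complex \<Rightarrow> ecomplex" where
  "chart_infty u = (if u = 0 then Infty else Fin (1 / u))"

definition holomorphic2_on :: "(complex \<times> complex \<Rightarrow> complex) \<Rightarrow> (complex \<times> complex) set \<Rightarrow> bool" where
  "holomorphic2_on f S \<longleftrightarrow> open S \<and>
     (\<forall>p\<in>S. \<exists>a b. (f has_derivative (\<lambda>(h, k). a * h + b * k)) (at p))"

text \<open>Each of the two charts of the sphere maps \<^term>\<open>Te\<close> into \<^term>\<open>Te_ext\<close>, and the two images
  together cover \<^term>\<open>Te_ext\<close>.\<close>

definition class_H2 :: "(ecomplex \<Rightarrow> ecomplex \<Rightarrow> complex) \<Rightarrow> bool" where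
  "class_H2 f \<longleftrightarrow>
     (\<forall>\<phi>\<in>{Fin, chart_infty}. \<forall>\<psi>\<in>{Fin, chart_infty}.
        holomorphic2_on (\<lambda>(u, v). f (\<phi> u) (\<psi> v)) (Te \<times> Te)) \<and>
     (\<forall>z1\<in>Te_ext. \<forall>z2\<in>Te_ext. f (reflect z1) (reflect z2) = cnj (f z1 z2)) \<and>
     (\<forall>z1 z2. cmod z1 < 1 \<and> cmod z2 < 1 \<longrightarrow>
        f (Fin z1) (Fin z2) - f (reflect (Fin z1)) (Fin z2)
          - f (Fin z1) (reflect (Fin z2)) + f (reflect (Fin z1)) (reflect (Fin z2)) \<in> \<real>\<^sub>\<ge>\<^sub>0) \<and>
     (\<forall>z1\<in>Te_ext. f z1 (Fin 0) + f z1 Infty = 0) \<and>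
     (\<forall>z2\<in>Te_ext. f (Fin 0) z2 + f Infty z2 = 0)"

definition has_limits_at_infinity :: "(complex \<Rightarrow> complex \<Rightarrow> complex) \<Rightarrow> bool" where
  "has_limits_at_infinity f \<longleftrightarrow>
     (\<forall>z2\<in>Te. \<exists>l. ((\<lambda>z1. f z1 z2) \<longlongrightarrow> l) at_infinity) \<and>
     (\<forall>z1\<in>Te. \<exists>l. ((\<lambda>z2. f z1 z2) \<longlongrightarrow> l) at_infinity) \<and>
     (\<exists>l. ((\<lambda>z2. Lim at_infinity (\<lambda>z1. f z1 z2)) \<longlongrightarrow> l) at_infinity)"

fun extend_to_infinity :: "(complex \<Rightarrow> complex \<Rightarrow> complex) \<Rightarrow> ecomplex \<Rightarrow> ecomplex \<Rightarrow> complex" where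
  "extend_to_infinity f (Fin z1) (Fin z2) = f z1 z2"
| "extend_to_infinity f Infty (Fin z2) = Lim at_infinity (\<lambda>z1. f z1 z2)"
| "extend_to_infinity f (Fin z1) Infty = Lim at_infinity (\<lambda>z2. f z1 z2)"
| "extend_to_infinity f Infty Infty =
     Lim at_infinity (\<lambda>z2. Lim at_infinity (\<lambda>z1. f z1 z2))"

definition resolvent_conditions :: "(complex \<Rightarrow> complex \<Rightarrow> 'a::chilbert_space \<Rightarrow> 'a) \<Rightarrow> bool" where
  "resolvent_conditions R \<longleftrightarrow>
     R 0 0 = id \<and>
     (\<forall>z1 \<in> Te - {0}. \<forall>z2 \<in> Te - {0}. cadjoint (R z1 z2) = R (1 / cnj z1) (1 / cnj z2)) \<and>
     (\<forall>h. let f = \<lambda>z1 z2. cinner (R z1 z2 h) h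
          in has_limits_at_infinity f \<and> class_H2 (extend_to_infinity f))"

section \<open>The Hilbert space of square-summable families\<close>

text \<open>HOL has no quantification over types, so "there exists a larger Hilbert space" needs a type
  that is large enough. If \<open>'a\<close> is contained in a Hilbert space carrying commuting unitary
  operators \<open>U1\<close>, \<open>U2\<close>, then the closed span of all \<open>U1\<^sup>m U2\<^sup>n h\<close> (with \<open>m\<close>, \<open>n\<close> integers and
  \<open>h\<close> of type \<open>'a\<close>) reduces both, so the space of square-summable families indexed by
  \<open>'a \<times> int \<times> int\<close>, into which this span embeds, suffices; on the orthogonal complement
  of the embedded span the unitaries can be taken to be the identity.\<close>

typedef 'i ell2 = "{f :: 'i \<Rightarrow> complex. (\<lambda>i. (cmod (f i))\<^sup>2) summable_on UNIV}"
  morphisms ell2_coord Abs_ell2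
  by (intro exI[of _ "\<lambda>_. 0"]) simp

setup_lifting type_definition_ell2

lemma square_summable_add:
  fixes f g :: "'i \<Rightarrow> complex"
  assumes "(\<lambda>i. (cmod (f i))\<^sup>2) summable_on UNIV" "(\<lambda>i. (cmod (g i))\<^sup>2) summable_on UNIV"
  shows "(\<lambda>i. (cmod (f i + g i))\<^sup>2) summable_on UNIV"
proof -
  have s: "(\<lambda>i. 2 * (cmod (f i))\<^sup>2 + 2 * (cmod (g i))\<^sup>2) summable_on UNIV"
    by (intro summable_on_add summable_on_cmult_right assms)
  have le: "(cmod (f i + g i))\<^sup>2 \<le> 2 * (cmod (f i))\<^sup>2 + 2 * (cmod (g i))\<^sup>2" for i
  proof -
    have "(cmod (f i + g i))\<^sup>2 \<le> (cmod (f i) + cmod (g i))\<^sup>2"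
      by (intro power_mono norm_triangle_ineq) auto
    also have "\<dots> \<le> 2 * (cmod (f i))\<^sup>2 + 2 * (cmod (g i))\<^sup>2"
      using zero_le_power2[of "cmod (f i) - cmod (g i)"]
      by (simp add: power2_sum power2_diff)
    finally show ?thesis .
  qed
  show ?thesis
    by (rule summable_on_comparison_test[OF s]) (use le in auto)
qed

lemma square_summable_scale:
  fixes f :: "'i \<Rightarrow> complex"
  assumes "(\<lambda>i. (cmod (f i))\<^sup>2) summable_on UNIV"
  shows "(\<lambda>i. (cmod (c * f i))\<^sup>2) summable_on UNIV"
  using summable_on_cmult_right[OF assms, of "(cmod c)\<^sup>2"]
  by (simp add: norm_mult power_mult_distrib)

lemma square_summable_mult:
  fixes f g :: "'i \<Rightarrow> complex"
  assumes "(\<lambda>i. (cmod (f i))\<^sup>2) summable_on UNIV" "(\<lambda>i. (cmod (g i))\<^sup>2) summable_on UNIV"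
  shows "(\<lambda>i. f i * cnj (g i)) summable_on UNIV"
proof -
  have s: "(\<lambda>i. (cmod (f i))\<^sup>2 + (cmod (g i))\<^sup>2) summable_on UNIV"
    by (intro summable_on_add assms)
  have "(\<lambda>i. norm (f i * cnj (g i))) summable_on UNIV"
  proof (rule summable_on_comparison_test[OF s])
    fix i
    have "2 * (cmod (f i) * cmod (g i)) \<le> (cmod (f i))\<^sup>2 + (cmod (g i))\<^sup>2"
      using sum_squares_bound[of "cmod (f i)" "cmod (g i)"] by (simp add: mult.assoc)
    moreover have "0 \<le> cmod (f i) * cmod (g i)"
      by simp
    ultimately show "norm (f i * cnj (g i)) \<le> (cmod (f i))\<^sup>2 + (cmod (g i))\<^sup>2"
      unfolding norm_mult complex_mod_cnj by linarith
  qed auto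
  then show ?thesis
    by (rule abs_summable_summable)
qed

instantiation ell2 :: (type) complex_inner
begin

lift_definition zero_ell2 :: "'a ell2" is "\<lambda>_. 0"
  by simp

lift_definition plus_ell2 :: "'a ell2 \<Rightarrow> 'a ell2 \<Rightarrow> 'a ell2" is "\<lambda>f g i. f i + g i"
  by (rule square_summable_add)

lift_definition uminus_ell2 :: "'a ell2 \<Rightarrow> 'a ell2" is "\<lambda>f i. - f i"
  by simp

lift_definition minus_ell2 :: "'a ell2 \<Rightarrow> 'a ell2 \<Rightarrow> 'a ell2" is "\<lambda>f g i. f i - g i"
  subgoal for f g
    using square_summable_add[of f "\<lambda>i. - g i"] by simp
  done

lift_definition scaleC_ell2 :: "complex \<Rightarrow> 'a ell2 \<Rightarrow> 'a ell2" is "\<lambda>c f i. c * f i"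
  by (rule square_summable_scale)

lift_definition cinner_ell2 :: "'a ell2 \<Rightarrow> 'a ell2 \<Rightarrow> complex"
  is "\<lambda>f g. \<Sum>\<^sub>\<infinity>i. f i * cnj (g i)" .

lift_definition norm_ell2 :: "'a ell2 \<Rightarrow> real" is "\<lambda>f. sqrt (\<Sum>\<^sub>\<infinity>i. (cmod (f i))\<^sup>2)" .

definition scaleR_ell2 :: "real \<Rightarrow> 'a ell2 \<Rightarrow> 'a ell2" where
  "scaleR_ell2 r x = complex_of_real r *\<^sub>C x"

definition sgn_ell2 :: "'a ell2 \<Rightarrow> 'a ell2" where
  "sgn_ell2 x = inverse (norm x) *\<^sub>R x"

definition dist_ell2 :: "'a ell2 \<Rightarrow> 'a ell2 \<Rightarrow> real" where
  "dist_ell2 x y = norm (x - y)"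

definition uniformity_ell2 :: "('a ell2 \<times> 'a ell2) filter" where
  "uniformity_ell2 = (INF e\<in>{0 <..}. principal {(x, y). dist x y < e})"

definition open_ell2 :: "'a ell2 set \<Rightarrow> bool" where
  "open_ell2 S \<longleftrightarrow> (\<forall>x\<in>S. \<forall>\<^sub>F (x', y) in uniformity. x' = x \<longrightarrow> y \<in> S)"

lemma ell2_sum_le_norm:
  fixes x :: "'a ell2"
  assumes "finite F"
  shows "L2_set (\<lambda>i. cmod (ell2_coord x i)) F \<le> norm x"
  using assms unfolding L2_set_def
  by transfer (auto intro!: finite_sum_le_infsum)

lemma ell2_norm_le:
  fixes x :: "'a ell2"
  assumes "\<And>F. finite F \<Longrightarrow> L2_set (\<lambda>i. cmod (ell2_coord x i)) F \<le> c" and "0 \<le> c"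
  shows "norm x \<le> c"
proof -
  have "(\<Sum>i\<in>F. (cmod (ell2_coord x i))\<^sup>2) \<le> c\<^sup>2" if "finite F" for F
    using assms(1)[OF that] \<open>0 \<le> c\<close> unfolding L2_set_def by (simp add: real_sqrt_le_iff sqrt_le_D)
  then have "(\<Sum>\<^sub>\<infinity>i. (cmod (ell2_coord x i))\<^sup>2) \<le> c\<^sup>2"
    using ell2_coord[of x] by (intro infsum_le_finite_sums) auto
  then show ?thesis
    using \<open>0 \<le> c\<close> unfolding norm_ell2.rep_eq by (simp add: real_le_lsqrt)
qed

instance
proof
  fix x y z :: "'a ell2" and a b r :: real and c d :: complex
  show "x + y + z = x + (y + z)" "x + y = y + x" "0 + x = x" "- x + x = 0" "x - y = x + - y"
    by (transfer; simp add: fun_eq_iff algebra_simps)+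
  show "a *\<^sub>R (x + y) = a *\<^sub>R x + a *\<^sub>R y" "(a + b) *\<^sub>R x = a *\<^sub>R x + b *\<^sub>R x"
    "a *\<^sub>R b *\<^sub>R x = (a * b) *\<^sub>R x" "1 *\<^sub>R x = x" "r *\<^sub>R x = complex_of_real r *\<^sub>C x"
    unfolding scaleR_ell2_def by (transfer; simp add: fun_eq_iff algebra_simps)+
  show "c *\<^sub>C (x + y) = c *\<^sub>C x + c *\<^sub>C y" "(c + d) *\<^sub>C x = c *\<^sub>C x + d *\<^sub>C x"
    "c *\<^sub>C d *\<^sub>C x = (c * d) *\<^sub>C x" "1 *\<^sub>C x = x"
    by (transfer; simp add: fun_eq_iff algebra_simps)+
  show "sgn x = inverse (norm x) *\<^sub>R x" "dist x y = norm (x - y)"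
    "(uniformity :: ('a ell2 \<times> 'a ell2) filter)
       = (INF e\<in>{0 <..}. principal {(x, y). dist x y < e})"
    by (simp_all add: sgn_ell2_def dist_ell2_def uniformity_ell2_def)
  show "open U \<longleftrightarrow> (\<forall>x\<in>U. \<forall>\<^sub>F (x', y) in uniformity. x' = x \<longrightarrow> y \<in> U)" for U :: "'a ell2 set"
    by (simp add: open_ell2_def)
  show "norm x = 0 \<longleftrightarrow> x = 0"
  proof
    assume "norm x = 0"
    then have "cmod (ell2_coord x i) \<le> 0" for i
      using ell2_sum_le_norm[of "{i}" x] by simp
    then show "x = 0"
      by (simp add: ell2_coord_inject[symmetric] zero_ell2.rep_eq fun_eq_iff)
  qed (transfer; simp)
  show "norm (x + y) \<le> norm x + norm y"
  proof (rule ell2_norm_le)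
    fix F :: "'a set"
    assume F: "finite F"
    have "L2_set (\<lambda>i. cmod (ell2_coord (x + y) i)) F
        \<le> L2_set (\<lambda>i. cmod (ell2_coord x i) + cmod (ell2_coord y i)) F"
      by (intro L2_set_mono) (auto simp: plus_ell2.rep_eq norm_triangle_ineq)
    also have "\<dots> \<le> L2_set (\<lambda>i. cmod (ell2_coord x i)) F + L2_set (\<lambda>i. cmod (ell2_coord y i)) F"
      by (rule L2_set_triangle_ineq)
    also have "\<dots> \<le> norm x + norm y"
      by (intro add_mono ell2_sum_le_norm F)
    finally show "L2_set (\<lambda>i. cmod (ell2_coord (x + y) i)) F \<le> norm x + norm y" .
  next
    show "0 \<le> norm x + norm y"
      using ell2_sum_le_norm[of "{}" x] ell2_sum_le_norm[of "{}" y] by simp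
  qed
  show "norm (a *\<^sub>R x) = \<bar>a\<bar> * norm x"
    unfolding scaleR_ell2_def
    by transfer (simp add: norm_mult power_mult_distrib infsum_cmult_right' real_sqrt_mult)
  show "cinner x y = cnj (cinner y x)"
    by transfer (simp flip: infsum_cnj add: mult.commute)
  show "cinner (x + y) z = cinner x z + cinner y z"
    by transfer (simp add: distrib_right infsum_add square_summable_mult)
  show "cinner (c *\<^sub>C x) y = c * cinner x y"
    by transfer (simp add: mult.assoc infsum_cmult_right')
  show "cinner x x = complex_of_real ((norm x)\<^sup>2)"
  proof transfer
    fix f :: "'a \<Rightarrow> complex"
    assume f: "(\<lambda>i. (cmod (f i))\<^sup>2) summable_on UNIV"
    have "(\<Sum>\<^sub>\<infinity>i. f i * cnj (f i)) = (\<Sum>\<^sub>\<infinity>i. complex_of_real ((cmod (f i))\<^sup>2))"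
      by (simp only: complex_norm_square)
    also have "\<dots> = complex_of_real (\<Sum>\<^sub>\<infinity>i. (cmod (f i))\<^sup>2)"
      using f by (intro infsumI has_sum_of_real has_sum_infsum)
    finally show "(\<Sum>\<^sub>\<infinity>i. f i * cnj (f i)) = complex_of_real ((sqrt (\<Sum>\<^sub>\<infinity>i. (cmod (f i))\<^sup>2))\<^sup>2)"
      by (simp add: infsum_nonneg)
  qed
qed

end

instance ell2 :: (type) chilbert_space
proof
  fix X :: "nat \<Rightarrow> 'a ell2"
  assume "Cauchy X"
  have "Cauchy (\<lambda>n. ell2_coord (X n) i)" for i
  proof (rule metric_CauchyI)
    fix e :: real
    assume "0 < e"
    then obtain N where N: "\<And>m n. m \<ge> N \<Longrightarrow> n \<ge> N \<Longrightarrow> dist (X m) (X n) < e"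
      using \<open>Cauchy X\<close> unfolding Cauchy_def by metis
    have "dist (ell2_coord (X m) i) (ell2_coord (X n) i) \<le> dist (X m) (X n)" for m n
      using ell2_sum_le_norm[of "{i}" "X m - X n"] by (simp add: dist_norm minus_ell2.rep_eq)
    then show "\<exists>M. \<forall>m\<ge>M. \<forall>n\<ge>M. dist (ell2_coord (X m) i) (ell2_coord (X n) i) < e"
      using N by (meson order_le_less_trans)
  qed
  then have "\<exists>l. (\<lambda>n. ell2_coord (X n) i) \<longlonglongrightarrow> l" for i
    by (simp add: Cauchy_convergent_iff convergent_def)
  then obtain L where L: "\<And>i. (\<lambda>n. ell2_coord (X n) i) \<longlonglongrightarrow> L i"
    by metis
  have tail: "\<exists>N. \<forall>n\<ge>N. \<forall>F. finite F \<longrightarrow> L2_set (\<lambda>i. cmod (L i - ell2_coord (X n) i)) F \<le> e"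
    if "0 < e" for e
  proof -
    obtain N where N: "\<And>m n. m \<ge> N \<Longrightarrow> n \<ge> N \<Longrightarrow> dist (X m) (X n) < e"
      using \<open>Cauchy X\<close> \<open>0 < e\<close> unfolding Cauchy_def by metis
    have "L2_set (\<lambda>i. cmod (L i - ell2_coord (X n) i)) F \<le> e" if n: "n \<ge> N" and F: "finite F" for n F
    proof (rule LIMSEQ_le_const2)
      show "(\<lambda>m. L2_set (\<lambda>i. cmod (ell2_coord (X m) i - ell2_coord (X n) i)) F)
              \<longlonglongrightarrow> L2_set (\<lambda>i. cmod (L i - ell2_coord (X n) i)) F"
        unfolding L2_set_def by (intro tendsto_intros L)
      have "L2_set (\<lambda>i. cmod (ell2_coord (X m) i - ell2_coord (X n) i)) F \<le> e" if "m \<ge> N" for m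
        using ell2_sum_le_norm[OF F, of "X m - X n"] N[OF that n]
        by (simp add: minus_ell2.rep_eq dist_norm)
      then show "\<exists>M. \<forall>m\<ge>M. L2_set (\<lambda>i. cmod (ell2_coord (X m) i - ell2_coord (X n) i)) F \<le> e"
        by blast
    qed
    then show ?thesis
      by blast
  qed
  obtain N where N: "\<And>F. finite F \<Longrightarrow> L2_set (\<lambda>i. cmod (L i - ell2_coord (X N) i)) F \<le> 1"
    using tail[of 1] by auto
  have "(\<lambda>i. (cmod (L i - ell2_coord (X N) i))\<^sup>2) summable_on UNIV"
  proof (rule nonneg_bdd_above_summable_on)
    have "(\<Sum>i\<in>F. (cmod (L i - ell2_coord (X N) i))\<^sup>2) \<le> 1" if "finite F" for F
      using N[OF that] unfolding L2_set_def by simp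
    then show "bdd_above (sum (\<lambda>i. (cmod (L i - ell2_coord (X N) i))\<^sup>2) ` {F. F \<subseteq> UNIV \<and> finite F})"
      by (auto intro!: bdd_aboveI[of _ 1])
  qed auto
  from square_summable_add[OF this, of "ell2_coord (X N)"]
  have "(\<lambda>i. (cmod (L i))\<^sup>2) summable_on UNIV"
    using ell2_coord[of "X N"] by simp
  then have coord: "ell2_coord (Abs_ell2 L) = L"
    by (simp add: Abs_ell2_inverse)
  have "X \<longlonglongrightarrow> Abs_ell2 L"
  proof (rule metric_LIMSEQ_I)
    fix e :: real
    assume "0 < e"
    then obtain N where
      "\<And>n F. n \<ge> N \<Longrightarrow> finite F \<Longrightarrow> L2_set (\<lambda>i. cmod (L i - ell2_coord (X n) i)) F \<le> e / 2"
      using tail[of "e / 2"] by auto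
    then have "norm (Abs_ell2 L - X n) \<le> e / 2" if "n \<ge> N" for n
      using that \<open>0 < e\<close> by (intro ell2_norm_le) (auto simp: minus_ell2.rep_eq coord)
    then have "dist (X n) (Abs_ell2 L) < e" if "n \<ge> N" for n
      using that \<open>0 < e\<close> by (fastforce simp: dist_norm norm_minus_commute)
    then show "\<exists>N. \<forall>n\<ge>N. dist (X n) (Abs_ell2 L) < e"
      by blast
  qed
  then show "convergent X"
    by (rule convergentI)
qed

end

theory Submission
  imports Defs "HOL-Complex_Analysis.Cauchy_Integral_Formula"
begin

text \<open>
  If \<open>U1\<close> and \<open>U2\<close> are commuting unitary operators, then each factor \<open>F(z) = (E + z U) (E - z U)\<^sup>-\<^sup>1\<close> is holomorphic
  off the unit circle and at infinity, \<open>F(z)\<^sup>* = -F(1 / cnj z)\<close>, \<open>F(0) = E\<close>, \<open>F(\<infinity>) = -E\<close>, and \<open>F(z) + F(z)\<^sup>*\<close> is positive for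
  \<open>|z| < 1\<close>. These facts for the two factors, which commute, give the conditions
  (\<open>generalized_resolvent_imp_conditions\<close>).

  For the converse, note that a factor has the expansion \<open>E + 2 \<Sum> z\<^sup>n U\<^sup>n\<close> (\<open>n \<ge> 1\<close>) inside the unit circle and
  \<open>-E - 2 \<Sum> z\<^sup>-\<^sup>n U\<^sup>-\<^sup>n\<close> outside. So if \<open>R\<close> comes from \<open>U1\<close> and \<open>U2\<close>, the power series coefficients of \<open>(R h, g)\<close> in the
  four components of its domain are, up to sign and powers of 2, the moments \<open>(U1\<^sup>m U2\<^sup>n h, g)\<close>, where \<open>m\<close> and \<open>n\<close> run over
  the integers. Given only the conditions, one defines numbers \<open>c\<^bsub>m,n\<^esub>(h, g)\<close> by these power series and has to
  recover the operators. The numbers prescribe the scalar products of vectors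
  \<open>\<Phi> (h, m, n)\<close>, which stand for \<open>U1\<^sup>m U2\<^sup>n h\<close>: the product of \<open>\<Phi> (h, m, n)\<close> and \<open>\<Phi> (g, p, q)\<close> has to be
  \<open>c\<^bsub>m-p,n-q\<^esub>(h, g)\<close>.

  The core is that this kernel is positive definite (\<open>moment_kernel_positive_definite\<close>). Inequality (b) of the
  class \<open>H\<^sub>2\<close> says that the double jump \<open>T\<close> of \<open>R\<close> between the points \<open>r w\<close> and \<open>w / r\<close>, \<open>|w| = 1\<close>, in each variable is a positive
  operator, and the numbers \<open>r\<^bsup>|m|+|n|\<^esup> c\<^bsub>m,n\<^esub>\<close> are the Fourier coefficients of \<open>T / 4\<close> on the torus. Replacing the
  integrals over the torus by averages over roots of unity turns the quadratic form of the kernel into a finite sum of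
  terms \<open>(T G, G) \<ge> 0\<close>. Because the averages are finite sums, the passage to the limit can be made in one
  variable at a time, where it is an estimate of Taylor remainders (\<open>jump_average_bound\<close>); then \<open>r\<close> tends to 1.

  A positive definite kernel on an index set \<open>X\<close> is the Gram matrix of a family in the space of square-summable families
  over \<open>X\<close> (\<open>gram_realization\<close>): the vectors are chosen one after the other, by Zorn's lemma, each in the closed span of the
  earlier ones plus one new unit vector. Since the kernel is invariant under the shifts of \<open>m\<close> and \<open>n\<close>, these shifts induce
  commuting unitary operators (\<open>shift_unitary\<close>), and comparing expansions shows that \<open>R\<close> is the compression of
  their Cayley transforms (\<open>conditions_imp_dilation\<close>).
\<close>

section \<open>Complex inner product spaces\<close>

lemma scaleC_zero_left [simp]: "0 *\<^sub>C (x::'a::complex_vector) = 0"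
  using scaleR_scaleC[of 0 x] by simp

lemma scaleC_zero_right [simp]: "c *\<^sub>C (0::'a::complex_vector) = 0"
  using scaleC_add_right[of c 0 "0::'a"] by simp

lemma scaleC_one' [simp]: "1 *\<^sub>C (x::'a::complex_vector) = x"
  by (rule scaleC_one)

lemma scaleC_minus_left [simp]: "(- c) *\<^sub>C (x::'a::complex_vector) = - (c *\<^sub>C x)"
  using scaleC_add_left[of c "-c" x] by (simp add: eq_neg_iff_add_eq_0 add.commute)

lemma scaleC_minus_right [simp]: "c *\<^sub>C (- (x::'a::complex_vector)) = - (c *\<^sub>C x)"
  using scaleC_add_right[of c x "-x"] by (simp add: eq_neg_iff_add_eq_0 add.commute)

lemma scaleC_diff_right: "c *\<^sub>C (x - (y::'a::complex_vector)) = c *\<^sub>C x - c *\<^sub>C y"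
  using scaleC_add_right[of c x "-y"] by simp

lemma scaleC_diff_left: "(c - d) *\<^sub>C (x::'a::complex_vector) = c *\<^sub>C x - d *\<^sub>C x"
  using scaleC_add_left[of c "-d" x] by simp

lemma scaleC_sum_right: "c *\<^sub>C (\<Sum>i\<in>F. f i :: 'a::complex_vector) = (\<Sum>i\<in>F. c *\<^sub>C f i)"
  by (induction F rule: infinite_finite_induct) (auto simp: scaleC_add_right)

lemma cinner_zero_left [simp]: "cinner 0 (y::'a::complex_inner) = 0"
  using cinner_scaleC_left[of 0 "0::'a" y] by simp

lemma cinner_minus_left [simp]: "cinner (- x) (y::'a::complex_inner) = - cinner x y"
  using cinner_scaleC_left[of "-1" x y] by simp

lemma cinner_diff_left: "cinner (x - x') (y::'a::complex_inner) = cinner x y - cinner x' y"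
  using cinner_add_left[of x "-x'" y] by simp

lemma cinner_add_right: "cinner x (y + z :: 'a::complex_inner) = cinner x y + cinner x z"
  by (subst (1 2 3) cinner_commute) (simp add: cinner_add_left)

lemma cinner_scaleC_right: "cinner x (c *\<^sub>C y :: 'a::complex_inner) = cnj c * cinner x y"
  by (subst (1 2) cinner_commute) (simp add: cinner_scaleC_left)

lemma cinner_zero_right [simp]: "cinner (y::'a::complex_inner) 0 = 0"
  by (subst cinner_commute) simp

lemma cinner_minus_right [simp]: "cinner (x::'a::complex_inner) (- y) = - cinner x y"
  by (subst (1 2) cinner_commute) simp

lemma cinner_diff_right: "cinner x (y - z :: 'a::complex_inner) = cinner x y - cinner x z"
  using cinner_add_right[of x y "-z"] by simp

lemma cinner_sum_left: "cinner (\<Sum>i\<in>F. f i) (y::'a::complex_inner) = (\<Sum>i\<in>F. cinner (f i) y)"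
  by (induction F rule: infinite_finite_induct) (auto simp: cinner_add_left)

lemma cinner_sum_right: "cinner (y::'a::complex_inner) (\<Sum>i\<in>F. f i) = (\<Sum>i\<in>F. cinner y (f i))"
  by (induction F rule: infinite_finite_induct) (auto simp: cinner_add_right)

lemma cinner_self_eq_0 [simp]: "cinner x x = 0 \<longleftrightarrow> (x::'a::complex_inner) = 0"
  by (simp add: cinner_norm)

lemma cinner_eqI:
  assumes "\<And>z. cinner x z = cinner y (z::'a::complex_inner)"
  shows "x = y"
  using assms[of "x - y"] cinner_self_eq_0[of "x - y"] by (simp add: cinner_diff_left)

lemma cinner_eqI_right:
  assumes "\<And>z. cinner z x = cinner z (y::'a::complex_inner)"
  shows "x = y"
  using assms[of "x - y"] cinner_self_eq_0[of "x - y"] by (simp add: cinner_diff_right)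

lemma norm_eq_cinner: "(norm (x::'a::complex_inner))\<^sup>2 = Re (cinner x x)"
  by (simp add: cinner_norm)

lemma norm_scaleC: "norm (c *\<^sub>C (x::'a::complex_inner)) = cmod c * norm x"
proof -
  have "complex_of_real ((norm (c *\<^sub>C x))\<^sup>2) = complex_of_real ((cmod c * norm x)\<^sup>2)"
    unfolding cinner_norm[symmetric] cinner_scaleC_left cinner_scaleC_right
    using complex_norm_square[of c] by (auto simp: cinner_norm power_mult_distrib mult_ac)
  then show ?thesis
    unfolding of_real_eq_iff by (simp add: power2_eq_iff_nonneg)
qed

lemma norm_add_square:
  "(norm (x + y))\<^sup>2 = (norm x)\<^sup>2 + (norm y)\<^sup>2 + 2 * Re (cinner x (y::'a::complex_inner))"
proof -
  have "Re (cinner y x) = Re (cinner x y)"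
    by (subst cinner_commute) simp
  then show ?thesis
    unfolding norm_eq_cinner cinner_add_left cinner_add_right by simp
qed

lemma norm_diff_square:
  "(norm (x - y))\<^sup>2 = (norm x)\<^sup>2 + (norm y)\<^sup>2 - 2 * Re (cinner x (y::'a::complex_inner))"
  using norm_add_square[of x "-y"] by simp

lemma cauchy_schwarz: "cmod (cinner x y) \<le> norm x * norm (y::'a::complex_inner)"
proof (cases "y = 0")
  case False
  define c where "c = cinner x y / complex_of_real ((norm y)\<^sup>2)"
  have ny: "(norm y)\<^sup>2 > 0" using False by simp
  have "0 \<le> (norm (x - c *\<^sub>C y))\<^sup>2" by simp
  also have "(norm (x - c *\<^sub>C y))\<^sup>2
      = (norm x)\<^sup>2 + (cmod c * norm y)\<^sup>2 - 2 * Re (cnj c * cinner x y)"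
    by (simp add: norm_diff_square norm_scaleC cinner_scaleC_right)
  also have "cnj c * cinner x y = complex_of_real ((cmod (cinner x y))\<^sup>2 / (norm y)\<^sup>2)"
    unfolding c_def complex_norm_square of_real_divide by simp
  also have "(cmod c * norm y)\<^sup>2 = (cmod (cinner x y))\<^sup>2 / (norm y)\<^sup>2"
    using ny by (simp add: c_def norm_divide norm_power power_mult_distrib power_divide) (simp add: power2_eq_square power4_eq_xxxx)
  finally have "(cmod (cinner x y))\<^sup>2 / (norm y)\<^sup>2 \<le> (norm x)\<^sup>2"
    unfolding Re_complex_of_real by linarith
  then have "(cmod (cinner x y))\<^sup>2 \<le> (norm x * norm y)\<^sup>2"
    using ny by (simp add: divide_simps power_mult_distrib split: if_splits)
  then show ?thesis
    by (rule power2_le_imp_le) simp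
qed simp

lemma bounded_bilinear_cinner:
  "bounded_bilinear (cinner :: 'a::complex_inner \<Rightarrow> 'a \<Rightarrow> complex)"
proof
  show "\<exists>K. \<forall>a b :: 'a. cmod (cinner a b) \<le> norm a * norm b * K"
    by (intro exI[of _ 1]) (simp add: cauchy_schwarz)
qed (simp_all add: cinner_add_left cinner_add_right scaleR_scaleC cinner_scaleC_left
       cinner_scaleC_right scaleR_conv_of_real)

lemmas tendsto_cinner = bounded_bilinear.tendsto[OF bounded_bilinear_cinner]

lemma bounded_bilinear_scaleC:
  "bounded_bilinear (scaleC :: complex \<Rightarrow> 'a::complex_inner \<Rightarrow> 'a)"
proof
  show "\<exists>K. \<forall>a. \<forall>b :: 'a. norm (a *\<^sub>C b) \<le> norm a * norm b * K"
    by (intro exI[of _ 1]) (simp add: norm_scaleC)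
qed (simp_all add: scaleC_add_left scaleC_add_right scaleR_scaleC scaleC_scaleC
      scaleR_conv_of_real mult.commute)

lemma cinner_polarization:
  assumes "clinear_map A"
  shows "4 * cinner (A u) (v::'a::complex_inner) =
    cinner (A (u + v)) (u + v) - cinner (A (u - v)) (u - v)
      + \<i> * cinner (A (u + \<i> *\<^sub>C v)) (u + \<i> *\<^sub>C v) - \<i> * cinner (A (u - \<i> *\<^sub>C v)) (u - \<i> *\<^sub>C v)"
proof -
  have add: "A (x + y) = A x + A y" and sc: "A (c *\<^sub>C x) = c *\<^sub>C A x" for c x y
    using assms by (auto simp: clinear_map_def)
  have df: "A (x - y) = A x - A y" for x y
    using add[of "x - y" y] by (simp add: algebra_simps)
  show ?thesis
    by (simp add: add df sc cinner_add_left cinner_add_right cinner_diff_left cinner_diff_right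
        cinner_scaleC_left cinner_scaleC_right algebra_simps)
qed

lemma norm_preserving_imp_cinner_preserving:
  fixes A :: "'a::complex_inner \<Rightarrow> 'b::complex_inner"
  assumes lin: "clinear_map A" and n: "\<And>x. norm (A x) = norm x"
  shows "cinner (A x) (A y) = cinner x y"
proof -
  have add: "A (x + y) = A x + A y" and sc: "A (c *\<^sub>C x) = c *\<^sub>C A x" for c x y
    using lin by (auto simp: clinear_map_def)
  have re: "Re (cinner (A x) (A y)) = Re (cinner x y)" for x y
    using norm_add_square[of "A x" "A y"] norm_add_square[of x y] n[of "x + y"]
    by (simp add: add n)
  have "Im (cinner (A x) (A y)) = Im (cinner x y)"
    using re[of x "\<i> *\<^sub>C y"] by (simp add: sc cinner_scaleC_right)
  with re show ?thesis by (simp add: complex_eq_iff)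
qed

section \<open>The Riesz representation theorem\<close>

text \<open>For small \<open>t\<close> of the sign opposite to that of \<open>a\<close>, the linear term dominates the quadratic one.\<close>

lemma quadratic_nonneg_imp_linear_zero:
  fixes a b :: real
  assumes "\<And>t. 2 * t * a + t\<^sup>2 * b \<ge> 0"
  shows "a = 0"
proof (rule ccontr)
  assume "a \<noteq> 0"
  define s where "s = \<bar>b\<bar> + 1"
  have s: "s > 0" "b < s" by (auto simp: s_def)
  have "2 * (- a / s) * a + (- a / s)\<^sup>2 * b = (a\<^sup>2 / s) * (b / s - 2)"
    using s by (simp add: power2_eq_square field_simps)
  also have "\<dots> < 0"
    using s \<open>a \<noteq> 0\<close> by (intro mult_pos_neg divide_pos_pos) (auto simp: divide_simps)
  finally show False using assms[of "- a / s"] by simp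
qed

text \<open>The functional is given by its graph \<open>G\<close>, which need not be closed; the bound makes \<open>G\<close> single
  valued. The representing vector minimizes \<open>\<parallel>u\<parallel>\<^sup>2 - 2 Re l\<close> over the pairs \<open>(u, l)\<close> of \<open>G\<close>: the
  parallelogram law makes minimizing sequences Cauchy.\<close>

lemma riesz_graph:
  fixes G :: "('a::chilbert_space \<times> complex) set"
  assumes zero: "(0, 0) \<in> G"
    and add: "\<And>u l u' l'. (u, l) \<in> G \<Longrightarrow> (u', l') \<in> G \<Longrightarrow> (u + u', l + l') \<in> G"
    and scale: "\<And>c u l. (u, l) \<in> G \<Longrightarrow> (c *\<^sub>C u, c * l) \<in> G"
    and bound: "\<And>u l. (u, l) \<in> G \<Longrightarrow> cmod l \<le> C * norm u"
  obtains w where "\<And>u l. (u, l) \<in> G \<Longrightarrow> cinner u w = l" "norm w \<le> C \<or> w = 0"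
    "\<And>v. (\<And>u l. (u, l) \<in> G \<Longrightarrow> cinner u v = 0) \<Longrightarrow> cinner w v = 0"
proof -
  define q where "q = (\<lambda>p::'a \<times> complex. (norm (fst p))\<^sup>2 - 2 * Re (snd p))"
  define d where "d = Inf (q ` G)"
  have lower: "- C\<^sup>2 \<le> q p" if "p \<in> G" for p
  proof -
    have "Re (snd p) \<le> C * norm (fst p)"
      using bound[of "fst p" "snd p"] that complex_Re_le_cmod[of "snd p"] by simp
    moreover have "0 \<le> (norm (fst p) - C)\<^sup>2" by simp
    ultimately show ?thesis unfolding q_def power2_diff by (simp add: mult.commute)
  qed
  have bdd: "bdd_below (q ` G)" using lower by (intro bdd_belowI[of _ "- C\<^sup>2"]) auto
  have dle: "d \<le> q p" if "p \<in> G" for p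
    unfolding d_def using bdd that by (intro cInf_lower) auto
  have "\<exists>p\<in>G. q p < d + 1 / real (Suc n)" for n
    using cInf_lessD[of "q ` G" "d + 1 / real (Suc n)"] zero unfolding d_def by fastforce
  then obtain P where P: "\<And>n. P n \<in> G" "\<And>n. q (P n) < d + 1 / real (Suc n)" by metis
  define U where "U = (\<lambda>n. fst (P n))"
  define L where "L = (\<lambda>n. snd (P n))"
  have UL: "(U n, L n) \<in> G" for n using P(1) by (simp add: U_def L_def)
  have qP: "(norm (U n))\<^sup>2 - 2 * Re (L n) < d + 1 / real (Suc n)" for n
    using P(2)[of n] by (simp add: q_def U_def L_def)
  have par: "(norm (U n - U m))\<^sup>2 \<le> 2 / real (Suc n) + 2 / real (Suc m)" for m n
  proof -
    have "((1/2) *\<^sub>C (U n + U m), (1/2) * (L n + L m)) \<in> G" by (intro scale add UL)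
    from dle[OF this] have "4 * d \<le> (norm (U n + U m))\<^sup>2 - 4 * Re (L n + L m)"
      by (simp add: q_def norm_scaleC norm_divide power_divide power_mult_distrib field_simps)
    then show ?thesis
      using qP[of n] qP[of m] unfolding norm_add_square norm_diff_square by (simp add: algebra_simps)
  qed
  have "Cauchy U"
  proof (rule metric_CauchyI)
    fix e :: real assume "0 < e"
    obtain N where N: "4 / e\<^sup>2 < real N" using reals_Archimedean2[of "4 / e\<^sup>2"] ..
    have "dist (U m) (U n) < e" if "m \<ge> N" "n \<ge> N" for m n
    proof -
      have N0: "real N > 0" using order.strict_trans[OF divide_pos_pos[of 4 "e\<^sup>2"] N] \<open>0 < e\<close> by simp
      have "2 / real (Suc m) \<le> 2 / real N" "2 / real (Suc n) \<le> 2 / real N"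
        using that N0 by (auto intro!: divide_left_mono)
      then have "(norm (U m - U n))\<^sup>2 \<le> 4 / real N" using par[of m n] by simp
      also have "\<dots> < e\<^sup>2" using N N0 zero_less_power[OF \<open>0 < e\<close>, of 2] by (auto simp: divide_less_eq mult.commute)
      finally show ?thesis using \<open>0 < e\<close> by (simp add: dist_norm power_less_imp_less_base)
    qed
    then show "\<exists>M. \<forall>m\<ge>M. \<forall>n\<ge>M. dist (U m) (U n) < e" by blast
  qed
  then obtain w where w: "U \<longlonglongrightarrow> w" by (auto simp: Cauchy_convergent_iff convergent_def)
  have re: "Re (cinner w u) = Re l" if ul: "(u, l) \<in> G" for u l
  proof -
    have "2 * t * (Re (cinner w u) - Re l) + t\<^sup>2 * (norm u)\<^sup>2 \<ge> 0" for t :: real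
    proof -
      have ineq: "2 * t * (Re (cinner (U n) u) - Re l) + t\<^sup>2 * (norm u)\<^sup>2 + 1 / real (Suc n) \<ge> 0" for n
      proof -
        have "(U n + complex_of_real t *\<^sub>C u, L n + complex_of_real t * l) \<in> G"
          by (intro add scale UL ul)
        from dle[OF this] show ?thesis
          using qP[of n]
          by (simp add: q_def norm_add_square norm_scaleC cinner_scaleC_right power_mult_distrib
              algebra_simps)
      qed
      have inv0: "(\<lambda>n. 1 / real (Suc n)) \<longlonglongrightarrow> 0"
        using LIMSEQ_Suc[OF lim_inverse_n'] .
      have "(\<lambda>n. 2 * t * (Re (cinner (U n) u) - Re l) + t\<^sup>2 * (norm u)\<^sup>2 + 1 / real (Suc n))
         \<longlonglongrightarrow> 2 * t * (Re (cinner w u) - Re l) + t\<^sup>2 * (norm u)\<^sup>2 + 0"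
        by (intro tendsto_intros tendsto_cinner w inv0)
      from LIMSEQ_le_const[OF this] ineq show ?thesis by auto
    qed
    from quadratic_nonneg_imp_linear_zero[OF this] show ?thesis by simp
  qed
  have rep: "cinner u w = l" if ul: "(u, l) \<in> G" for u l
  proof -
    have "Re (cinner w (\<i> *\<^sub>C u)) = Re (\<i> * l)" by (intro re scale ul)
    then have "Im (cinner w u) = - Im l" by (simp add: cinner_scaleC_right)
    with re[OF ul] show ?thesis
      by (subst cinner_commute) (simp add: complex_eq_iff)
  qed
  have "norm w \<le> C \<or> w = 0"
  proof -
    have "cmod (cinner (U n) w) \<le> C * norm (U n)" for n using bound[OF UL] rep[OF UL] by simp
    moreover have "(\<lambda>n. cmod (cinner (U n) w)) \<longlonglongrightarrow> cmod (cinner w w)"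
      by (intro tendsto_intros tendsto_cinner w)
    moreover have "(\<lambda>n. C * norm (U n)) \<longlonglongrightarrow> C * norm w" by (intro tendsto_intros w)
    ultimately have "cmod (cinner w w) \<le> C * norm w"
      by (intro LIMSEQ_le[of _ _ "\<lambda>n. C * norm (U n)"]) auto
    then have "norm w * norm w \<le> C * norm w" by (simp add: cinner_norm power2_eq_square norm_mult)
    then show ?thesis by (cases "w = 0") auto
  qed
  moreover have "cinner w v = 0" if "\<And>u l. (u, l) \<in> G \<Longrightarrow> cinner u v = 0" for v
  proof -
    have "(\<lambda>n. cinner (U n) v) \<longlonglongrightarrow> cinner w v" by (intro tendsto_cinner w tendsto_const)
    then show ?thesis using that[OF UL] by (simp add: LIMSEQ_const_iff)
  qed
  ultimately show ?thesis using that rep by blast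
qed

text \<open>A functional given by its values \<open>b y\<close> on a family of vectors is represented by a vector \<open>w\<close>
  as soon as it is bounded on finite linear combinations; well-definedness on the span is part of the bound.
  The last property puts \<open>w\<close> into the closed span of the family, which makes it unique.\<close>

lemma riesz_family:
  fixes \<psi> :: "'i \<Rightarrow> 'a::chilbert_space"
  assumes bound: "\<And>F c. finite F \<Longrightarrow> F \<subseteq> A \<Longrightarrow>
      cmod (\<Sum>y\<in>F. c y * b y) \<le> C * norm (\<Sum>y\<in>F. c y *\<^sub>C \<psi> y)"
    and C: "C \<ge> 0"
  obtains w where "\<And>y. y \<in> A \<Longrightarrow> cinner (\<psi> y) w = b y" "norm w \<le> C"
    "\<And>v. (\<And>y. y \<in> A \<Longrightarrow> cinner (\<psi> y) v = 0) \<Longrightarrow> cinner w v = 0"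
proof -
  define G where "G = {(\<Sum>y\<in>F. c y *\<^sub>C \<psi> y, \<Sum>y\<in>F. c y * b y) | F c. finite F \<and> F \<subseteq> A}"
  have zero: "(0, 0) \<in> G" unfolding G_def by (force intro!: exI[of _ "{}"])
  have add: "(u + u', l + l') \<in> G" if "(u, l) \<in> G" "(u', l') \<in> G" for u l u' l'
  proof -
    obtain F c F' c' where F: "finite F" "F \<subseteq> A" "u = (\<Sum>y\<in>F. c y *\<^sub>C \<psi> y)" "l = (\<Sum>y\<in>F. c y * b y)"
      and F': "finite F'" "F' \<subseteq> A" "u' = (\<Sum>y\<in>F'. c' y *\<^sub>C \<psi> y)" "l' = (\<Sum>y\<in>F'. c' y * b y)"
      using \<open>(u, l) \<in> G\<close> \<open>(u', l') \<in> G\<close> unfolding G_def by blast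
    define d where "d = (\<lambda>y. if y \<in> F then c y else 0)"
    define d' where "d' = (\<lambda>y. if y \<in> F' then c' y else 0)"
    have "u = (\<Sum>y\<in>F \<union> F'. d y *\<^sub>C \<psi> y)" "l = (\<Sum>y\<in>F \<union> F'. d y * b y)"
      unfolding F d_def using F(1) F'(1) by (auto intro!: sum.mono_neutral_cong_left)
    moreover have "u' = (\<Sum>y\<in>F \<union> F'. d' y *\<^sub>C \<psi> y)" "l' = (\<Sum>y\<in>F \<union> F'. d' y * b y)"
      unfolding F' d'_def using F(1) F'(1) by (auto intro!: sum.mono_neutral_cong_left)
    ultimately have "u + u' = (\<Sum>y\<in>F \<union> F'. (d y + d' y) *\<^sub>C \<psi> y)"
      "l + l' = (\<Sum>y\<in>F \<union> F'. (d y + d' y) * b y)"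
      by (simp_all add: sum.distrib scaleC_add_left distrib_right)
    then show ?thesis
      unfolding G_def using F F' by (intro CollectI exI[of _ "F \<union> F'"] exI[of _ "\<lambda>y. d y + d' y"]) auto
  qed
  have scale: "(a *\<^sub>C u, a * l) \<in> G" if "(u, l) \<in> G" for a u l
  proof -
    obtain F c where F: "finite F" "F \<subseteq> A" "u = (\<Sum>y\<in>F. c y *\<^sub>C \<psi> y)" "l = (\<Sum>y\<in>F. c y * b y)"
      using \<open>(u, l) \<in> G\<close> unfolding G_def by blast
    then show ?thesis
      unfolding G_def
      by (intro CollectI exI[of _ F] exI[of _ "\<lambda>y. a * c y"])
         (auto simp: scaleC_sum_right scaleC_scaleC sum_distrib_left mult.assoc)
  qed
  have bnd: "cmod l \<le> C * norm u" if "(u, l) \<in> G" for u l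
    using that bound unfolding G_def by blast
  obtain w where w: "\<And>u l. (u, l) \<in> G \<Longrightarrow> cinner u w = l" "norm w \<le> C \<or> w = 0"
    "\<And>v. (\<And>u l. (u, l) \<in> G \<Longrightarrow> cinner u v = 0) \<Longrightarrow> cinner w v = 0"
    by (rule riesz_graph[OF zero add scale bnd]) blast+
  show ?thesis
  proof (rule that[of w])
    show "cinner (\<psi> y) w = b y" if "y \<in> A" for y
    proof (rule w(1))
      show "(\<psi> y, b y) \<in> G"
        unfolding G_def
        by (rule CollectI, rule exI[of _ "{y}"], rule exI[of _ "\<lambda>_. 1"]) (simp add: that)
    qed
    show "norm w \<le> C" using w(2) C by auto
    show "cinner w v = 0" if "\<And>y. y \<in> A \<Longrightarrow> cinner (\<psi> y) v = 0" for v
    proof (rule w(3))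
      fix u l assume "(u, l) \<in> G"
      then obtain F c where F: "F \<subseteq> A" and u: "u = (\<Sum>y\<in>F. c y *\<^sub>C \<psi> y)"
        unfolding G_def by blast
      have "cinner (\<psi> y) v = 0" if "y \<in> F" for y
        using F that \<open>\<And>y. y \<in> A \<Longrightarrow> cinner (\<psi> y) v = 0\<close> by blast
      then show "cinner u v = 0"
        by (simp add: u cinner_sum_left cinner_scaleC_left)
    qed
  qed
qed

lemma clinear_map_add: "clinear_map A \<Longrightarrow> A (x + y) = A x + A y"
  by (simp add: clinear_map_def)

lemma clinear_map_scaleC: "clinear_map A \<Longrightarrow> A (c *\<^sub>C x) = c *\<^sub>C A x"
  by (simp add: clinear_map_def)

lemma clinear_map_zero: "clinear_map A \<Longrightarrow> A 0 = 0"
  using clinear_map_scaleC[of A 0 0] by simp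

lemma clinear_map_uminus: "clinear_map A \<Longrightarrow> A (- x) = - A x"
  using clinear_map_scaleC[of A "-1" x] by simp

lemma clinear_map_diff: "clinear_map A \<Longrightarrow> A (x - y) = A x - A y"
  using clinear_map_add[of A x "-y"] by (simp add: clinear_map_uminus)

lemma clinear_map_sum: "clinear_map A \<Longrightarrow> A (\<Sum>i\<in>F. f i) = (\<Sum>i\<in>F. A (f i))"
  by (induction F rule: infinite_finite_induct) (auto simp: clinear_map_add clinear_map_zero)

text \<open>The range of an isometry \<open>J\<close> of a Hilbert space is complete, so the projection exists; it is
  \<open>J J\<^sup>*\<close>, and \<open>J\<^sup>* v\<close> represents the functional \<open>g \<mapsto> (J g, v)\<close>.\<close>

lemma orth_projection_range_isometry:
  fixes J :: "'a::chilbert_space \<Rightarrow> 'b::chilbert_space"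
  assumes J: "clinear_map J" "\<And>x y. cinner (J x) (J y) = cinner x y"
  shows "J h = orth_projection (range J) v \<longleftrightarrow> (\<forall>g. cinner h g = cinner v (J g))"
proof -
  have nJ: "norm (J x) = norm x" for x
    using J(2)[of x x] unfolding cinner_norm of_real_eq_iff by (simp add: power2_eq_iff_nonneg)
  have uniq: "orth_projection (range J) v = J k" if k: "\<And>g. cinner k g = cinner v (J g)" for k
    unfolding orth_projection_def
  proof (rule the_equality)
    show "J k \<in> range J \<and> (\<forall>m\<in>range J. cinner (v - J k) m = 0)"
      using k by (auto simp: cinner_diff_left J)
    fix y assume y: "y \<in> range J \<and> (\<forall>m\<in>range J. cinner (v - y) m = 0)"
    then obtain l where "y = J l" by blast
    then have "cinner l g = cinner k g" for g using y k by (auto simp: cinner_diff_left J)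
    then have "l = k" by (rule cinner_eqI)
    with \<open>y = J l\<close> show "y = J k" by simp
  qed
  have bnd: "cmod (\<Sum>y\<in>F. c y * cinner (J y) v) \<le> norm v * norm (\<Sum>y\<in>F. c y *\<^sub>C y)" for F c
  proof -
    have "(\<Sum>y\<in>F. c y * cinner (J y) v) = cinner (J (\<Sum>y\<in>F. c y *\<^sub>C y)) v"
      by (simp add: clinear_map_sum[OF J(1)] clinear_map_scaleC[OF J(1)] cinner_sum_left
          cinner_scaleC_left)
    also have "cmod \<dots> \<le> norm (J (\<Sum>y\<in>F. c y *\<^sub>C y)) * norm v" by (rule cauchy_schwarz)
    finally show ?thesis by (simp add: nJ mult.commute)
  qed
  obtain w where w: "\<And>g. cinner g w = cinner (J g) v"
    by (rule riesz_family[where \<psi> = "\<lambda>y. y" and A = UNIV and b = "\<lambda>y. cinner (J y) v", OF bnd])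
       auto
  have w': "cinner w g = cinner v (J g)" for g
    using w[of g] by (subst (1 2) cinner_commute) simp
  have inj: "h = w" if "J h = J w"
    using that nJ[of "h - w"] by (simp add: clinear_map_diff[OF J(1)])
  show ?thesis
  proof
    assume "J h = orth_projection (range J) v"
    with uniq[OF w'] inj w' show "\<forall>g. cinner h g = cinner v (J g)" by simp
  qed (use uniq in metis)
qed


section \<open>The Cayley transform of a unitary operator\<close>

lemma unitary_clinear: "unitary U \<Longrightarrow> clinear_map U"
  by (simp add: unitary_def)

lemma unitary_cinner: "unitary U \<Longrightarrow> cinner (U x) (U y) = cinner x y"
  by (simp add: unitary_def)

lemma unitary_norm: "unitary U \<Longrightarrow> norm (U x) = norm x"
  using unitary_cinner[of U x x] unfolding cinner_norm of_real_eq_iff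
  by (simp add: power2_eq_iff_nonneg)

lemma unitary_bij: assumes "unitary U" shows "bij U"
proof (rule bijI)
  show "inj U"
  proof (rule injI)
    fix x y assume "U x = U y"
    then show "x = y"
      using unitary_norm[OF assms, of "x - y"] by (simp add: clinear_map_diff[OF unitary_clinear[OF assms]])
  qed
  show "surj U" using assms by (simp add: unitary_def)
qed

lemma unitary_inv_left [simp]: "unitary U \<Longrightarrow> inv U (U x) = x"
  by (simp add: bij_is_inj inv_f_f unitary_bij)

lemma unitary_inv_right [simp]: "unitary U \<Longrightarrow> U (inv U x) = x"
  by (simp add: unitary_def surj_f_inv_f)

lemma unitary_inv:
  fixes U :: "'a::complex_inner \<Rightarrow> 'a"
  assumes U: "unitary U"
  shows "unitary (inv U)"
proof -
  note lin = unitary_clinear[OF U]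
  have "inv U (x + y) = inv U x + inv U y" for x y
    using unitary_inv_left[OF U, of "inv U x + inv U y"] by (simp add: clinear_map_add[OF lin] U)
  moreover have "inv U (c *\<^sub>C x) = c *\<^sub>C inv U x" for c x
    using unitary_inv_left[OF U, of "c *\<^sub>C inv U x"] by (simp add: clinear_map_scaleC[OF lin] U)
  moreover have "cinner (inv U x) (inv U y) = cinner x y" for x y
    using unitary_cinner[OF U, of "inv U x" "inv U y"] by (simp add: U)
  ultimately show ?thesis
    using unitary_bij[OF U] by (simp add: unitary_def clinear_map_def bij_is_surj bij_imp_bij_inv)
qed

lemma unitary_inv_inv: "unitary U \<Longrightarrow> inv (inv U) = U"
  by (simp add: inv_inv_eq unitary_bij)

lemma unitary_adjoint: "unitary U \<Longrightarrow> cinner (U x) y = cinner x (inv U y)"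
  using unitary_cinner[of U x "inv U y"] by simp

lemma open_Te: "open Te"
proof -
  have "Te = {z. cmod z < 1} \<union> {z. cmod z > 1}" by (auto simp: Te_def)
  moreover have "open {z. cmod z < 1}" "open {z. cmod z > 1}"
    by (intro open_Collect_less continuous_intros)+
  ultimately show ?thesis by (metis open_Un)
qed

text \<open>Surjectivity is Banach's fixed point theorem: \<open>x - z U x = y\<close> says that \<open>x\<close> is a fixed point of
  \<open>x \<mapsto> y + z U x\<close> and also of \<open>x \<mapsto> z\<^sup>-\<^sup>1 U\<^sup>-\<^sup>1 (x - y)\<close>, and one of the two maps contracts.\<close>

lemma bij_one_minus_scaled_unitary:
  fixes U :: "'a::chilbert_space \<Rightarrow> 'a"
  assumes U: "unitary U" and z: "z \<in> Te"
  shows "bij (\<lambda>x. x - z *\<^sub>C U x)"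
proof (rule bijI)
  note lin = unitary_clinear[OF U]
  show "inj (\<lambda>x. x - z *\<^sub>C U x)"
  proof (rule injI)
    fix x y assume "x - z *\<^sub>C U x = y - z *\<^sub>C U y"
    then have "x - y = z *\<^sub>C U (x - y)"
      by (simp add: clinear_map_diff[OF lin] scaleC_diff_right algebra_simps)
    then have "norm (x - y) = cmod z * norm (x - y)"
      by (metis norm_scaleC unitary_norm[OF U])
    then show "x = y" using z by (auto simp: Te_def)
  qed
  show "surj (\<lambda>x. x - z *\<^sub>C U x)"
  proof -
    have "\<exists>x. x - z *\<^sub>C U x = y" for y
    proof (cases "cmod z < 1")
      case True
      have "dist (y + z *\<^sub>C U a) (y + z *\<^sub>C U b) \<le> cmod z * dist a b" for a b
        using norm_scaleC[of z "U (a - b)"] unitary_norm[OF U, of "a - b"]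
        by (simp add: dist_norm clinear_map_diff[OF lin] scaleC_diff_right)
      then have "\<exists>!x. y + z *\<^sub>C U x = x" using True by (intro banach_fix_type) auto
      then show ?thesis by (metis add_diff_cancel_right')
    next
      case False
      then have z1: "cmod z > 1" using z by (auto simp: Te_def)
      then have z0: "z \<noteq> 0" by auto
      note lin' = unitary_clinear[OF unitary_inv[OF U]]
      have "dist ((1/z) *\<^sub>C inv U (a - y)) ((1/z) *\<^sub>C inv U (b - y)) \<le> (1 / cmod z) * dist a b" for a b
        using norm_scaleC[of "1/z" "inv U (a - b)"] unitary_norm[OF unitary_inv[OF U], of "a - b"]
        by (simp add: dist_norm clinear_map_diff[OF lin'] scaleC_diff_right norm_divide)
      moreover have "0 \<le> 1 / cmod z" "1 / cmod z < 1" using z1 by (auto simp: divide_less_eq)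
      ultimately have "\<exists>!x. (1/z) *\<^sub>C inv U (x - y) = x" by (intro banach_fix_type) auto
      then obtain x where x: "(1/z) *\<^sub>C inv U (x - y) = x" by blast
      have "z *\<^sub>C U x = z *\<^sub>C U ((1/z) *\<^sub>C inv U (x - y))" using x by simp
      also have "\<dots> = x - y" using z0 by (simp add: clinear_map_scaleC[OF lin] U scaleC_scaleC)
      finally show ?thesis by (intro exI[of _ x]) simp
    qed
    then show ?thesis by (metis surj_def)
  qed
qed

definition unitary_resolvent :: "complex \<Rightarrow> ('a::complex_vector \<Rightarrow> 'a) \<Rightarrow> 'a \<Rightarrow> 'a" where
  "unitary_resolvent z U = inv (\<lambda>x. x - z *\<^sub>C U x)"

context
  fixes U :: "'a::chilbert_space \<Rightarrow> 'a" and z :: complex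
  assumes U: "unitary U" and z: "z \<in> Te"
begin

lemma unitary_resolvent_solves: "unitary_resolvent z U x - z *\<^sub>C U (unitary_resolvent z U x) = x"
  unfolding unitary_resolvent_def
  using bij_one_minus_scaled_unitary[OF U z] by (intro surj_f_inv_f[where f = "\<lambda>x. x - z *\<^sub>C U x"]) (rule bij_is_surj)

lemma unitary_resolvent_unique: "y - z *\<^sub>C U y = x \<Longrightarrow> unitary_resolvent z U x = y"
  unfolding unitary_resolvent_def
  using bij_one_minus_scaled_unitary[OF U z] by (auto intro!: inv_f_eq bij_is_inj)

lemma unitary_resolvent_linear: "clinear_map (unitary_resolvent z U)"
  unfolding clinear_map_def
proof (intro conjI allI; rule unitary_resolvent_unique)
  note lin = unitary_clinear[OF U]
  fix x y :: 'a and c :: complex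
  let ?S = "unitary_resolvent z U"
  have "?S x + ?S y - z *\<^sub>C U (?S x + ?S y) = (?S x - z *\<^sub>C U (?S x)) + (?S y - z *\<^sub>C U (?S y))"
    by (simp add: clinear_map_add[OF lin] scaleC_add_right algebra_simps)
  then show "?S x + ?S y - z *\<^sub>C U (?S x + ?S y) = x + y"
    by (simp add: unitary_resolvent_solves)
  have "c *\<^sub>C ?S x - z *\<^sub>C U (c *\<^sub>C ?S x) = c *\<^sub>C (?S x - z *\<^sub>C U (?S x))"
    by (simp add: clinear_map_scaleC[OF lin] scaleC_diff_right scaleC_scaleC mult.commute)
  then show "c *\<^sub>C ?S x - z *\<^sub>C U (c *\<^sub>C ?S x) = c *\<^sub>C x"
    by (simp add: unitary_resolvent_solves)
qed

lemma unitary_resolvent_bound: "norm (unitary_resolvent z U x) \<le> norm x / \<bar>1 - cmod z\<bar>"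
proof -
  let ?y = "unitary_resolvent z U x"
  have "\<bar>norm ?y - norm (z *\<^sub>C U ?y)\<bar> \<le> norm (?y - z *\<^sub>C U ?y)"
    by (rule norm_triangle_ineq3)
  moreover have "norm ?y - norm (z *\<^sub>C U ?y) = (1 - cmod z) * norm ?y"
    by (simp add: norm_scaleC unitary_norm[OF U] algebra_simps)
  ultimately have "\<bar>1 - cmod z\<bar> * norm ?y \<le> norm x"
    by (simp add: unitary_resolvent_solves abs_mult)
  moreover have "\<bar>1 - cmod z\<bar> > 0" using z by (auto simp: Te_def)
  ultimately show ?thesis by (simp add: pos_le_divide_eq mult.commute)
qed

lemma cayley_factor_eq: "cayley_factor z U x = 2 *\<^sub>C unitary_resolvent z U x - x"
proof -
  let ?y = "unitary_resolvent z U x"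
  have "cayley_factor z U x = ?y + z *\<^sub>C U ?y"
    by (simp add: cayley_factor_def unitary_resolvent_def)
  also have "\<dots> = (?y + ?y) - (?y - z *\<^sub>C U ?y)" by simp
  also have "?y + ?y = 2 *\<^sub>C ?y" using scaleC_add_left[of 1 1 ?y] by simp
  finally show ?thesis by (simp add: unitary_resolvent_solves)
qed

lemma cayley_factor_linear: "clinear_map (cayley_factor z U)"
  using unitary_resolvent_linear
  by (auto simp: clinear_map_def cayley_factor_eq scaleC_add_right scaleC_diff_right scaleC_scaleC
      mult.commute)

lemma unitary_resolvent_commute:
  assumes A: "clinear_map A" and comm: "\<And>x. A (U x) = U (A x)"
  shows "A (unitary_resolvent z U x) = unitary_resolvent z U (A x)"
proof (rule sym, rule unitary_resolvent_unique)
  let ?y = "unitary_resolvent z U x"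
  have "A ?y - z *\<^sub>C U (A ?y) = A (?y - z *\<^sub>C U ?y)"
    by (simp add: clinear_map_diff[OF A] clinear_map_scaleC[OF A] comm)
  then show "A ?y - z *\<^sub>C U (A ?y) = A x" by (simp add: unitary_resolvent_solves)
qed

lemma cayley_factor_commute:
  assumes A: "clinear_map A" and comm: "\<And>x. A (U x) = U (A x)"
  shows "A (cayley_factor z U x) = cayley_factor z U (A x)"
  by (simp add: cayley_factor_eq clinear_map_diff[OF A] clinear_map_scaleC[OF A]
      unitary_resolvent_commute[OF A comm])

end

lemma cnj_Te: "z \<in> Te \<Longrightarrow> cnj z \<in> Te" by (simp add: Te_def)

lemma inverse_Te: "z \<in> Te \<Longrightarrow> 1 / z \<in> Te" by (auto simp: Te_def norm_divide)

lemma unitary_resolvent_adjoint: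
  assumes U: "unitary U" and z: "z \<in> Te"
  shows "cinner (unitary_resolvent z U x) y = cinner x (unitary_resolvent (cnj z) (inv U) (y::'a::chilbert_space))"
proof -
  define a where "a = unitary_resolvent z U x"
  define b where "b = unitary_resolvent (cnj z) (inv U) y"
  have a: "x = a - z *\<^sub>C U a" and b: "y = b - cnj z *\<^sub>C inv U b"
    unfolding a_def b_def
    by (simp_all add: unitary_resolvent_solves[OF U z]
        unitary_resolvent_solves[OF unitary_inv[OF U] cnj_Te[OF z]])
  have "cinner a y = cinner x b"
    unfolding a b
    by (simp add: cinner_diff_left cinner_diff_right cinner_scaleC_left cinner_scaleC_right
        unitary_adjoint[OF U])
  then show ?thesis by (simp add: a_def b_def)
qed

lemma cayley_factor_adjoint:
  assumes U: "unitary U" and z: "z \<in> Te"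
  shows "cinner (cayley_factor z U x) y = cinner x (cayley_factor (cnj z) (inv U) (y::'a::chilbert_space))"
  by (simp add: cayley_factor_eq[OF U z] cayley_factor_eq[OF unitary_inv[OF U] cnj_Te[OF z]]
      cinner_diff_left cinner_diff_right cinner_scaleC_left cinner_scaleC_right
      unitary_resolvent_adjoint[OF U z])

text \<open>Multiply numerator and denominator of \<open>(E + z\<^sup>-\<^sup>1 U) (E - z\<^sup>-\<^sup>1 U)\<^sup>-\<^sup>1\<close> by \<open>z U\<^sup>-\<^sup>1\<close>.\<close>

lemma cayley_factor_inverse:
  assumes U: "unitary U" and z: "z \<in> Te" "z \<noteq> 0"
  shows "cayley_factor (1 / z) U x = - cayley_factor z (inv U) (x::'a::chilbert_space)"
proof -
  note U' = unitary_inv[OF U]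
  note lin = unitary_clinear[OF U]
  define a where "a = unitary_resolvent z (inv U) x"
  have a: "a - z *\<^sub>C inv U a = x" unfolding a_def by (rule unitary_resolvent_solves[OF U' z(1)])
  have "unitary_resolvent (1 / z) U x = - (z *\<^sub>C inv U a)"
  proof (rule unitary_resolvent_unique[OF U inverse_Te[OF z(1)]])
    show "- (z *\<^sub>C inv U a) - (1 / z) *\<^sub>C U (- (z *\<^sub>C inv U a)) = x"
      using a z by (simp add: clinear_map_uminus[OF lin] clinear_map_scaleC[OF lin] scaleC_scaleC U)
  qed
  also have "\<dots> = x - a" using a by (simp add: algebra_simps)
  finally have eq: "unitary_resolvent (1 / z) U x = x - a" .
  have "2 *\<^sub>C x = x + x" using scaleC_add_left[of 1 1 x] by simp
  then show ?thesis
    unfolding cayley_factor_eq[OF U inverse_Te[OF z(1)]] cayley_factor_eq[OF U' z(1)] eq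
    by (simp add: scaleC_diff_right flip: a_def)
qed

lemma cayley_factor_zero: "unitary U \<Longrightarrow> cayley_factor 0 U x = (x::'a::chilbert_space)"
proof -
  assume U: "unitary U"
  have "0 \<in> Te" by (simp add: Te_def)
  moreover have "unitary_resolvent 0 U x = x" by (rule unitary_resolvent_unique[OF U \<open>0 \<in> Te\<close>]) simp
  moreover have "2 *\<^sub>C x = x + x" using scaleC_add_left[of 1 1 x] by simp
  ultimately show ?thesis by (simp add: cayley_factor_eq[OF U])
qed

text \<open>The resolvent identity, which gives continuity and then differentiability in \<open>z\<close>.\<close>

lemma unitary_resolvent_diff:
  assumes U: "unitary U" and v: "v \<in> Te" and z: "z \<in> Te"
  shows "unitary_resolvent v U x - unitary_resolvent z U x
    = (v - z) *\<^sub>C unitary_resolvent v U (U (unitary_resolvent z U (x::'a::chilbert_space)))"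
proof -
  note lin = unitary_clinear[OF U] and rlin = unitary_resolvent_linear[OF U v]
  define a where "a = unitary_resolvent z U x"
  have x: "x = a - z *\<^sub>C U a" unfolding a_def by (simp add: unitary_resolvent_solves[OF U z])
  have "unitary_resolvent v U (a - v *\<^sub>C U a) = a"
    by (rule unitary_resolvent_unique[OF U v]) simp
  moreover have "a - v *\<^sub>C U a = x - (v - z) *\<^sub>C U a"
    by (simp add: x scaleC_diff_left)
  ultimately have "unitary_resolvent v U x - (v - z) *\<^sub>C unitary_resolvent v U (U a) = a"
    by (simp add: clinear_map_diff[OF rlin] clinear_map_scaleC[OF rlin])
  then show ?thesis by (simp add: a_def algebra_simps)
qed

lemma unitary_resolvent_tendsto:
  assumes U: "unitary U" and z: "z \<in> Te"
  shows "((\<lambda>v. unitary_resolvent v U x) \<longlongrightarrow> unitary_resolvent z U (x::'a::chilbert_space)) (at z)"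
proof -
  define w where "w = U (unitary_resolvent z U x)"
  have z1: "\<bar>1 - cmod z\<bar> \<noteq> 0" using z by (auto simp: Te_def)
  have "((\<lambda>v. cmod (v - z) * (norm w / \<bar>1 - cmod v\<bar>)) \<longlongrightarrow> cmod (z - z) * (norm w / \<bar>1 - cmod z\<bar>)) (at z)"
    by (intro tendsto_intros z1)
  then have lim: "((\<lambda>v. cmod (v - z) * (norm w / \<bar>1 - cmod v\<bar>)) \<longlongrightarrow> 0) (at z)" by simp
  have "((\<lambda>v. unitary_resolvent v U x - unitary_resolvent z U x) \<longlongrightarrow> 0) (at z)"
  proof (rule Lim_null_comparison[OF _ lim])
    have "\<forall>\<^sub>F v in at z. v \<in> Te" using open_Te z by (auto simp: eventually_at_topological)
    then show "\<forall>\<^sub>F v in at z. norm (unitary_resolvent v U x - unitary_resolvent z U x)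
        \<le> cmod (v - z) * (norm w / \<bar>1 - cmod v\<bar>)"
    proof eventually_elim
      case (elim v)
      show ?case
        unfolding unitary_resolvent_diff[OF U elim z] norm_scaleC w_def[symmetric]
        by (intro mult_left_mono unitary_resolvent_bound[OF U elim]) simp
    qed
  qed
  then show ?thesis by (simp add: LIM_zero_iff)
qed

lemma unitary_resolvent_has_derivative:
  assumes U: "unitary U" and z: "z \<in> Te"
  shows "((\<lambda>v. unitary_resolvent v U x) has_derivative
    (\<lambda>k. k *\<^sub>C unitary_resolvent z U (U (unitary_resolvent z U (x::'a::chilbert_space))))) (at z)"
proof -
  define w where "w = U (unitary_resolvent z U x)"
  let ?S = "\<lambda>v. unitary_resolvent v U"
  have bl: "bounded_linear (\<lambda>k. k *\<^sub>C ?S z w)"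
    by (rule bounded_bilinear.bounded_linear_left[OF bounded_bilinear_scaleC])
  have "((\<lambda>v. norm (?S v w - ?S z w)) \<longlongrightarrow> norm (?S z w - ?S z w)) (at z)"
    by (intro tendsto_intros unitary_resolvent_tendsto[OF U z])
  moreover have "\<forall>\<^sub>F v in at z. norm (?S v w - ?S z w)
      = norm ((?S v x - ?S z x) - (v - z) *\<^sub>C ?S z w) / norm (v - z)"
  proof -
    have "\<forall>\<^sub>F v in at z. v \<in> Te \<and> v \<noteq> z"
      using open_Te z by (auto simp: eventually_at_topological)
    then show ?thesis
    proof eventually_elim
      case (elim v)
      then have v: "v \<in> Te" "v \<noteq> z" by auto
      have "(?S v x - ?S z x) - (v - z) *\<^sub>C ?S z w = (v - z) *\<^sub>C (?S v w - ?S z w)"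
        using unitary_resolvent_diff[OF U v(1) z, of x] by (simp add: w_def scaleC_diff_right)
      then show ?case using v by (simp add: norm_scaleC)
    qed
  qed
  ultimately have "((\<lambda>v. norm ((?S v x - ?S z x) - (v - z) *\<^sub>C ?S z w) / norm (v - z)) \<longlongrightarrow> 0) (at z)"
    by (simp add: filterlim_cong)
  then show ?thesis
    unfolding has_derivative_iff_norm w_def[symmetric] using bl by simp
qed

lemma cayley_factor_has_derivative:
  assumes U: "unitary U" and z: "z \<in> Te"
  shows "\<exists>d. ((\<lambda>v. cayley_factor v U x) has_derivative (\<lambda>k. k *\<^sub>C (d::'a::chilbert_space))) (at z)"
proof -
  let ?d = "2 *\<^sub>C unitary_resolvent z U (U (unitary_resolvent z U x))"
  have "((\<lambda>v. 2 *\<^sub>C unitary_resolvent v U x - x) has_derivative (\<lambda>k. k *\<^sub>C ?d)) (at z)"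
    by (rule derivative_eq_intros
        bounded_linear.has_derivative[OF bounded_bilinear.bounded_linear_right[OF bounded_bilinear_scaleC]]
        unitary_resolvent_has_derivative[OF U z] refl)+ (simp add: scaleC_scaleC mult.commute)
  then have "((\<lambda>v. cayley_factor v U x) has_derivative (\<lambda>k. k *\<^sub>C ?d)) (at z)"
    by (rule has_derivative_transform_within_open[OF _ open_Te z]) (simp add: cayley_factor_eq[OF U])
  then show ?thesis by blast
qed

text \<open>The adjoint of the first factor depends antiholomorphically on \<open>u\<close> and the inner product is
  antilinear in its second argument, so the product rule gives a complex linear derivative.\<close>

lemma cayley_factors_cinner_has_derivative:
  fixes x y :: "'a::chilbert_space"
  assumes U: "unitary U" and W: "unitary W" and u: "u \<in> Te" and v: "v \<in> Te"
  shows "\<exists>a b. ((\<lambda>(u, v). cinner (cayley_factor u U (cayley_factor v W x)) y)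
    has_derivative (\<lambda>(h, k). a * h + b * k)) (at (u, v))"
proof -
  obtain d where d: "((\<lambda>v. cayley_factor v W x) has_derivative (\<lambda>k. k *\<^sub>C d)) (at v)"
    using cayley_factor_has_derivative[OF W v] by blast
  obtain e where e: "((\<lambda>v. cayley_factor v (inv U) y) has_derivative (\<lambda>k. k *\<^sub>C e)) (at (cnj u))"
    using cayley_factor_has_derivative[OF unitary_inv[OF U] cnj_Te[OF u]] by blast
  let ?A = "cayley_factor v W x" and ?B = "cayley_factor (cnj u) (inv U) y"
  have d': "((\<lambda>p. cayley_factor (snd p) W x) has_derivative (\<lambda>p. snd p *\<^sub>C d)) (at (u, v))"
    using has_derivative_compose[OF has_derivative_snd[OF has_derivative_ident], of "\<lambda>v. cayley_factor v W x" _ "(u,v)" UNIV] d by simp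
  have "((\<lambda>p::complex \<times> complex. cnj (fst p)) has_derivative (\<lambda>p. cnj (fst p))) (at (u, v))"
    by (intro derivative_intros bounded_linear_imp_has_derivative bounded_linear_compose[OF bounded_linear_cnj] bounded_linear_fst)
  from has_derivative_compose[OF this, of "\<lambda>v. cayley_factor v (inv U) y"] e
  have e': "((\<lambda>p. cayley_factor (cnj (fst p)) (inv U) y) has_derivative (\<lambda>p. cnj (fst p) *\<^sub>C e)) (at (u, v))"
    by simp
  have "((\<lambda>p. cinner (cayley_factor (snd p) W x) (cayley_factor (cnj (fst p)) (inv U) y)) has_derivative
      (\<lambda>p. cinner ?A (cnj (fst p) *\<^sub>C e) + cinner (snd p *\<^sub>C d) ?B)) (at (u, v))"
    using bounded_bilinear.FDERIV[OF bounded_bilinear_cinner d' e'] by simp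
  then have "((\<lambda>(u, v). cinner (cayley_factor v W x) (cayley_factor (cnj u) (inv U) y)) has_derivative
      (\<lambda>(h, k). cinner ?A e * h + cinner d ?B * k)) (at (u, v))"
    by (simp add: cinner_scaleC_left cinner_scaleC_right case_prod_unfold mult.commute)
  then have "((\<lambda>(u, v). cinner (cayley_factor u U (cayley_factor v W x)) y) has_derivative
      (\<lambda>(h, k). cinner ?A e * h + cinner d ?B * k)) (at (u, v))"
    by (rule has_derivative_transform_within_open[OF _ open_Times[OF open_Te open_Te]])
       (use u v in \<open>auto simp: cayley_factor_adjoint[OF U]\<close>)
  then show ?thesis by blast
qed

section \<open>Generalized resolvents satisfy the conditions\<close>

text \<open>The limit of the Cayley transform as \<open>z \<rightarrow> \<infinity>\<close> is \<open>-E\<close>.\<close>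

fun cayley_ext :: "('a::complex_inner \<Rightarrow> 'a) \<Rightarrow> ecomplex \<Rightarrow> 'a \<Rightarrow> 'a" where
  "cayley_ext U (Fin z) x = cayley_factor z U x"
| "cayley_ext U Infty x = - x"

lemma chart_in_Te_ext: "\<phi> \<in> {Fin, chart_infty} \<Longrightarrow> u \<in> Te \<Longrightarrow> \<phi> u \<in> Te_ext"
  by (cases "u = 0") (auto simp: Te_ext_def chart_infty_def intro!: imageI inverse_Te)

lemma reflect_in_Te_ext: "Z \<in> Te_ext \<Longrightarrow> reflect Z \<in> Te_ext"
  by (cases "Z = Fin 0") (auto simp: Te_ext_def Te_def norm_inverse intro!: imageI split: if_splits)

lemma cayley_ext_chart_infty:
  assumes U: "unitary U" and u: "u \<in> Te"
  shows "cayley_ext U (chart_infty u) x = - cayley_factor u (inv U) (x::'a::chilbert_space)"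
  using cayley_factor_inverse[OF U u, of x] cayley_factor_zero[OF unitary_inv[OF U], of x]
  by (simp add: chart_infty_def)

text \<open>In the chart at infinity the Cayley transform is, up to sign, that of the inverse operator. So
  every statement on \<open>Te\<close> about all unitary operators carries over to both charts.\<close>

lemma cayley_ext_chart:
  assumes U: "unitary U" and \<phi>: "\<phi> \<in> {Fin, chart_infty}"
  obtains s W where "s \<in> {1, -1 :: complex}" "unitary W"
    "\<And>u x. u \<in> Te \<Longrightarrow> cayley_ext U (\<phi> u) (x::'a::chilbert_space) = s *\<^sub>C cayley_factor u W x"
proof (cases "\<phi> = Fin")
  case True
  show ?thesis by (rule that[of 1 U]) (simp_all add: U True)
next
  case False
  then have "\<phi> = chart_infty" using \<phi> by simp
  then show ?thesis
    by (intro that[of "-1" "inv U"]) (simp_all add: unitary_inv[OF U] cayley_ext_chart_infty[OF U])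
qed

lemma cayley_ext_linear:
  assumes U: "unitary U" and Z: "Z \<in> Te_ext"
  shows "clinear_map (cayley_ext U Z :: 'a::chilbert_space \<Rightarrow> 'a)"
proof (cases Z)
  case (Fin z)
  then have "z \<in> Te" using Z by (auto simp: Te_ext_def)
  moreover have "cayley_ext U Z = cayley_factor z U" by (rule ext) (simp add: Fin)
  ultimately show ?thesis using cayley_factor_linear[OF U] by simp
next
  case Infty
  then show ?thesis by (simp add: clinear_map_def)
qed

lemma cayley_ext_commute:
  assumes U: "unitary U" and W: "unitary W" and comm: "U \<circ> W = W \<circ> U"
    and Z: "Z \<in> Te_ext" and Y: "Y \<in> Te_ext"
  shows "cayley_ext U Z (cayley_ext W Y x) = cayley_ext W Y (cayley_ext U Z (x::'a::chilbert_space))"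
proof -
  have c: "U (W x) = W (U x)" for x using comm by (metis comp_apply)
  have 1: "U (cayley_ext W Y x) = cayley_ext W Y (U x)" for x
  proof (cases Y)
    case (Fin z)
    then have "z \<in> Te" using Y by (auto simp: Te_ext_def)
    then show ?thesis using Fin cayley_factor_commute[OF W _ unitary_clinear[OF U] c] by simp
  qed (simp add: clinear_map_uminus[OF unitary_clinear[OF U]])
  show ?thesis
  proof (cases Z)
    case (Fin z)
    then have "z \<in> Te" using Z by (auto simp: Te_ext_def)
    then show ?thesis using Fin cayley_factor_commute[OF U _ cayley_ext_linear[OF W Y] 1[symmetric]] by simp
  next
    case Infty
    then show ?thesis by (simp add: clinear_map_uminus[OF cayley_ext_linear[OF W Y]])
  qed
qed

lemma cayley_ext_reflect_Fin:
  assumes U: "unitary U" and z: "z \<in> Te"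
  shows "cayley_ext U (reflect (Fin z)) x = - cayley_factor (cnj z) (inv U) (x::'a::chilbert_space)"
  using cayley_factor_inverse[OF U cnj_Te[OF z], of x] cayley_factor_zero[OF unitary_inv[OF U], of x]
  by (simp add: inverse_eq_divide)

lemma cayley_ext_adjoint:
  assumes U: "unitary U" and Z: "Z \<in> Te_ext"
  shows "cinner (cayley_ext U Z x) y = - cinner x (cayley_ext U (reflect Z) (y::'a::chilbert_space))"
proof (cases Z)
  case (Fin z)
  then have "z \<in> Te" using Z by (auto simp: Te_ext_def)
  then show ?thesis
    using Fin cayley_ext_reflect_Fin[OF U, of z y] cayley_factor_adjoint[OF U, of z x y] by simp
next
  case Infty
  then show ?thesis by (simp add: cayley_factor_zero[OF U])
qed

text \<open>Here \<open>F = 2 S - E\<close> with the resolvent \<open>S\<close>, and \<open>x\<close>, \<open>S x\<close>, \<open>S\<^sup>* x\<close> are explicit in terms of \<open>a = S\<^sup>* S x\<close>: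
  \<open>S x = (E - z U)\<^sup>* a\<close> and \<open>S\<^sup>* x = (E - z U) a\<close>. The formula is what makes the real part of \<open>F\<close> positive for \<open>|z| < 1\<close>.\<close>

lemma cayley_factor_real_part:
  assumes U: "unitary U" and z: "z \<in> Te"
  shows "cayley_factor z U x + cayley_factor (cnj z) (inv U) x
    = (2 * (1 - z * cnj z)) *\<^sub>C unitary_resolvent (cnj z) (inv U) (unitary_resolvent z U (x::'a::chilbert_space))"
proof -
  note U' = unitary_inv[OF U] and z' = cnj_Te[OF z]
  note lin = unitary_clinear[OF U] and lin' = unitary_clinear[OF U']
  define b where "b = unitary_resolvent z U x"
  define a where "a = unitary_resolvent (cnj z) (inv U) b"
  have b: "b = a - cnj z *\<^sub>C inv U a" unfolding a_def by (simp add: unitary_resolvent_solves[OF U' z'])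
  have x: "x = b - z *\<^sub>C U b" unfolding b_def by (simp add: unitary_resolvent_solves[OF U z])
  have Ub: "U b = U a - cnj z *\<^sub>C a"
    by (simp add: b clinear_map_diff[OF lin] clinear_map_scaleC[OF lin] U)
  have S': "unitary_resolvent (cnj z) (inv U) x = a - z *\<^sub>C U a"
  proof (rule unitary_resolvent_unique[OF U' z'])
    show "a - z *\<^sub>C U a - cnj z *\<^sub>C inv U (a - z *\<^sub>C U a) = x"
      unfolding x Ub unfolding b
      by (simp add: clinear_map_diff[OF lin'] clinear_map_scaleC[OF lin'] U scaleC_diff_right
          scaleC_scaleC mult.commute algebra_simps)
  qed
  have two: "2 *\<^sub>C y = y + y" for y :: 'a using scaleC_add_left[of 1 1 y] by simp
  have "cayley_factor z U x + cayley_factor (cnj z) (inv U) x = 2 *\<^sub>C (b + (a - z *\<^sub>C U a) - x)"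
    by (simp add: cayley_factor_eq[OF U z] cayley_factor_eq[OF U' z'] S' scaleC_add_right
        scaleC_diff_right two flip: b_def)
  also have "b + (a - z *\<^sub>C U a) - x = (1 - z * cnj z) *\<^sub>C a"
    unfolding x Ub by (simp add: scaleC_diff_right scaleC_diff_left scaleC_scaleC)
  finally show ?thesis by (simp add: scaleC_scaleC a_def b_def)
qed

lemma class_H2_cong:
  assumes eq: "\<And>Z1 Z2. Z1 \<in> Te_ext \<Longrightarrow> Z2 \<in> Te_ext \<Longrightarrow> f Z1 Z2 = g Z1 Z2" and g: "class_H2 g"
  shows "class_H2 f"
  unfolding class_H2_def
proof (intro conjI ballI allI impI)
  fix \<phi> \<psi> assume c: "\<phi> \<in> {Fin, chart_infty}" "\<psi> \<in> {Fin, chart_infty}"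
  then have h: "holomorphic2_on (\<lambda>(u, v). g (\<phi> u) (\<psi> v)) (Te \<times> Te)"
    using g unfolding class_H2_def by blast
  show "holomorphic2_on (\<lambda>(u, v). f (\<phi> u) (\<psi> v)) (Te \<times> Te)"
    unfolding holomorphic2_on_def
  proof (intro conjI ballI)
    show "open (Te \<times> Te)" by (intro open_Times open_Te)
    fix p assume p: "p \<in> Te \<times> Te"
    then obtain a b where d: "((\<lambda>(u, v). g (\<phi> u) (\<psi> v)) has_derivative (\<lambda>(h, k). a * h + b * k)) (at p)"
      using h unfolding holomorphic2_on_def by blast
    have "((\<lambda>(u, v). f (\<phi> u) (\<psi> v)) has_derivative (\<lambda>(h, k). a * h + b * k)) (at p)"
      by (rule has_derivative_transform_within_open[OF d open_Times[OF open_Te open_Te] p])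
         (auto simp: eq chart_in_Te_ext[OF c(1)] chart_in_Te_ext[OF c(2)])
    then show "\<exists>a b. ((\<lambda>(u, v). f (\<phi> u) (\<psi> v)) has_derivative (\<lambda>(h, k). a * h + b * k)) (at p)"
      by blast
  qed
next
  fix z1 z2 assume "z1 \<in> Te_ext" "z2 \<in> Te_ext"
  then show "f (reflect z1) (reflect z2) = cnj (f z1 z2)"
    using g unfolding class_H2_def by (metis eq reflect_in_Te_ext)
next
  fix z1 z2 assume z: "cmod z1 < 1 \<and> cmod z2 < 1"
  then have "Fin z1 \<in> Te_ext" "Fin z2 \<in> Te_ext" by (auto simp: Te_ext_def Te_def)
  with z have F: "f (Fin z1) (Fin z2) = g (Fin z1) (Fin z2)"
    "f (reflect (Fin z1)) (Fin z2) = g (reflect (Fin z1)) (Fin z2)"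
    "f (Fin z1) (reflect (Fin z2)) = g (Fin z1) (reflect (Fin z2))"
    "f (reflect (Fin z1)) (reflect (Fin z2)) = g (reflect (Fin z1)) (reflect (Fin z2))"
    by (auto intro!: eq reflect_in_Te_ext simp del: reflect.simps)
  show "f (Fin z1) (Fin z2) - f (reflect (Fin z1)) (Fin z2)
          - f (Fin z1) (reflect (Fin z2)) + f (reflect (Fin z1)) (reflect (Fin z2)) \<in> \<real>\<^sub>\<ge>\<^sub>0"
    unfolding F using g z unfolding class_H2_def by blast
next
  have "Infty \<in> Te_ext" "Fin 0 \<in> Te_ext" by (auto simp: Te_ext_def Te_def)
  then show "f z1 (Fin 0) + f z1 Infty = 0" "f (Fin 0) z1 + f Infty z1 = 0" if "z1 \<in> Te_ext" for z1
    using g that unfolding class_H2_def by (metis eq)+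
qed

text \<open>For the positivity condition, the operator on the left is the product of the two commuting operators
  \<open>F + F\<^sup>*\<close> belonging to \<open>U\<close> and \<open>W\<close>. By the formula for the real part the form is a nonnegative multiple of
  \<open>\<parallel>S T x\<parallel>\<^sup>2\<close>, where \<open>S\<close> and \<open>T\<close> are the resolvents of \<open>U\<close> and \<open>W\<close>.\<close>

lemma class_H2_cayley:
  fixes x :: "'a::chilbert_space"
  assumes U: "unitary U" and W: "unitary W" and comm: "U \<circ> W = W \<circ> U"
  shows "class_H2 (\<lambda>Z1 Z2. cinner (cayley_ext U Z1 (cayley_ext W Z2 x)) x)"
  unfolding class_H2_def
proof (intro conjI ballI allI impI)
  fix \<phi> \<psi> assume \<phi>: "\<phi> \<in> {Fin, chart_infty}" and \<psi>: "\<psi> \<in> {Fin, chart_infty}"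
  obtain s U' where s: "s \<in> {1, -1}" "unitary U'"
    "\<And>u x. u \<in> Te \<Longrightarrow> cayley_ext U (\<phi> u) x = s *\<^sub>C cayley_factor u U' x"
    using cayley_ext_chart[OF U \<phi>] by metis
  obtain t W' where t: "t \<in> {1, -1}" "unitary W'"
    "\<And>u x. u \<in> Te \<Longrightarrow> cayley_ext W (\<psi> u) x = t *\<^sub>C cayley_factor u W' x"
    using cayley_ext_chart[OF W \<psi>] by metis
  show "holomorphic2_on (\<lambda>(u, v). cinner (cayley_ext U (\<phi> u) (cayley_ext W (\<psi> v) x)) x) (Te \<times> Te)"
    unfolding holomorphic2_on_def
  proof (intro conjI ballI)
    show "open (Te \<times> Te)" by (intro open_Times open_Te)
    fix p assume p: "p \<in> Te \<times> Te"
    then obtain a b where "((\<lambda>(u, v). cinner (cayley_factor u U' (cayley_factor v W' x)) x)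
        has_derivative (\<lambda>(h, k). a * h + b * k)) (at p)"
      using cayley_factors_cinner_has_derivative[OF s(2) t(2)] by (cases p) blast
    from has_derivative_mult_right[OF this, of "s * t"]
    have d: "((\<lambda>(u, v). s * t * cinner (cayley_factor u U' (cayley_factor v W' x)) x)
        has_derivative (\<lambda>(h, k). s * t * a * h + s * t * b * k)) (at p)"
      by (simp add: case_prod_unfold algebra_simps)
    have "((\<lambda>(u, v). cinner (cayley_ext U (\<phi> u) (cayley_ext W (\<psi> v) x)) x)
        has_derivative (\<lambda>(h, k). s * t * a * h + s * t * b * k)) (at p)"
      by (rule has_derivative_transform_within_open[OF d open_Times[OF open_Te open_Te] p])
         (auto simp: s(3) t(3) cinner_scaleC_left clinear_map_scaleC[OF cayley_factor_linear[OF s(2)]])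
    then show "\<exists>a b. ((\<lambda>(u, v). cinner (cayley_ext U (\<phi> u) (cayley_ext W (\<psi> v) x)) x)
        has_derivative (\<lambda>(h, k). a * h + b * k)) (at p)" by blast
  qed
next
  fix Z1 Z2 assume Z: "Z1 \<in> Te_ext" "Z2 \<in> Te_ext"
  note R = reflect_in_Te_ext[OF Z(1)] reflect_in_Te_ext[OF Z(2)]
  have "cinner (cayley_ext U Z1 (cayley_ext W Z2 x)) x
      = cinner x (cayley_ext W (reflect Z2) (cayley_ext U (reflect Z1) x))"
    by (simp add: cayley_ext_adjoint[OF U Z(1)] cayley_ext_adjoint[OF W Z(2)])
  also have "\<dots> = cinner x (cayley_ext U (reflect Z1) (cayley_ext W (reflect Z2) x))"
    by (simp add: cayley_ext_commute[OF U W comm R])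
  finally show "cinner (cayley_ext U (reflect Z1) (cayley_ext W (reflect Z2) x)) x
      = cnj (cinner (cayley_ext U Z1 (cayley_ext W Z2 x)) x)"
    by (subst cinner_commute) simp
next
  fix z1 z2 assume z: "cmod z1 < 1 \<and> cmod z2 < 1"
  then have Te: "z1 \<in> Te" "z2 \<in> Te" by (auto simp: Te_def)
  note U' = unitary_inv[OF U] and W' = unitary_inv[OF W]
  note linF = cayley_factor_linear[OF U Te(1)] and linF' = cayley_factor_linear[OF U' cnj_Te[OF Te(1)]]
  let ?S = "unitary_resolvent z1 U" and ?S' = "unitary_resolvent (cnj z1) (inv U)"
  let ?T = "unitary_resolvent z2 W" and ?T' = "unitary_resolvent (cnj z2) (inv W)"
  note linS = unitary_resolvent_linear[OF U Te(1)] and linS' = unitary_resolvent_linear[OF U' cnj_Te[OF Te(1)]]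
  have UW: "U (W x) = W (U x)" for x using comm by (metis comp_apply)
  have UW': "U (inv W x) = inv W (U x)" for x
    by (metis UW W unitary_inv_left unitary_inv_right)
  have ST: "?S (?T x) = ?T (?S x)" for x
    by (rule unitary_resolvent_commute[OF W Te(2) linS])
       (rule unitary_resolvent_commute[OF U Te(1) unitary_clinear[OF W] UW[symmetric], symmetric])
  have ST': "?S (?T' x) = ?T' (?S x)" for x
    by (rule unitary_resolvent_commute[OF W' cnj_Te[OF Te(2)] linS])
       (rule unitary_resolvent_commute[OF U Te(1) unitary_clinear[OF W'] UW'[symmetric], symmetric])
  define c1 where "c1 = 2 * (1 - z1 * cnj z1)"
  define c2 where "c2 = 2 * (1 - z2 * cnj z2)"
  let ?y = "cayley_factor z2 W x + cayley_factor (cnj z2) (inv W) x"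
  have "cinner (cayley_ext U (Fin z1) (cayley_ext W (Fin z2) x)) x
      - cinner (cayley_ext U (reflect (Fin z1)) (cayley_ext W (Fin z2) x)) x
      - cinner (cayley_ext U (Fin z1) (cayley_ext W (reflect (Fin z2)) x)) x
      + cinner (cayley_ext U (reflect (Fin z1)) (cayley_ext W (reflect (Fin z2)) x)) x
      = cinner (cayley_factor z1 U ?y + cayley_factor (cnj z1) (inv U) ?y) x"
    unfolding cayley_ext_reflect_Fin[OF U Te(1)] cayley_ext_reflect_Fin[OF W Te(2)]
    by (simp add: clinear_map_add[OF linF] clinear_map_add[OF linF'] clinear_map_uminus[OF linF]
        clinear_map_uminus[OF linF'] cinner_add_left)
  also have "\<dots> = c1 * c2 * cinner (?S' (?S (?T' (?T x)))) x"
    unfolding cayley_factor_real_part[OF U Te(1)] cayley_factor_real_part[OF W Te(2)] c1_def c2_def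
    by (simp add: clinear_map_scaleC[OF linS] clinear_map_scaleC[OF linS'] cinner_scaleC_left)
  also have "cinner (?S' (?S (?T' (?T x)))) x = cinner (?S (?T' (?T x))) (?S x)"
    using unitary_resolvent_adjoint[OF U' cnj_Te[OF Te(1)]] by (simp add: unitary_inv_inv[OF U])
  also have "\<dots> = cinner (?S (?T x)) (?T (?S x))"
    using unitary_resolvent_adjoint[OF W' cnj_Te[OF Te(2)]] by (simp add: unitary_inv_inv[OF W] ST')
  also have "\<dots> = complex_of_real ((norm (?S (?T x)))\<^sup>2)"
    unfolding ST[symmetric] by (rule cinner_norm)
  finally have eq: "cinner (cayley_ext U (Fin z1) (cayley_ext W (Fin z2) x)) x
      - cinner (cayley_ext U (reflect (Fin z1)) (cayley_ext W (Fin z2) x)) x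
      - cinner (cayley_ext U (Fin z1) (cayley_ext W (reflect (Fin z2)) x)) x
      + cinner (cayley_ext U (reflect (Fin z1)) (cayley_ext W (reflect (Fin z2)) x)) x
      = c1 * c2 * complex_of_real ((norm (?S (?T x)))\<^sup>2)" .
  have "2 * (1 - z * cnj z) = complex_of_real (2 * (1 - (cmod z)\<^sup>2))" for z
    by (simp add: complex_norm_square del: of_real_power)
  then have c: "c1 * c2 * complex_of_real ((norm (?S (?T x)))\<^sup>2)
      = complex_of_real (2 * (1 - (cmod z1)\<^sup>2) * (2 * (1 - (cmod z2)\<^sup>2)) * (norm (?S (?T x)))\<^sup>2)"
    unfolding c1_def c2_def by simp
  have "2 * (1 - (cmod z1)\<^sup>2) * (2 * (1 - (cmod z2)\<^sup>2)) * (norm (?S (?T x)))\<^sup>2 \<ge> 0"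
    using z by (intro mult_nonneg_nonneg) (simp_all add: abs_square_le_1)
  then show "cinner (cayley_ext U (Fin z1) (cayley_ext W (Fin z2) x)) x
      - cinner (cayley_ext U (reflect (Fin z1)) (cayley_ext W (Fin z2) x)) x
      - cinner (cayley_ext U (Fin z1) (cayley_ext W (reflect (Fin z2)) x)) x
      + cinner (cayley_ext U (reflect (Fin z1)) (cayley_ext W (reflect (Fin z2)) x)) x \<in> \<real>\<^sub>\<ge>\<^sub>0"
    unfolding eq c by (simp add: complex_nonneg_Reals_iff del: of_real_mult)
next
  fix Z assume Z: "Z \<in> Te_ext"
  show "cinner (cayley_ext U Z (cayley_ext W (Fin 0) x)) x + cinner (cayley_ext U Z (cayley_ext W Infty x)) x = 0"
    by (simp add: cayley_factor_zero[OF W] clinear_map_uminus[OF cayley_ext_linear[OF U Z]])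
  show "cinner (cayley_ext U (Fin 0) (cayley_ext W Z x)) x + cinner (cayley_ext U Infty (cayley_ext W Z x)) x = 0"
    by (simp add: cayley_factor_zero[OF U])
qed

lemma cayley_factor_tendsto_at_infinity:
  assumes U: "unitary U"
  shows "((\<lambda>z. cayley_factor z U x) \<longlongrightarrow> - (x::'a::chilbert_space)) at_infinity"
proof -
  have "0 \<in> Te" by (simp add: Te_def)
  then obtain d where "((\<lambda>v. cayley_factor v (inv U) x) has_derivative (\<lambda>k. k *\<^sub>C d)) (at 0)"
    using cayley_factor_has_derivative[OF unitary_inv[OF U]] by blast
  then have "isCont (\<lambda>v. cayley_factor v (inv U) x) 0" by (rule has_derivative_continuous)
  then have "((\<lambda>z. cayley_factor (inverse z) (inv U) x) \<longlongrightarrow> cayley_factor 0 (inv U) x) at_infinity"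
    by (rule isCont_tendsto_compose[OF _ tendsto_inverse_0])
  then have "((\<lambda>z. - cayley_factor (inverse z) (inv U) x) \<longlongrightarrow> - x) at_infinity"
    using cayley_factor_zero[OF unitary_inv[OF U], of x] by (intro tendsto_minus) simp
  moreover have "\<forall>\<^sub>F z in at_infinity. - cayley_factor (inverse z) (inv U) x = cayley_factor z U x"
    unfolding eventually_at_infinity
  proof (intro exI[of _ 2] allI impI)
    fix z :: complex assume "2 \<le> cmod z"
    then have "inverse z \<in> Te" "inverse z \<noteq> 0" by (auto simp: Te_def norm_inverse)
    then show "- cayley_factor (inverse z) (inv U) x = cayley_factor z U x"
      using cayley_factor_inverse[OF U, of "inverse z" x] by (simp add: inverse_eq_divide)
  qed
  ultimately show ?thesis by (rule Lim_transform_eventually)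
qed

lemma eventually_Te_at_infinity: "\<forall>\<^sub>F z in at_infinity. z \<in> Te"
  unfolding eventually_at_infinity by (intro exI[of _ 2]) (auto simp: Te_def)

lemma cayley_extend_to_infinity:
  fixes x :: "'a::chilbert_space"
  assumes U: "unitary U" and W: "unitary W"
    and f: "\<And>z1 z2. z1 \<in> Te \<Longrightarrow> z2 \<in> Te \<Longrightarrow> f z1 z2 = cinner (cayley_factor z1 U (cayley_factor z2 W x)) x"
  shows "has_limits_at_infinity f"
    and "Z1 \<in> Te_ext \<Longrightarrow> Z2 \<in> Te_ext \<Longrightarrow>
      extend_to_infinity f Z1 Z2 = cinner (cayley_ext U Z1 (cayley_ext W Z2 x)) x"
proof -
  have 1: "((\<lambda>z1. f z1 z2) \<longlongrightarrow> - cinner (cayley_factor z2 W x) x) at_infinity" if "z2 \<in> Te" for z2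
  proof (rule Lim_transform_eventually)
    show "((\<lambda>z1. cinner (cayley_factor z1 U (cayley_factor z2 W x)) x) \<longlongrightarrow> - cinner (cayley_factor z2 W x) x) at_infinity"
      using tendsto_cinner[OF cayley_factor_tendsto_at_infinity[OF U] tendsto_const] by fastforce
    show "\<forall>\<^sub>F z1 in at_infinity. cinner (cayley_factor z1 U (cayley_factor z2 W x)) x = f z1 z2"
      using eventually_Te_at_infinity by eventually_elim (simp add: f that)
  qed
  have 2: "((\<lambda>z2. f z1 z2) \<longlongrightarrow> - cinner (cayley_factor z1 U x) x) at_infinity" if z1: "z1 \<in> Te" for z1
  proof (rule Lim_transform_eventually)
    show "((\<lambda>z2. cinner (cayley_factor z2 W x) (cayley_factor (cnj z1) (inv U) x))
        \<longlongrightarrow> - cinner (cayley_factor z1 U x) x) at_infinity"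
      using tendsto_cinner[OF cayley_factor_tendsto_at_infinity[OF W] tendsto_const, of x]
      by (simp add: cayley_factor_adjoint[OF U z1])
    show "\<forall>\<^sub>F z2 in at_infinity. cinner (cayley_factor z2 W x) (cayley_factor (cnj z1) (inv U) x) = f z1 z2"
      using eventually_Te_at_infinity
      by eventually_elim (simp add: f z1 cayley_factor_adjoint[OF U z1])
  qed
  note L1 = tendsto_Lim[OF trivial_limit_at_infinity 1]
  note L2 = tendsto_Lim[OF trivial_limit_at_infinity 2]
  have 3: "((\<lambda>z2. Lim at_infinity (\<lambda>z1. f z1 z2)) \<longlongrightarrow> cinner x x) at_infinity"
  proof (rule Lim_transform_eventually)
    show "((\<lambda>z2. - cinner (cayley_factor z2 W x) x) \<longlongrightarrow> cinner x x) at_infinity"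
      using tendsto_minus[OF tendsto_cinner[OF cayley_factor_tendsto_at_infinity[OF W] tendsto_const, of x x]]
      by simp
    show "\<forall>\<^sub>F z2 in at_infinity. - cinner (cayley_factor z2 W x) x = Lim at_infinity (\<lambda>z1. f z1 z2)"
      using eventually_Te_at_infinity by eventually_elim (simp add: L1)
  qed
  note L3 = tendsto_Lim[OF trivial_limit_at_infinity 3]
  show "has_limits_at_infinity f"
    unfolding has_limits_at_infinity_def using 1 2 3 by blast
  show "extend_to_infinity f Z1 Z2 = cinner (cayley_ext U Z1 (cayley_ext W Z2 x)) x"
    if "Z1 \<in> Te_ext" "Z2 \<in> Te_ext"
    using that by (cases Z1; cases Z2)
      (auto simp: Te_ext_def f L1 L2 L3 clinear_map_uminus[OF cayley_factor_linear[OF U]])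
qed

text \<open>The scalar products \<open>(R z1 z2 h, g)\<close> are those of the product of the two Cayley transforms on the larger
  space, so adjoints, limits and the properties of the class are read off there.\<close>

lemma generalized_resolvent_imp_conditions:
  fixes R :: "complex \<Rightarrow> complex \<Rightarrow> 'a::chilbert_space \<Rightarrow> 'a"
  assumes "generalized_resolvent_of_some_pair TYPE('b::chilbert_space) R"
  shows "resolvent_conditions R"
proof -
  obtain J :: "'a \<Rightarrow> 'b" and U W where J: "clinear_map J" "\<And>x y. cinner (J x) (J y) = cinner x y"
    and U: "unitary U" and W: "unitary W" and comm: "U \<circ> W = W \<circ> U"
    and R: "\<And>z1 z2 h. z1 \<in> Te \<Longrightarrow> z2 \<in> Te \<Longrightarrow>
       J (R z1 z2 h) = orth_projection (range J) (cayley_factor z1 U (cayley_factor z2 W (J h)))"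
    using assms unfolding generalized_resolvent_of_some_pair_def generalized_resolvent_def by blast
  have R': "cinner (R z1 z2 h) g = cinner (cayley_factor z1 U (cayley_factor z2 W (J h))) (J g)"
    if "z1 \<in> Te" "z2 \<in> Te" for z1 z2 h g
    using R[OF that, of h] unfolding orth_projection_range_isometry[OF J] by blast
  have "0 \<in> Te" by (simp add: Te_def)
  then have "R 0 0 = id"
    by (intro ext cinner_eqI) (simp add: R' cayley_factor_zero[OF U] cayley_factor_zero[OF W] J)
  moreover have "cadjoint (R z1 z2) = R (1 / cnj z1) (1 / cnj z2)" if z: "z1 \<in> Te - {0}" "z2 \<in> Te - {0}" for z1 z2
  proof -
    have Z: "Fin z1 \<in> Te_ext" "Fin z2 \<in> Te_ext" using z by (auto simp: Te_ext_def)
    note RZ = reflect_in_Te_ext[OF Z(1)] reflect_in_Te_ext[OF Z(2)]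
    have z': "1 / cnj z1 \<in> Te" "1 / cnj z2 \<in> Te" using z by (auto intro: inverse_Te cnj_Te)
    have r: "reflect (Fin z1) = Fin (1 / cnj z1)" "reflect (Fin z2) = Fin (1 / cnj z2)"
      using z by (auto simp: inverse_eq_divide)
    have adj: "cinner (R z1 z2 x) y = cinner x (R (1 / cnj z1) (1 / cnj z2) y)" for x y
    proof -
      have "cinner (R z1 z2 x) y = cinner (cayley_ext U (Fin z1) (cayley_ext W (Fin z2) (J x))) (J y)"
        using z by (simp add: R')
      also have "\<dots> = cinner (J x) (cayley_ext W (reflect (Fin z2)) (cayley_ext U (reflect (Fin z1)) (J y)))"
        by (simp only: cayley_ext_adjoint[OF U Z(1)] cayley_ext_adjoint[OF W Z(2)] minus_minus)
      also have "\<dots> = cinner (J x) (cayley_ext U (reflect (Fin z1)) (cayley_ext W (reflect (Fin z2)) (J y)))"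
        by (simp only: cayley_ext_commute[OF U W comm RZ])
      also have "\<dots> = cinner x (R (1 / cnj z1) (1 / cnj z2) y)"
        unfolding r by (subst (1 2) cinner_commute) (simp add: R'[OF z'])
      finally show ?thesis .
    qed
    show ?thesis
      unfolding cadjoint_def
    proof (rule some_equality)
      fix B assume B: "\<forall>x y. cinner (R z1 z2 x) y = cinner x (B y)"
      show "B = R (1 / cnj z1) (1 / cnj z2)"
        by (intro ext cinner_eqI_right) (metis B adj)
    qed (use adj in blast)
  qed
  moreover have "has_limits_at_infinity (\<lambda>z1 z2. cinner (R z1 z2 h) h)
      \<and> class_H2 (extend_to_infinity (\<lambda>z1 z2. cinner (R z1 z2 h) h))" for h
  proof
    note ex = cayley_extend_to_infinity[OF U W, of "\<lambda>z1 z2. cinner (R z1 z2 h) h" "J h", OF R']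
    show "has_limits_at_infinity (\<lambda>z1 z2. cinner (R z1 z2 h) h)" by (rule ex(1))
    show "class_H2 (extend_to_infinity (\<lambda>z1 z2. cinner (R z1 z2 h) h))"
      by (rule class_H2_cong[OF ex(2) class_H2_cayley[OF U W comm]])
  qed
  ultimately show ?thesis
    unfolding resolvent_conditions_def Let_def by blast
qed


section \<open>Fourier coefficients of functions on both sides of the unit circle\<close>

definition nth_root_of_unity :: "nat \<Rightarrow> nat \<Rightarrow> complex" where
  "nth_root_of_unity N a = cis (2 * pi * real a / real N)"

lemma norm_nth_root_of_unity [simp]: "cmod (nth_root_of_unity N a) = 1"
  by (simp add: nth_root_of_unity_def)

lemma nth_root_of_unity_nonzero [simp]: "nth_root_of_unity N a \<noteq> 0"
  by (simp add: nth_root_of_unity_def)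

lemma cnj_nth_root_of_unity: "cnj (nth_root_of_unity N a) = inverse (nth_root_of_unity N a)"
  by (simp add: nth_root_of_unity_def cis_cnj)

lemma sum_nth_root_of_unity_powi:
  assumes j: "\<bar>j\<bar> < int N"
  shows "(\<Sum>a<N. nth_root_of_unity N a powi j) = (if j = 0 then of_nat N else 0)"
proof -
  define q where "q = cis (2 * pi * of_int j / real N)"
  have N: "N > 0" using j by simp
  have "nth_root_of_unity N a powi j = q ^ a" for a
    by (simp only: nth_root_of_unity_def q_def cis_power_int Complex.DeMoivre) (rule arg_cong[of _ _ cis], simp)
  then have S: "(\<Sum>a<N. nth_root_of_unity N a powi j) = (if q = 1 then of_nat N else (1 - q ^ N) / (1 - q))"
    by (simp add: sum_gp_strict)
  have "q ^ N = 1"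
    using N cis_multiple_2pi[of "of_int j"] by (simp add: q_def Complex.DeMoivre)
  moreover have "q \<noteq> 1" if "j \<noteq> 0"
  proof
    assume "q = 1"
    then have "cos (2 * pi * of_int j / real N) = 1"
      by (metis one_complex.sel(1) q_def cis.sel(1))
    then obtain n :: int where "2 * pi * of_int j / real N = of_int n * 2 * pi"
      unfolding cos_one_2pi_int by blast
    then have "real_of_int j = of_int n * of_int (int N)" using N by (simp add: field_simps)
    then have "j = n * int N" by (metis of_int_eq_iff of_int_mult)
    then have "\<bar>j\<bar> = \<bar>n\<bar> * int N" by (simp add: abs_mult)
    moreover have "\<bar>n\<bar> \<ge> 1" using \<open>j = n * int N\<close> that by auto
    ultimately show False using j mult_right_mono[of 1 "\<bar>n\<bar>" "int N"] by simp
  qed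
  moreover have "q = 1" if "j = 0" using that by (simp add: q_def)
  ultimately show ?thesis using S by auto
qed

definition taylor_coeff :: "int \<Rightarrow> (complex \<Rightarrow> complex) \<Rightarrow> complex" where
  "taylor_coeff k g = (if k \<ge> 0 then (deriv ^^ nat k) g 0 / fact (nat k) else 0)"

lemma taylor_remainder_bound:
  assumes g: "g holomorphic_on ball 0 1" and r: "0 < r" "r < \<rho>" "\<rho> < 1"
    and M: "\<And>z. cmod z = \<rho> \<Longrightarrow> cmod (g z) \<le> M" and z: "cmod z = r"
  shows "cmod (g z - (\<Sum>j<n. taylor_coeff (int j) g * z ^ j)) \<le> M * (r / \<rho>) ^ n / (1 - r / \<rho>)"
proof -
  define c where "c = (\<lambda>j::nat. taylor_coeff (int j) g * z ^ j)"
  have t: "0 \<le> r / \<rho>" "r / \<rho> < 1" using r by (auto simp: divide_simps)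
  have "(\<lambda>j. (deriv ^^ j) g 0 / fact j * (z - 0) ^ j) sums g z"
    using z r by (intro holomorphic_power_series[OF g]) auto
  then have "c sums g z" by (simp add: c_def taylor_coeff_def)
  then have "(\<lambda>j. c (j + n)) sums (g z - (\<Sum>j<n. c j))" by (rule sums_split_initial_segment)
  then have eq: "g z - (\<Sum>j<n. c j) = (\<Sum>j. c (j + n))" by (rule sums_unique)
  have cont: "continuous_on (cball 0 \<rho>) g"
    by (rule holomorphic_on_imp_continuous_on[OF holomorphic_on_subset[OF g]]) (use r in auto)
  have hol: "g holomorphic_on ball 0 \<rho>" by (rule holomorphic_on_subset[OF g]) (use r in auto)
  have cbound: "cmod (c j) \<le> M * (r / \<rho>) ^ j" for j
  proof -
    have "cmod ((deriv ^^ j) g 0) \<le> fact j * M / \<rho> ^ j"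
      by (rule Cauchy_inequality[OF hol cont]) (use r M in auto)
    then have "cmod ((deriv ^^ j) g 0) / fact j \<le> M / \<rho> ^ j"
      by (subst pos_divide_le_eq) (simp_all add: mult.commute)
    then have "cmod ((deriv ^^ j) g 0) / fact j * r ^ j \<le> M / \<rho> ^ j * r ^ j"
      using r by (intro mult_right_mono) auto
    then show ?thesis
      using z by (simp add: c_def taylor_coeff_def norm_mult norm_divide norm_power power_divide)
  qed
  have geo: "(\<lambda>j. M * (r / \<rho>) ^ (j + n)) sums (M * (r / \<rho>) ^ n * (1 / (1 - r / \<rho>)))"
    using sums_mult[OF geometric_sums[of "r / \<rho>"], of "M * (r / \<rho>) ^ n"] t
    by (simp add: power_add mult_ac)
  have "cmod (\<Sum>j. c (j + n)) \<le> (\<Sum>j. M * (r / \<rho>) ^ (j + n))"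
    by (rule norm_suminf_le[OF cbound sums_summable[OF geo]])
  with sums_unique[OF geo] eq show ?thesis by (simp add: c_def)
qed

text \<open>Averaging over the \<open>N\<close>-th roots of unity picks out one coefficient of a polynomial of small degree
  exactly, so only the Taylor remainder contributes to the error. Allowing \<open>s = -1\<close> covers the other chart, on
  which the circle is traversed backwards.\<close>

lemma average_taylor_coeff:
  assumes g: "g holomorphic_on ball 0 1" and r: "0 < r" "r < \<rho>" "\<rho> < 1"
    and M: "\<And>z. cmod z = \<rho> \<Longrightarrow> cmod (g z) \<le> M" and s: "s \<in> {1, -1 :: int}"
    and N: "2 * nat \<bar>k\<bar> < N"
  shows "cmod ((\<Sum>a<N. nth_root_of_unity N a powi (- s * k) * g (of_real r * nth_root_of_unity N a powi s)) / of_nat N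
    - of_real r ^ nat \<bar>k\<bar> * taylor_coeff k g) \<le> M * (r / \<rho>) ^ (N - nat \<bar>k\<bar>) / (1 - r / \<rho>)"
proof -
  define n where "n = N - nat \<bar>k\<bar>"
  define E where "E = nth_root_of_unity N"
  define p where "p = (\<lambda>z. \<Sum>j<n. taylor_coeff (int j) g * z ^ j)"
  define B where "B = M * (r / \<rho>) ^ n / (1 - r / \<rho>)"
  have N0: "N > 0" using N by simp
  have E: "cmod (E a) = 1" "E a \<noteq> 0" for a by (simp_all add: E_def)
  have exact: "(\<Sum>a<N. E a powi (- s * k) * p (of_real r * E a powi s))
      = of_nat N * (of_real r ^ nat \<bar>k\<bar> * taylor_coeff k g)"
  proof -
    have "E a powi (- s * k) * p (of_real r * E a powi s)
        = (\<Sum>j<n. taylor_coeff (int j) g * of_real r ^ j * E a powi (s * (int j - k)))" for a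
    proof -
      have "E a powi (- s * k) * (E a powi s) ^ j = E a powi (s * (int j - k))" for j
      proof -
        have "(E a powi s) ^ j = E a powi (s * int j)" by (simp add: power_int_power')
        moreover have "E a powi (- s * k) * E a powi (s * int j) = E a powi (- s * k + s * int j)"
          by (rule power_int_add[symmetric]) (simp add: E)
        ultimately show ?thesis by (simp add: right_diff_distrib)
      qed
      note e = this
      have "E a powi (- s * k) * (taylor_coeff (int j) g * (of_real r * E a powi s) ^ j)
          = taylor_coeff (int j) g * of_real r ^ j * E a powi (s * (int j - k))" for j
        unfolding e[symmetric] by (simp only: power_mult_distrib mult_ac)
      then show ?thesis unfolding p_def sum_distrib_left by (rule sum.cong[OF refl])
    qed
    then have "(\<Sum>a<N. E a powi (- s * k) * p (of_real r * E a powi s))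
        = (\<Sum>j<n. taylor_coeff (int j) g * of_real r ^ j * (\<Sum>a<N. E a powi (s * (int j - k))))"
      by (simp add: sum_distrib_left) (rule sum.swap)
    also have "\<dots> = (\<Sum>j<n. if int j = k then taylor_coeff (int j) g * of_real r ^ j * of_nat N else 0)"
    proof (rule sum.cong[OF refl])
      fix j assume "j \<in> {..<n}"
      then have "\<bar>int j - k\<bar> < int N" using N by (auto simp: n_def)
      then have "\<bar>s * (int j - k)\<bar> < int N" using s by (auto simp: abs_mult)
      from sum_nth_root_of_unity_powi[OF this]
      show "taylor_coeff (int j) g * of_real r ^ j * (\<Sum>a<N. E a powi (s * (int j - k)))
          = (if int j = k then taylor_coeff (int j) g * of_real r ^ j * of_nat N else 0)"
        using s by (auto simp: E_def)
    qed
    also have "\<dots> = of_nat N * (of_real r ^ nat \<bar>k\<bar> * taylor_coeff k g)"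
    proof (cases "k \<ge> 0")
      case True
      then have "int j = k \<longleftrightarrow> j = nat k" for j by auto
      moreover have "nat k < n" using N True by (simp add: n_def)
      ultimately show ?thesis using True by (simp add: sum.delta)
    next
      case False
      then have "int j \<noteq> k" for j by auto
      then show ?thesis using False by (simp add: taylor_coeff_def)
    qed
    finally show ?thesis .
  qed
  have "cmod ((\<Sum>a<N. E a powi (- s * k) * g (of_real r * E a powi s))
      - (\<Sum>a<N. E a powi (- s * k) * p (of_real r * E a powi s)))
      \<le> (\<Sum>a<N. cmod (E a powi (- s * k) * (g (of_real r * E a powi s) - p (of_real r * E a powi s))))"
    unfolding sum_subtractf[symmetric] right_diff_distrib[symmetric] by (rule norm_sum)
  also have "\<dots> \<le> (\<Sum>a<N. B)"
  proof (rule sum_mono)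
    fix a
    have "cmod (of_real r * E a powi s) = r" using E r by (simp add: norm_mult norm_power_int)
    from taylor_remainder_bound[OF g r M this, of n]
    show "cmod (E a powi (- s * k) * (g (of_real r * E a powi s) - p (of_real r * E a powi s))) \<le> B"
      using E by (simp add: norm_mult norm_power_int p_def B_def)
  qed
  finally have "cmod ((\<Sum>a<N. E a powi (- s * k) * g (of_real r * E a powi s))
      - of_nat N * (of_real r ^ nat \<bar>k\<bar> * taylor_coeff k g)) \<le> of_nat N * B"
    unfolding exact by simp
  then have "cmod (of_nat N * ((\<Sum>a<N. E a powi (- s * k) * g (of_real r * E a powi s)) / of_nat N
      - of_real r ^ nat \<bar>k\<bar> * taylor_coeff k g)) \<le> of_nat N * B"
    using N0 by (simp add: right_diff_distrib)
  then have "cmod ((\<Sum>a<N. E a powi (- s * k) * g (of_real r * E a powi s)) / of_nat N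
      - of_real r ^ nat \<bar>k\<bar> * taylor_coeff k g) \<le> B"
    using N0 by (simp add: norm_mult)
  then show ?thesis by (simp only: E_def B_def n_def)
qed

text \<open>Functions with an expansion \<open>c\<^sub>0 + 2 \<Sum> c\<^sub>n z\<^sup>n\<close> inside the unit circle and
  \<open>-c\<^sub>0 - 2 \<Sum> c\<^sub>-\<^sub>n z\<^sup>-\<^sup>n\<close> outside, such as \<open>(1 + z w) / (1 - z w)\<close> for \<open>|w| = 1\<close>, where \<open>c\<^sub>n = w\<^sup>n\<close>.\<close>

definition two_sided_holomorphic :: "(ecomplex \<Rightarrow> complex) \<Rightarrow> bool" where
  "two_sided_holomorphic g \<longleftrightarrow> (\<lambda>z. g (Fin z)) holomorphic_on Te \<and>
     (\<lambda>u. g (chart_infty u)) holomorphic_on Te \<and> g (Fin 0) + g Infty = 0"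

definition fourier_coeff :: "int \<Rightarrow> (ecomplex \<Rightarrow> complex) \<Rightarrow> complex" where
  "fourier_coeff k g = (taylor_coeff k (\<lambda>z. g (Fin z)) - taylor_coeff (- k) (\<lambda>u. g (chart_infty u))) / 2"

text \<open>A discretization of the \<open>k\<close>-th Fourier coefficient of half the jump of \<open>g\<close> across the circle.\<close>

definition jump_average :: "nat \<Rightarrow> real \<Rightarrow> int \<Rightarrow> (ecomplex \<Rightarrow> complex) \<Rightarrow> complex" where
  "jump_average N r k g = (\<Sum>a<N. nth_root_of_unity N a powi (- k) *
     ((g (Fin (of_real r * nth_root_of_unity N a)) - g (Fin (nth_root_of_unity N a / of_real r))) / 2)) / of_nat N"

lemma ball_subset_Te: "ball 0 1 \<subseteq> Te"
  by (auto simp: Te_def)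

lemma jump_average_bound:
  assumes g: "(\<lambda>z. g (Fin z)) holomorphic_on Te" "(\<lambda>u. g (chart_infty u)) holomorphic_on Te"
    and r: "0 < r" "r < \<rho>" "\<rho> < 1"
    and M: "\<And>z. cmod z = \<rho> \<Longrightarrow> cmod (g (Fin z)) \<le> M" "\<And>u. cmod u = \<rho> \<Longrightarrow> cmod (g (chart_infty u)) \<le> M"
    and N: "2 * nat \<bar>k\<bar> < N"
  shows "cmod (jump_average N r k g - of_real r ^ nat \<bar>k\<bar> * fourier_coeff k g)
    \<le> M * (r / \<rho>) ^ (N - nat \<bar>k\<bar>) / (1 - r / \<rho>)"
proof -
  let ?B = "M * (r / \<rho>) ^ (N - nat \<bar>k\<bar>) / (1 - r / \<rho>)"
  let ?E = "nth_root_of_unity N"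
  let ?A = "(\<Sum>a<N. ?E a powi (- k) * g (Fin (of_real r * ?E a))) / of_nat N"
  let ?A' = "(\<Sum>a<N. ?E a powi (- k) * g (chart_infty (of_real r * ?E a powi (- 1)))) / of_nat N"
  have half: "cmod ((x - y) / 2) \<le> B" if "cmod x \<le> B" "cmod y \<le> B" for x y B
    using norm_triangle_ineq4[of x y] that by (simp add: norm_divide)
  have 1: "cmod (?A - of_real r ^ nat \<bar>k\<bar> * taylor_coeff k (\<lambda>z. g (Fin z))) \<le> ?B"
    using average_taylor_coeff[OF holomorphic_on_subset[OF g(1) ball_subset_Te] r M(1) _ N, of 1] by simp
  have 2: "cmod (?A' - of_real r ^ nat \<bar>k\<bar> * taylor_coeff (- k) (\<lambda>u. g (chart_infty u))) \<le> ?B"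
    using average_taylor_coeff[OF holomorphic_on_subset[OF g(2) ball_subset_Te] r M(2), of "-1" "-k" N] N
    by simp
  have "chart_infty (of_real r * ?E a powi (- 1)) = Fin (?E a / of_real r)" for a
    using r by (simp add: chart_infty_def power_int_minus field_simps)
  then have "jump_average N r k g = (?A - ?A') / 2"
    unfolding jump_average_def
    by (simp add: sum_subtractf[symmetric] sum_divide_distrib diff_divide_distrib right_diff_distrib
        mult.commute)
  then have "jump_average N r k g - of_real r ^ nat \<bar>k\<bar> * fourier_coeff k g
      = ((?A - of_real r ^ nat \<bar>k\<bar> * taylor_coeff k (\<lambda>z. g (Fin z)))
       - (?A' - of_real r ^ nat \<bar>k\<bar> * taylor_coeff (- k) (\<lambda>u. g (chart_infty u)))) / 2"
    by (simp only: fourier_coeff_def diff_divide_distrib right_diff_distrib times_divide_eq_right) simp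
  also have "cmod \<dots> \<le> ?B"
    by (rule half[OF 1 2])
  finally show ?thesis .
qed

lemma geometric_error_tendsto_0:
  fixes t :: real
  assumes "0 \<le> t" "t < 1"
  shows "(\<lambda>N. M * t ^ (N - m) / (1 - t)) \<longlonglongrightarrow> 0"
proof -
  have "(\<lambda>N. t ^ N) \<longlonglongrightarrow> 0" using assms by (intro LIMSEQ_power_zero) simp
  then have "(\<lambda>N. t ^ (N + m - m)) \<longlonglongrightarrow> 0" by simp
  then have "(\<lambda>N. t ^ (N - m)) \<longlonglongrightarrow> 0" by (rule LIMSEQ_offset)
  then have "(\<lambda>N. M * t ^ (N - m) / (1 - t)) \<longlonglongrightarrow> M * 0 / (1 - t)"
    using assms by (intro tendsto_intros) auto
  then show ?thesis by simp
qed

lemma jump_average_tendsto: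
  assumes g: "two_sided_holomorphic g" and r: "0 < r" "r < 1"
  shows "(\<lambda>N. jump_average N r k g) \<longlonglongrightarrow> of_real r ^ nat \<bar>k\<bar> * fourier_coeff k g"
proof -
  \<comment> \<open>Any radius strictly between \<open>r\<close> and \<open>1\<close>.\<close>
  define \<rho> where "\<rho> = (1 + r) / 2"
  have \<rho>: "r < \<rho>" "\<rho> < 1" using r by (auto simp: \<rho>_def)
  have sph: "sphere 0 \<rho> \<subseteq> Te" using \<rho> by (auto simp: Te_def)
  have bnd: "\<exists>M. \<forall>z. cmod z = \<rho> \<longrightarrow> cmod (h z) \<le> M" if "h holomorphic_on Te" for h
  proof -
    have "continuous_on (sphere 0 \<rho>) h"
      by (rule holomorphic_on_imp_continuous_on[OF holomorphic_on_subset[OF that sph]])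
    then have "bounded (h ` sphere 0 \<rho>)"
      by (intro compact_imp_bounded compact_continuous_image compact_sphere)
    then obtain M where M: "\<forall>y \<in> h ` sphere 0 \<rho>. cmod y \<le> M" unfolding bounded_iff ..
    show ?thesis
    proof (intro exI[of _ M] allI impI)
      fix z assume "cmod z = \<rho>"
      then have "h z \<in> h ` sphere 0 \<rho>" by simp
      with M show "cmod (h z) \<le> M" by blast
    qed
  qed
  have hol: "(\<lambda>z. g (Fin z)) holomorphic_on Te" "(\<lambda>u. g (chart_infty u)) holomorphic_on Te"
    using g by (auto simp: two_sided_holomorphic_def)
  obtain M1 M2 where "\<And>z. cmod z = \<rho> \<Longrightarrow> cmod (g (Fin z)) \<le> M1"
    "\<And>z. cmod z = \<rho> \<Longrightarrow> cmod (g (chart_infty z)) \<le> M2"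
    using bnd[OF hol(1)] bnd[OF hol(2)] by blast
  then have M: "\<And>z. cmod z = \<rho> \<Longrightarrow> cmod (g (Fin z)) \<le> max M1 M2"
    "\<And>z. cmod z = \<rho> \<Longrightarrow> cmod (g (chart_infty z)) \<le> max M1 M2" by (auto intro: max.coboundedI1 max.coboundedI2)
  have "(\<lambda>N. jump_average N r k g - of_real r ^ nat \<bar>k\<bar> * fourier_coeff k g) \<longlonglongrightarrow> 0"
  proof (rule Lim_null_comparison)
    show "\<forall>\<^sub>F N in sequentially. cmod (jump_average N r k g - of_real r ^ nat \<bar>k\<bar> * fourier_coeff k g)
        \<le> max M1 M2 * (r / \<rho>) ^ (N - nat \<bar>k\<bar>) / (1 - r / \<rho>)"
      using eventually_gt_at_top[of "2 * nat \<bar>k\<bar>"]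
      by eventually_elim (rule jump_average_bound[OF hol r(1) \<rho> M])
    show "(\<lambda>N. max M1 M2 * (r / \<rho>) ^ (N - nat \<bar>k\<bar>) / (1 - r / \<rho>)) \<longlonglongrightarrow> 0"
      using r \<rho> by (intro geometric_error_tendsto_0) (auto simp: divide_simps)
  qed
  then show ?thesis by (simp add: LIM_zero_iff)
qed

definition circle_side :: "complex \<Rightarrow> int" where
  "circle_side z = (if cmod z < 1 then 1 else -1)"

text \<open>The coefficients of the expansion of \<open>(1 + z w) / (1 - z w)\<close> in the powers \<open>w\<^sup>n\<close>, \<open>n \<ge> 0\<close>, for \<open>|z| < 1\<close>,
  and in the powers \<open>w\<^sup>-\<^sup>n\<close> for \<open>|z| > 1\<close>, where \<open>|w| = 1\<close>.\<close>

definition cayley_weight :: "complex \<Rightarrow> nat \<Rightarrow> complex" where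
  "cayley_weight z n = of_int (circle_side z) * (if n = 0 then 1 else 2) * (z powi circle_side z) ^ n"

text \<open>A scalar function has the same expansion, with the same weights, as the Cayley transform of a unitary
  operator below. So a function of this kind and the Cayley transform agree as soon as the Fourier coefficients
  are the moments \<open>(U\<^sup>n x, y)\<close>.\<close>

lemma two_sided_holomorphic_sums:
  assumes g: "two_sided_holomorphic g" and z: "z \<in> Te"
  shows "(\<lambda>n. cayley_weight z n * fourier_coeff (circle_side z * int n) g) sums g (Fin z)"
proof -
  have hol: "(\<lambda>z. g (Fin z)) holomorphic_on ball 0 1" "(\<lambda>u. g (chart_infty u)) holomorphic_on ball 0 1"
    using g holomorphic_on_subset[OF _ ball_subset_Te] by (auto simp: two_sided_holomorphic_def)
  have g0: "g Infty = - g (Fin 0)"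
    using g by (simp add: two_sided_holomorphic_def eq_neg_iff_add_eq_0 add.commute)
  show ?thesis
  proof (cases "cmod z < 1")
    case True
    have "(\<lambda>n. (deriv ^^ n) (\<lambda>z. g (Fin z)) 0 / fact n * (z - 0) ^ n) sums g (Fin z)"
      by (rule holomorphic_power_series[OF hol(1)]) (use True in auto)
    \<comment> \<open>For \<open>n = 0\<close> both charts contribute to the coefficient, which is why the value at infinity enters.\<close>
    moreover have "(deriv ^^ n) (\<lambda>z. g (Fin z)) 0 / fact n * (z - 0) ^ n
        = cayley_weight z n * fourier_coeff (circle_side z * int n) g" for n
      using True by (cases "n = 0")
        (auto simp: cayley_weight_def circle_side_def fourier_coeff_def taylor_coeff_def chart_infty_def g0)
    ultimately show ?thesis by simp
  next
    case False
    then have z1: "cmod z > 1" "z \<noteq> 0" using z by (auto simp: Te_def)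
    have "(\<lambda>n. (deriv ^^ n) (\<lambda>u. g (chart_infty u)) 0 / fact n * (1 / z - 0) ^ n) sums g (chart_infty (1 / z))"
      by (rule holomorphic_power_series[OF hol(2)]) (use z1 in \<open>auto simp: norm_divide divide_simps\<close>)
    moreover have "(deriv ^^ n) (\<lambda>u. g (chart_infty u)) 0 / fact n * (1 / z - 0) ^ n
        = cayley_weight z n * fourier_coeff (circle_side z * int n) g" for n
      using False by (cases "n = 0")
        (auto simp: cayley_weight_def circle_side_def fourier_coeff_def taylor_coeff_def chart_infty_def g0
          power_int_minus inverse_eq_divide)
    moreover have "chart_infty (1 / z) = Fin z" using z1 by (simp add: chart_infty_def)
    ultimately show ?thesis by simp
  qed
qed

lemma unitary_funpow_norm: "unitary U \<Longrightarrow> norm ((U ^^ n) x) = norm x"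
  by (induction n) (simp_all add: unitary_norm)

text \<open>The Neumann series \<open>S = \<Sum> z\<^sup>n U\<^sup>n\<close> for the resolvent, with \<open>F = 2 S - E\<close>.\<close>

lemma cayley_factor_sums_inside:
  fixes x y :: "'a::chilbert_space"
  assumes U: "unitary U" and z: "cmod z < 1"
  shows "(\<lambda>n. (if n = 0 then 1 else 2) * z ^ n * cinner ((U ^^ n) x) y) sums cinner (cayley_factor z U x) y"
proof -
  have Te: "z \<in> Te" using z by (auto simp: Te_def)
  note lin = unitary_resolvent_linear[OF U Te]
  let ?S = "unitary_resolvent z U"
  have step: "?S v = v + z *\<^sub>C ?S (U v)" for v
    using unitary_resolvent_solves[OF U Te, of v]
      unitary_resolvent_commute[OF U Te unitary_clinear[OF U], of v] by (simp add: algebra_simps)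
  have part: "cinner (?S x) y = (\<Sum>k<n. z ^ k * cinner ((U ^^ k) x) y) + z ^ n * cinner (?S ((U ^^ n) x)) y" for n
  proof (induction n)
    case (Suc n)
    have "cinner (?S ((U ^^ n) x)) y = cinner ((U ^^ n) x) y + z * cinner (?S ((U ^^ Suc n) x)) y"
      by (subst step) (simp add: cinner_add_left cinner_scaleC_left)
    with Suc show ?case by (simp add: algebra_simps)
  qed simp
  have "(\<lambda>n. z ^ n * cinner (?S ((U ^^ n) x)) y) \<longlonglongrightarrow> 0"
  proof (rule Lim_null_comparison)
    show "\<forall>\<^sub>F n in sequentially. cmod (z ^ n * cinner (?S ((U ^^ n) x)) y) \<le> cmod z ^ n * (norm x / \<bar>1 - cmod z\<bar> * norm y)"
    proof (rule always_eventually, rule allI)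
      fix n
      have "cmod (cinner (?S ((U ^^ n) x)) y) \<le> norm (?S ((U ^^ n) x)) * norm y" by (rule cauchy_schwarz)
      also have "\<dots> \<le> norm x / \<bar>1 - cmod z\<bar> * norm y"
        using unitary_resolvent_bound[OF U Te, of "(U ^^ n) x"]
        by (intro mult_right_mono) (simp_all add: unitary_funpow_norm[OF U])
      finally show "cmod (z ^ n * cinner (?S ((U ^^ n) x)) y) \<le> cmod z ^ n * (norm x / \<bar>1 - cmod z\<bar> * norm y)"
        unfolding norm_mult norm_power by (intro mult_left_mono) simp_all
    qed
    have "(\<lambda>n. cmod z ^ n * (norm x / \<bar>1 - cmod z\<bar> * norm y)) \<longlonglongrightarrow> 0 * (norm x / \<bar>1 - cmod z\<bar> * norm y)"
      using z by (intro tendsto_mult tendsto_const LIMSEQ_power_zero) simp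
    then show "(\<lambda>n. cmod z ^ n * (norm x / \<bar>1 - cmod z\<bar> * norm y)) \<longlonglongrightarrow> 0" by simp
  qed
  then have "(\<lambda>n. cinner (?S x) y - z ^ n * cinner (?S ((U ^^ n) x)) y) \<longlonglongrightarrow> cinner (?S x) y - 0"
    by (intro tendsto_intros)
  moreover have "(\<Sum>k<n. z ^ k * cinner ((U ^^ k) x) y) = cinner (?S x) y - z ^ n * cinner (?S ((U ^^ n) x)) y" for n
    using part[of n] by simp
  ultimately have "(\<lambda>n. z ^ n * cinner ((U ^^ n) x) y) sums cinner (?S x) y"
    by (simp add: sums_def)
  from sums_diff[OF sums_mult[OF this, of 2] sums_single[of 0 "\<lambda>_. cinner x y"]]
  have "(\<lambda>n. 2 * (z ^ n * cinner ((U ^^ n) x) y) - (if n = 0 then cinner x y else 0)) sums cinner (cayley_factor z U x) y"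
    by (simp add: cayley_factor_eq[OF U Te] cinner_diff_left cinner_scaleC_left)
  moreover have "2 * (z ^ n * cinner ((U ^^ n) x) y) - (if n = 0 then cinner x y else 0)
      = (if n = 0 then 1 else 2) * z ^ n * cinner ((U ^^ n) x) y" for n
    by simp
  ultimately show ?thesis by simp
qed

lemma cayley_factor_sums:
  fixes x y :: "'a::chilbert_space"
  assumes U: "unitary U" and z: "z \<in> Te"
  shows "(\<lambda>n. cayley_weight z n * cinner (((if cmod z < 1 then U else inv U) ^^ n) x) y)
    sums cinner (cayley_factor z U x) y"
proof (cases "cmod z < 1")
  case True
  then show ?thesis
    using cayley_factor_sums_inside[OF U True, of x y] by (simp add: cayley_weight_def circle_side_def)
next
  case False
  then have z1: "cmod z > 1" "z \<noteq> 0" using z by (auto simp: Te_def)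
  then have "cmod (1 / z) < 1" by (simp add: norm_divide divide_less_eq)
  from sums_minus[OF cayley_factor_sums_inside[OF unitary_inv[OF U] this, of x y]]
  show ?thesis
    using False cayley_factor_inverse[OF unitary_inv[OF U] z z1(2), of x] 
    by (simp add: cayley_weight_def circle_side_def power_int_minus inverse_eq_divide unitary_inv_inv[OF U])
qed


section \<open>Fourier coefficients in two variables\<close>

definition two_sided_holomorphic2 :: "(ecomplex \<Rightarrow> ecomplex \<Rightarrow> complex) \<Rightarrow> bool" where
  "two_sided_holomorphic2 g \<longleftrightarrow>
     (\<forall>\<phi>\<in>{Fin, chart_infty}. \<forall>\<psi>\<in>{Fin, chart_infty}.
        continuous_on (Te \<times> Te) (\<lambda>(u, v). g (\<phi> u) (\<psi> v)) \<and>
        (\<forall>v\<in>Te. (\<lambda>u. g (\<phi> u) (\<psi> v)) holomorphic_on Te) \<and>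
        (\<forall>u\<in>Te. (\<lambda>v. g (\<phi> u) (\<psi> v)) holomorphic_on Te)) \<and>
     (\<forall>Z\<in>Te_ext. g Z (Fin 0) + g Z Infty = 0 \<and> g (Fin 0) Z + g Infty Z = 0)"

lemma class_H2_imp_two_sided_holomorphic2:
  assumes f: "class_H2 f"
  shows "two_sided_holomorphic2 f"
  unfolding two_sided_holomorphic2_def
proof (intro conjI ballI)
  fix \<phi> \<psi> assume c: "\<phi> \<in> {Fin, chart_infty}" "\<psi> \<in> {Fin, chart_infty}"
  define F where "F = (\<lambda>(u, v). f (\<phi> u) (\<psi> v))"
  have "holomorphic2_on F (Te \<times> Te)" using f c unfolding class_H2_def F_def by blast
  then have d: "\<exists>a b. (F has_derivative (\<lambda>(h, k). a * h + b * k)) (at p)" if "p \<in> Te \<times> Te" for p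
    using that unfolding holomorphic2_on_def by blast
  show "continuous_on (Te \<times> Te) (\<lambda>(u, v). f (\<phi> u) (\<psi> v))"
    unfolding F_def[symmetric]
    by (rule continuous_at_imp_continuous_on) (metis d has_derivative_continuous)
  have "(\<lambda>u. f (\<phi> u) (\<psi> v)) field_differentiable at u" if uv: "u \<in> Te" "v \<in> Te" for u v
  proof -
    obtain a b where ab: "(F has_derivative (\<lambda>(h, k). a * h + b * k)) (at (u, v))"
      using d[of "(u, v)"] uv by blast
    have "((\<lambda>u. (u, v)) has_derivative (\<lambda>h. (h, 0))) (at u)"
      by (intro derivative_eq_intros) auto
    from has_derivative_compose[OF this ab]
    have "((\<lambda>u. f (\<phi> u) (\<psi> v)) has_derivative (\<lambda>h. a * h)) (at u)" by (simp add: F_def)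
    then show ?thesis by (auto simp: field_differentiable_def has_field_derivative_def)
  qed
  then show "(\<lambda>u. f (\<phi> u) (\<psi> v)) holomorphic_on Te" if "v \<in> Te" for v
    using that open_Te by (simp add: holomorphic_on_def field_differentiable_at_within)
  have "(\<lambda>v. f (\<phi> u) (\<psi> v)) field_differentiable at v" if uv: "u \<in> Te" "v \<in> Te" for u v
  proof -
    obtain a b where ab: "(F has_derivative (\<lambda>(h, k). a * h + b * k)) (at (u, v))"
      using d[of "(u, v)"] uv by blast
    have "((\<lambda>v. (u, v)) has_derivative (\<lambda>h. (0, h))) (at v)"
      by (intro derivative_eq_intros) auto
    from has_derivative_compose[OF this ab]
    have "((\<lambda>v. f (\<phi> u) (\<psi> v)) has_derivative (\<lambda>h. b * h)) (at v)" by (simp add: F_def)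
    then show ?thesis by (auto simp: field_differentiable_def has_field_derivative_def)
  qed
  then show "(\<lambda>v. f (\<phi> u) (\<psi> v)) holomorphic_on Te" if "u \<in> Te" for u
    using that open_Te by (simp add: holomorphic_on_def field_differentiable_at_within)
next
  fix Z assume "Z \<in> Te_ext"
  then show "f Z (Fin 0) + f Z Infty = 0" "f (Fin 0) Z + f Infty Z = 0"
    using f unfolding class_H2_def by blast+
qed

lemma two_sided_holomorphic2_linear:
  assumes f: "two_sided_holomorphic2 f" and g: "two_sided_holomorphic2 g"
  shows "two_sided_holomorphic2 (\<lambda>Z1 Z2. f Z1 Z2 + c * g Z1 Z2)"
  unfolding two_sided_holomorphic2_def
proof (intro conjI ballI)
  fix \<phi> \<psi> assume ch: "\<phi> \<in> {Fin, chart_infty}" "\<psi> \<in> {Fin, chart_infty}"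
  have 1: "continuous_on (Te \<times> Te) (\<lambda>(u, v). f (\<phi> u) (\<psi> v))" "continuous_on (Te \<times> Te) (\<lambda>(u, v). g (\<phi> u) (\<psi> v))"
    using f g ch unfolding two_sided_holomorphic2_def by blast+
  show "continuous_on (Te \<times> Te) (\<lambda>(u, v). f (\<phi> u) (\<psi> v) + c * g (\<phi> u) (\<psi> v))"
    using continuous_on_add[OF 1(1) continuous_on_mult[OF continuous_on_const 1(2)], of c]
    by (simp add: case_prod_unfold)
  fix v assume v: "v \<in> Te"
  have "(\<lambda>u. f (\<phi> u) (\<psi> v)) holomorphic_on Te" "(\<lambda>u. g (\<phi> u) (\<psi> v)) holomorphic_on Te"
    using f g ch v unfolding two_sided_holomorphic2_def by blast+
  then show "(\<lambda>u. f (\<phi> u) (\<psi> v) + c * g (\<phi> u) (\<psi> v)) holomorphic_on Te"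
    by (intro holomorphic_intros)
next
  fix \<phi> \<psi> u assume ch: "\<phi> \<in> {Fin, chart_infty}" "\<psi> \<in> {Fin, chart_infty}" and u: "u \<in> Te"
  have "(\<lambda>v. f (\<phi> u) (\<psi> v)) holomorphic_on Te" "(\<lambda>v. g (\<phi> u) (\<psi> v)) holomorphic_on Te"
    using f g ch u unfolding two_sided_holomorphic2_def by blast+
  then show "(\<lambda>v. f (\<phi> u) (\<psi> v) + c * g (\<phi> u) (\<psi> v)) holomorphic_on Te"
    by (intro holomorphic_intros)
next
  fix Z assume "Z \<in> Te_ext"
  then have "f Z (Fin 0) + f Z Infty = 0" "f (Fin 0) Z + f Infty Z = 0"
    "g Z (Fin 0) + g Z Infty = 0" "g (Fin 0) Z + g Infty Z = 0"
    using f g unfolding two_sided_holomorphic2_def by blast+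
  then have "(f Z (Fin 0) + f Z Infty) + c * (g Z (Fin 0) + g Z Infty) = 0"
    "(f (Fin 0) Z + f Infty Z) + c * (g (Fin 0) Z + g Infty Z) = 0" by simp_all
  then show "f Z (Fin 0) + c * g Z (Fin 0) + (f Z Infty + c * g Z Infty) = 0"
    "f (Fin 0) Z + c * g (Fin 0) Z + (f Infty Z + c * g Infty Z) = 0"
    by (simp_all add: algebra_simps)
qed

lemma Te_ext_cases:
  assumes "Z \<in> Te_ext"
  obtains \<phi> u where "\<phi> \<in> {Fin, chart_infty}" "u \<in> Te" "Z = \<phi> u"
proof (cases Z)
  case (Fin z)
  then show ?thesis using assms that[of Fin z] by (auto simp: Te_ext_def)
next
  case Infty
  then show ?thesis using that[of chart_infty 0] by (simp add: chart_infty_def Te_def)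
qed

lemma two_sided_holomorphic2_slice:
  assumes g: "two_sided_holomorphic2 g" and Z: "Z \<in> Te_ext"
  shows "two_sided_holomorphic (g Z)"
proof -
  obtain \<phi> u where \<phi>: "\<phi> \<in> {Fin, chart_infty}" "u \<in> Te" "Z = \<phi> u" using Te_ext_cases[OF Z] .
  then have "(\<lambda>v. g Z (\<psi> v)) holomorphic_on Te" if "\<psi> \<in> {Fin, chart_infty}" for \<psi>
    using g that unfolding two_sided_holomorphic2_def by blast
  moreover have "g Z (Fin 0) + g Z Infty = 0" using g Z unfolding two_sided_holomorphic2_def by blast
  ultimately show ?thesis unfolding two_sided_holomorphic_def by blast
qed

lemma scaled_root_in_Te:
  assumes "0 < r" "r < 1"
  shows "of_real r * nth_root_of_unity N a \<in> Te" "nth_root_of_unity N a / of_real r \<in> Te"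
  using assms by (auto simp: Te_def norm_mult norm_divide)

text \<open>The averages in the second variable are finite sums of functions holomorphic in the first one,
  and they converge locally uniformly in the first variable, because the bound for the error involves
  \<open>g\<close> only through its maximum on a compact set.\<close>

lemma fourier_coeff_holomorphic:
  assumes g: "two_sided_holomorphic2 g" and \<phi>: "\<phi> \<in> {Fin, chart_infty}"
  shows "(\<lambda>u. fourier_coeff n (g (\<phi> u))) holomorphic_on Te"
proof -
  \<comment> \<open>The coefficients do not depend on the radii; any \<open>0 < r < \<rho> < 1\<close> would do.\<close>
  define r :: real where "r = 1/4"
  define \<rho> :: real where "\<rho> = 1/2"
  have r: "0 < r" "r < \<rho>" "\<rho> < 1" "r < 1" by (auto simp: r_def \<rho>_def)
  define m where "m = nat \<bar>n\<bar>"
  show ?thesis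
  proof (rule holomorphic_uniform_sequence[OF open_Te])
    fix N
    show "(\<lambda>u. jump_average N r n (g (\<phi> u)) / of_real r ^ m) holomorphic_on Te"
      unfolding jump_average_def
      by (intro holomorphic_intros)
        (use g \<phi> scaled_root_in_Te[OF r(1,4)] r in \<open>auto simp: two_sided_holomorphic2_def\<close>)
  next
    fix x assume "x \<in> Te"
    then obtain d where d: "d > 0" "cball x d \<subseteq> Te" using open_Te open_contains_cball by blast
    have sph: "sphere (0::complex) \<rho> \<subseteq> Te" using r by (auto simp: Te_def)
    have bnd: "\<exists>M. \<forall>u\<in>cball x d. \<forall>v\<in>sphere (0::complex) \<rho>. cmod (g (\<phi> u) (\<psi> v)) \<le> M"
      if \<psi>: "\<psi> \<in> {Fin, chart_infty}" for \<psi>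
    proof -
      have "continuous_on (Te \<times> Te) (\<lambda>(u, v). g (\<phi> u) (\<psi> v))"
        using g \<phi> \<psi> unfolding two_sided_holomorphic2_def by blast
      then have "continuous_on (cball x d \<times> sphere 0 \<rho>) (\<lambda>(u, v). g (\<phi> u) (\<psi> v))"
        by (rule continuous_on_subset) (use d sph in auto)
      then have "bounded ((\<lambda>(u, v). g (\<phi> u) (\<psi> v)) ` (cball x d \<times> sphere 0 \<rho>))"
        by (intro compact_imp_bounded compact_continuous_image compact_Times compact_sphere compact_cball)
      then obtain M where M: "\<forall>y \<in> (\<lambda>(u, v). g (\<phi> u) (\<psi> v)) ` (cball x d \<times> sphere 0 \<rho>). cmod y \<le> M"
        unfolding bounded_iff ..
      show ?thesis
      proof (intro exI[of _ M] ballI)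
        fix u v :: complex assume "u \<in> cball x d" "v \<in> sphere 0 \<rho>"
        then have "g (\<phi> u) (\<psi> v) \<in> (\<lambda>(u, v). g (\<phi> u) (\<psi> v)) ` (cball x d \<times> sphere 0 \<rho>)"
          by (intro image_eqI[of _ _ "(u, v)"]) auto
        with M show "cmod (g (\<phi> u) (\<psi> v)) \<le> M" by blast
      qed
    qed
    obtain M1 where M1: "\<And>u v. u \<in> cball x d \<Longrightarrow> v \<in> sphere 0 \<rho> \<Longrightarrow> cmod (g (\<phi> u) (Fin v)) \<le> M1"
      using bnd[of Fin] by blast
    obtain M2 where M2: "\<And>u v. u \<in> cball x d \<Longrightarrow> v \<in> sphere 0 \<rho> \<Longrightarrow> cmod (g (\<phi> u) (chart_infty v)) \<le> M2"
      using bnd[of chart_infty] by blast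
    define M where "M = max M1 M2"
    have err: "cmod (jump_average N r n (g (\<phi> u)) / of_real r ^ m - fourier_coeff n (g (\<phi> u)))
        \<le> M / r ^ m * (r / \<rho>) ^ (N - m) / (1 - r / \<rho>)" if u: "u \<in> cball x d" and N: "2 * m < N" for u N
    proof -
      have "\<phi> u \<in> Te_ext" using u d chart_in_Te_ext[OF \<phi>] by blast
      then have hol: "(\<lambda>z. g (\<phi> u) (Fin z)) holomorphic_on Te" "(\<lambda>v. g (\<phi> u) (chart_infty v)) holomorphic_on Te"
        using two_sided_holomorphic2_slice[OF g] by (auto simp: two_sided_holomorphic_def)
      have "cmod (jump_average N r n (g (\<phi> u)) - of_real r ^ nat \<bar>n\<bar> * fourier_coeff n (g (\<phi> u)))
          \<le> M * (r / \<rho>) ^ (N - nat \<bar>n\<bar>) / (1 - r / \<rho>)"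
        using N M1[OF u] M2[OF u]
        by (intro jump_average_bound[OF hol r(1-3)]) (auto simp: m_def M_def intro: max.coboundedI1 max.coboundedI2)
      then have "cmod (jump_average N r n (g (\<phi> u)) - of_real r ^ m * fourier_coeff n (g (\<phi> u))) / r ^ m
          \<le> M * (r / \<rho>) ^ (N - m) / (1 - r / \<rho>) / r ^ m"
        using r by (intro divide_right_mono) (auto simp: m_def)
      moreover have "jump_average N r n (g (\<phi> u)) / of_real r ^ m - fourier_coeff n (g (\<phi> u))
          = (jump_average N r n (g (\<phi> u)) - of_real r ^ m * fourier_coeff n (g (\<phi> u))) / of_real r ^ m"
        using r by (simp add: diff_divide_distrib)
      ultimately show ?thesis using r by (simp add: norm_divide norm_power mult_ac)
    qed
    have "uniform_limit (cball x d) (\<lambda>N u. jump_average N r n (g (\<phi> u)) / of_real r ^ m)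
        (\<lambda>u. fourier_coeff n (g (\<phi> u))) sequentially"
    proof (rule uniform_limitI)
      fix e :: real assume "e > 0"
      have "(\<lambda>N. M / r ^ m * (r / \<rho>) ^ (N - m) / (1 - r / \<rho>)) \<longlonglongrightarrow> 0"
        by (intro geometric_error_tendsto_0) (auto simp: r_def \<rho>_def)
      then have "\<forall>\<^sub>F N in sequentially. M / r ^ m * (r / \<rho>) ^ (N - m) / (1 - r / \<rho>) < e"
        using \<open>e > 0\<close> by (rule order_tendstoD)
      with eventually_gt_at_top[of "2 * m"]
      show "\<forall>\<^sub>F N in sequentially. \<forall>u\<in>cball x d.
          dist (jump_average N r n (g (\<phi> u)) / of_real r ^ m) (fourier_coeff n (g (\<phi> u))) < e"
      proof eventually_elim
        case (elim N)
        show ?case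
        proof
          fix u assume "u \<in> cball x d"
          from err[OF this elim(1)] elim(2)
          show "dist (jump_average N r n (g (\<phi> u)) / of_real r ^ m) (fourier_coeff n (g (\<phi> u))) < e"
            by (simp add: dist_norm)
        qed
      qed
    qed
    with d show "\<exists>d>0. cball x d \<subseteq> Te \<and> uniform_limit (cball x d)
        (\<lambda>N u. jump_average N r n (g (\<phi> u)) / of_real r ^ m) (\<lambda>u. fourier_coeff n (g (\<phi> u))) sequentially"
      by blast
  qed
qed

lemma fourier_coeff_two_sided_holomorphic:
  assumes g: "two_sided_holomorphic2 g"
  shows "two_sided_holomorphic (\<lambda>Z. fourier_coeff n (g Z))"
proof -
  define r :: real where "r = 1/2"
  have r: "0 < r" "r < 1" by (auto simp: r_def)
  have E: "Fin 0 \<in> Te_ext" "Infty \<in> Te_ext" by (auto simp: Te_ext_def Te_def)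
  have neg: "g (Fin 0) Z = - g Infty Z" if "Z \<in> Te_ext" for Z
    using g that by (auto simp: two_sided_holomorphic2_def eq_neg_iff_add_eq_0)
  have "jump_average N r n (g (Fin 0)) + jump_average N r n (g Infty) = 0" for N
  proof -
    have "Fin (of_real r * nth_root_of_unity N a) \<in> Te_ext"
      "Fin (nth_root_of_unity N a / of_real r) \<in> Te_ext" for a
      using scaled_root_in_Te[OF r] by (auto simp: Te_ext_def)
    then show ?thesis
      unfolding jump_average_def add_divide_distrib[symmetric] sum.distrib[symmetric]
      by (simp add: neg flip: distrib_left add_divide_distrib)
  qed
  moreover have "(\<lambda>N. jump_average N r n (g (Fin 0)) + jump_average N r n (g Infty))
      \<longlonglongrightarrow> of_real r ^ nat \<bar>n\<bar> * fourier_coeff n (g (Fin 0)) + of_real r ^ nat \<bar>n\<bar> * fourier_coeff n (g Infty)"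
    by (intro tendsto_add jump_average_tendsto two_sided_holomorphic2_slice[OF g] E r)
  ultimately have "of_real r ^ nat \<bar>n\<bar> * (fourier_coeff n (g (Fin 0)) + fourier_coeff n (g Infty)) = 0"
    by (simp add: LIMSEQ_const_iff distrib_left)
  then have "fourier_coeff n (g (Fin 0)) + fourier_coeff n (g Infty) = 0" using r by simp
  then show ?thesis
    unfolding two_sided_holomorphic_def using fourier_coeff_holomorphic[OF g] by blast
qed

definition fourier_coeff2 :: "int \<Rightarrow> int \<Rightarrow> (ecomplex \<Rightarrow> ecomplex \<Rightarrow> complex) \<Rightarrow> complex" where
  "fourier_coeff2 m n g = fourier_coeff m (\<lambda>Z. fourier_coeff n (g Z))"

text \<open>The averages are sums of finitely many values, so the two limits can be taken one after the
  other and each involves a function of one variable only.\<close>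

lemma fourier_coeff2_sum_nonneg:
  assumes I: "finite I" and g: "\<And>i. i \<in> I \<Longrightarrow> two_sided_holomorphic2 (g i)"
    and pos: "\<And>r N1 N2. 0 < r \<Longrightarrow> r < 1 \<Longrightarrow>
      (\<Sum>i\<in>I. c i * jump_average N1 r (m i) (\<lambda>Z. jump_average N2 r (n i) (g i Z))) \<in> \<real>\<^sub>\<ge>\<^sub>0"
  shows "(\<Sum>i\<in>I. c i * fourier_coeff2 (m i) (n i) (g i)) \<in> \<real>\<^sub>\<ge>\<^sub>0"
proof -
  have closed: "L \<in> \<real>\<^sub>\<ge>\<^sub>0" if "X \<longlonglongrightarrow> L" "\<And>j. X j \<in> \<real>\<^sub>\<ge>\<^sub>0" for X and L :: complex
    using closed_sequentially[OF closed_nonneg_Reals_complex] that by blast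
  define \<Phi> where "\<Phi> = (\<lambda>r::real. \<Sum>i\<in>I. c i * (of_real r ^ nat \<bar>m i\<bar> *
     (of_real r ^ nat \<bar>n i\<bar> * fourier_coeff2 (m i) (n i) (g i))))"
  have \<Phi>: "\<Phi> r \<in> \<real>\<^sub>\<ge>\<^sub>0" if r: "0 < r" "r < 1" for r
  proof (rule closed)
    define b where "b = (\<lambda>i Z. of_real r ^ nat \<bar>n i\<bar> * fourier_coeff (n i) (g i Z))"
    show "(\<lambda>N1. \<Sum>i\<in>I. c i * jump_average N1 r (m i) (b i)) \<longlonglongrightarrow> \<Phi> r"
      unfolding \<Phi>_def
    proof (intro tendsto_sum tendsto_mult tendsto_const)
      fix i assume i: "i \<in> I"
      have "jump_average N1 r (m i) (b i)
          = of_real r ^ nat \<bar>n i\<bar> * jump_average N1 r (m i) (\<lambda>Z. fourier_coeff (n i) (g i Z))" for N1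
        unfolding jump_average_def b_def by (simp add: sum_distrib_left right_diff_distrib diff_divide_distrib mult_ac)
      moreover have "(\<lambda>N1. of_real r ^ nat \<bar>n i\<bar> * jump_average N1 r (m i) (\<lambda>Z. fourier_coeff (n i) (g i Z)))
          \<longlonglongrightarrow> of_real r ^ nat \<bar>n i\<bar> * (of_real r ^ nat \<bar>m i\<bar> * fourier_coeff2 (m i) (n i) (g i))"
        unfolding fourier_coeff2_def
        by (intro tendsto_mult tendsto_const jump_average_tendsto fourier_coeff_two_sided_holomorphic g i r)
      ultimately show "(\<lambda>N1. jump_average N1 r (m i) (b i))
          \<longlonglongrightarrow> of_real r ^ nat \<bar>m i\<bar> * (of_real r ^ nat \<bar>n i\<bar> * fourier_coeff2 (m i) (n i) (g i))"
        by (simp add: mult.left_commute)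
    qed
    fix N1
    show "(\<Sum>i\<in>I. c i * jump_average N1 r (m i) (b i)) \<in> \<real>\<^sub>\<ge>\<^sub>0"
    proof (rule closed)
      show "(\<lambda>N2. \<Sum>i\<in>I. c i * jump_average N1 r (m i) (\<lambda>Z. jump_average N2 r (n i) (g i Z)))
          \<longlonglongrightarrow> (\<Sum>i\<in>I. c i * jump_average N1 r (m i) (b i))"
        unfolding jump_average_def[of N1] b_def divide_inverse
        by (intro tendsto_sum tendsto_mult tendsto_const tendsto_diff jump_average_tendsto
            two_sided_holomorphic2_slice g r)
          (use scaled_root_in_Te[OF r] in \<open>auto simp: Te_ext_def divide_inverse\<close>)
    qed (rule pos[OF r])
  qed
  have "(\<lambda>j. \<Phi> (1 - 1 / real (Suc (Suc j)))) \<longlonglongrightarrow> (\<Sum>i\<in>I. c i * (of_real (1 - 0) ^ nat \<bar>m i\<bar> *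
     (of_real (1 - 0) ^ nat \<bar>n i\<bar> * fourier_coeff2 (m i) (n i) (g i))))"
    unfolding \<Phi>_def
    by (intro tendsto_intros LIMSEQ_Suc[OF LIMSEQ_Suc[OF lim_inverse_n']])
  then have "(\<lambda>j. \<Phi> (1 - 1 / real (Suc (Suc j)))) \<longlonglongrightarrow> (\<Sum>i\<in>I. c i * fourier_coeff2 (m i) (n i) (g i))"
    by simp
  then show ?thesis
    by (rule closed) (intro \<Phi>, auto simp: divide_simps)
qed

lemma jump_average_iterated:
  "jump_average N1 r m (\<lambda>Z. jump_average N2 r n (g Z)) =
    (\<Sum>a<N1. \<Sum>b<N2. nth_root_of_unity N1 a powi (- m) * nth_root_of_unity N2 b powi (- n) *
      (let A = Fin (of_real r * nth_root_of_unity N1 a); A' = Fin (nth_root_of_unity N1 a / of_real r);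
           B = Fin (of_real r * nth_root_of_unity N2 b); B' = Fin (nth_root_of_unity N2 b / of_real r)
       in g A B - g A' B - g A B' + g A' B')) / (4 * of_nat N1 * of_nat N2)"
  unfolding jump_average_def Let_def
  by (simp add: sum_divide_distrib sum_distrib_left sum_subtractf[symmetric])
     (intro sum.cong refl, simp add: field_simps)

section \<open>Positive definiteness\<close>

text \<open>The polarization of the functions \<open>(R z1 z2 w, w)\<close>, extended to infinity.\<close>

definition polarized_extension ::
  "(complex \<Rightarrow> complex \<Rightarrow> 'a::complex_inner \<Rightarrow> 'a) \<Rightarrow> 'a \<Rightarrow> 'a \<Rightarrow> ecomplex \<Rightarrow> ecomplex \<Rightarrow> complex" where
  "polarized_extension R u v Z1 Z2 =
    (let q = (\<lambda>w. extend_to_infinity (\<lambda>z1 z2. cinner (R z1 z2 w) w) Z1 Z2)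
     in (q (u + v) - q (u - v) + \<i> * q (u + \<i> *\<^sub>C v) - \<i> * q (u - \<i> *\<^sub>C v)) / 4)"

lemma polarized_extension_Fin:
  assumes "clinear_map (R z1 z2)"
  shows "polarized_extension R u v (Fin z1) (Fin z2) = cinner (R z1 z2 u) v"
  using cinner_polarization[OF assms, of u v] by (simp add: polarized_extension_def Let_def mult.commute)

lemma polarized_extension_two_sided_holomorphic2:
  assumes R: "\<And>w. class_H2 (extend_to_infinity (\<lambda>z1 z2. cinner (R z1 z2 w) w))"
  shows "two_sided_holomorphic2 (polarized_extension R u v)"
proof -
  define q where "q = (\<lambda>w Z1 Z2. extend_to_infinity (\<lambda>z1 z2. cinner (R z1 z2 w) w) Z1 Z2)"
  have q: "two_sided_holomorphic2 (q w)" for w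
    unfolding q_def by (rule class_H2_imp_two_sided_holomorphic2[OF R])
  have zero: "two_sided_holomorphic2 (\<lambda>Z1 Z2. 0)"
    by (simp add: two_sided_holomorphic2_def)
  have "two_sided_holomorphic2 (\<lambda>Z1 Z2. (((0 + 1/4 * q (u + v) Z1 Z2) + (-1/4) * q (u - v) Z1 Z2)
     + \<i>/4 * q (u + \<i> *\<^sub>C v) Z1 Z2) + (-\<i>/4) * q (u - \<i> *\<^sub>C v) Z1 Z2)"
    by (intro two_sided_holomorphic2_linear q zero)
  moreover have "(\<lambda>Z1 Z2. (((0 + 1/4 * q (u + v) Z1 Z2) + (-1/4) * q (u - v) Z1 Z2)
     + \<i>/4 * q (u + \<i> *\<^sub>C v) Z1 Z2) + (-\<i>/4) * q (u - \<i> *\<^sub>C v) Z1 Z2) = polarized_extension R u v"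
    by (intro ext) (simp add: polarized_extension_def Let_def q_def field_simps)
  ultimately show ?thesis by simp
qed

definition positive_definite :: "('x \<Rightarrow> 'x \<Rightarrow> complex) \<Rightarrow> bool" where
  "positive_definite k \<longleftrightarrow> (\<forall>F c. finite F \<longrightarrow> (\<Sum>x\<in>F. \<Sum>y\<in>F. c x * cnj (c y) * k x y) \<in> \<real>\<^sub>\<ge>\<^sub>0)"

text \<open>The scalar products which the vectors \<open>U1\<^sup>m U2\<^sup>n h\<close> and \<open>U1\<^sup>p U2\<^sup>q g\<close> of the larger space must have.\<close>

fun moment_kernel :: "(complex \<Rightarrow> complex \<Rightarrow> 'a::complex_inner \<Rightarrow> 'a) \<Rightarrow> 'a \<times> int \<times> int \<Rightarrow> 'a \<times> int \<times> int \<Rightarrow> complex" where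
  "moment_kernel R (h, m, n) (g, p, q) = fourier_coeff2 (m - p) (n - q) (polarized_extension R h g)"

text \<open>By the positivity condition of the class, the double jump
  \<open>T a b\<close> of \<open>R\<close> at a pair of points of the circles of radius \<open>r\<close> is a positive operator. The averages are the
  Fourier coefficients of a discrete operator measure with masses proportional to \<open>T a b\<close>, so the quadratic
  form of the kernel, with the averages in place of the coefficients, is a sum of terms \<open>(T a b G, G)\<close>. Both
  limits preserve the sign.\<close>

lemma moment_kernel_positive_definite:
  fixes R :: "complex \<Rightarrow> complex \<Rightarrow> 'a::complex_inner \<Rightarrow> 'a"
  assumes lin: "\<And>z1 z2. z1 \<in> Te \<Longrightarrow> z2 \<in> Te \<Longrightarrow> clinear_map (R z1 z2)"
    and R: "\<And>w. class_H2 (extend_to_infinity (\<lambda>z1 z2. cinner (R z1 z2 w) w))"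
  shows "positive_definite (moment_kernel R)"
  unfolding positive_definite_def
proof (intro allI impI)
  fix F :: "('a \<times> int \<times> int) set" and c :: "'a \<times> int \<times> int \<Rightarrow> complex"
  assume F: "finite F"
  define H :: "'a \<times> int \<times> int \<Rightarrow> 'a" where "H = fst"
  define m where "m = (\<lambda>x::'a \<times> int \<times> int. fst (snd x))"
  define n where "n = (\<lambda>x::'a \<times> int \<times> int. snd (snd x))"
  define g where "g = (\<lambda>p. polarized_extension R (H (fst p)) (H (snd p)))"
  have k: "moment_kernel R x y = fourier_coeff2 (m x - m y) (n x - n y) (g (x, y))" for x y
    by (cases x; cases y) (simp add: H_def m_def n_def g_def)
  have "(\<Sum>p\<in>F \<times> F. (c (fst p) * cnj (c (snd p))) *
      fourier_coeff2 (m (fst p) - m (snd p)) (n (fst p) - n (snd p)) (g p)) \<in> \<real>\<^sub>\<ge>\<^sub>0"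
  proof (rule fourier_coeff2_sum_nonneg)
    show "finite (F \<times> F)" using F by simp
    show "two_sided_holomorphic2 (g p)" for p
      unfolding g_def by (rule polarized_extension_two_sided_holomorphic2[OF R])
    fix r :: real and N1 N2 assume r: "0 < r" "r < 1"
    define A where "A = nth_root_of_unity N1"
    define B where "B = nth_root_of_unity N2"
    have AB: "A a \<noteq> 0" "B b \<noteq> 0" for a b by (simp_all add: A_def B_def)
    have Te: "of_real r * A a \<in> Te" "A a / of_real r \<in> Te" "of_real r * B b \<in> Te" "B b / of_real r \<in> Te" for a b
      using scaled_root_in_Te[OF r] by (simp_all add: A_def B_def)
    define T where "T = (\<lambda>a b w. R (of_real r * A a) (of_real r * B b) w - R (A a / of_real r) (of_real r * B b) w
        - R (of_real r * A a) (B b / of_real r) w + R (A a / of_real r) (B b / of_real r) w)"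
    have Tlin: "clinear_map (T a b)" for a b
      using lin[OF Te(1) Te(3)] lin[OF Te(2) Te(3)] lin[OF Te(1) Te(4)] lin[OF Te(2) Te(4)]
      by (auto simp: clinear_map_def T_def scaleC_add_right scaleC_diff_right)
    have Tpos: "cinner (T a b w) w \<in> \<real>\<^sub>\<ge>\<^sub>0" for a b w
    proof -
      have refl: "reflect (Fin (of_real r * nth_root_of_unity N a)) = Fin (nth_root_of_unity N a / of_real r)" for N a
        using r by (simp add: cnj_nth_root_of_unity field_simps)
      have "cmod (of_real r * A a) < 1 \<and> cmod (of_real r * B b) < 1"
        using r by (simp add: norm_mult A_def B_def)
      then have "let f = extend_to_infinity (\<lambda>z1 z2. cinner (R z1 z2 w) w);
            Z1 = Fin (of_real r * A a); Z2 = Fin (of_real r * B b)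
          in f Z1 Z2 - f (reflect Z1) Z2 - f Z1 (reflect Z2) + f (reflect Z1) (reflect Z2) \<in> \<real>\<^sub>\<ge>\<^sub>0"
        using R[of w] unfolding class_H2_def Let_def by blast
      then show ?thesis
        unfolding A_def B_def refl Let_def
        by (simp add: T_def cinner_add_left cinner_diff_left A_def B_def)
    qed
    define G where "G = (\<lambda>a b. \<Sum>x\<in>F. (c x * (A a powi (- m x) * B b powi (- n x))) *\<^sub>C H x)"
    have TG: "(\<Sum>p\<in>F \<times> F. (c (fst p) * cnj (c (snd p))) * (A a powi (- (m (fst p) - m (snd p)))
        * B b powi (- (n (fst p) - n (snd p))) * cinner (T a b (H (fst p))) (H (snd p))))
        = cinner (T a b (G a b)) (G a b)" for a b
    proof -
      have cnjp: "cnj (A a powi (- i)) = A a powi i" "cnj (B b powi (- i)) = B b powi i" for i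
        using AB by (simp_all add: A_def B_def cnj_nth_root_of_unity power_int_minus power_int_inverse)
      have split: "A a powi (- (i - j)) = A a powi (- i) * A a powi j" 
        "B b powi (- (i - j)) = B b powi (- i) * B b powi j" for i j
        using AB by (simp_all flip: power_int_add)
      have "cinner (T a b (G a b)) (G a b)
          = (\<Sum>x\<in>F. \<Sum>y\<in>F. (c x * (A a powi (- m x) * B b powi (- n x))) *
              cnj (c y * (A a powi (- m y) * B b powi (- n y))) * cinner (T a b (H x)) (H y))"
        by (simp add: G_def clinear_map_sum[OF Tlin] clinear_map_scaleC[OF Tlin] cinner_sum_left
            cinner_sum_right cinner_scaleC_left cinner_scaleC_right sum_distrib_left mult_ac)
           (rule sum.swap)
      also have "\<dots> = (\<Sum>x\<in>F. \<Sum>y\<in>F. (c x * cnj (c y)) * (A a powi (- (m x - m y)) * B b powi (- (n x - n y))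
           * cinner (T a b (H x)) (H y)))"
        by (simp only: complex_cnj_mult cnjp split mult_ac)
      finally show ?thesis by (simp add: sum.cartesian_product case_prod_unfold)
    qed
    have gT: "(let X = Fin (of_real r * A a); X' = Fin (A a / of_real r);
           Y = Fin (of_real r * B b); Y' = Fin (B b / of_real r)
       in g p X Y - g p X' Y - g p X Y' + g p X' Y') = cinner (T a b (H (fst p))) (H (snd p))" for p a b
      by (simp add: g_def T_def polarized_extension_Fin lin Te cinner_add_left cinner_diff_left)
    have "(\<Sum>p\<in>F \<times> F. (c (fst p) * cnj (c (snd p))) * jump_average N1 r (m (fst p) - m (snd p))
        (\<lambda>Z. jump_average N2 r (n (fst p) - n (snd p)) (g p Z)))
      = (\<Sum>p\<in>F \<times> F. \<Sum>a<N1. \<Sum>b<N2. (c (fst p) * cnj (c (snd p))) * (A a powi (- (m (fst p) - m (snd p)))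
        * B b powi (- (n (fst p) - n (snd p))) * cinner (T a b (H (fst p))) (H (snd p))) / (4 * of_nat N1 * of_nat N2))"
      unfolding jump_average_iterated A_def[symmetric] B_def[symmetric] gT
      by (simp only: sum_distrib_left sum_divide_distrib times_divide_eq_right)
    also have "\<dots> = (\<Sum>a<N1. \<Sum>b<N2. cinner (T a b (G a b)) (G a b) / (4 * of_nat N1 * of_nat N2))"
      unfolding TG[symmetric] sum_divide_distrib
      by (subst sum.swap, rule sum.cong[OF refl], subst sum.swap, rule refl)
    also have "\<dots> \<in> \<real>\<^sub>\<ge>\<^sub>0"
    proof -
      have s: "sum f S \<in> \<real>\<^sub>\<ge>\<^sub>0" if "\<And>i. f i \<in> \<real>\<^sub>\<ge>\<^sub>0" for f :: "nat \<Rightarrow> complex" and S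
        using that by (induction S rule: infinite_finite_induct) auto
      have "(4 * of_nat N1 * of_nat N2 :: complex) \<in> \<real>\<^sub>\<ge>\<^sub>0" by (intro nonneg_Reals_mult_I) auto
      then show ?thesis by (intro s nonneg_Reals_divide_I Tpos)
    qed
    finally show "(\<Sum>p\<in>F \<times> F. (c (fst p) * cnj (c (snd p))) * jump_average N1 r (m (fst p) - m (snd p))
        (\<lambda>Z. jump_average N2 r (n (fst p) - n (snd p)) (g p Z))) \<in> \<real>\<^sub>\<ge>\<^sub>0" .
  qed
  then show "(\<Sum>x\<in>F. \<Sum>y\<in>F. c x * cnj (c y) * moment_kernel R x y) \<in> \<real>\<^sub>\<ge>\<^sub>0"
    unfolding k by (simp add: sum.cartesian_product case_prod_unfold)
qed


section \<open>Vectors with a given Gram matrix\<close>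

lemma positive_definiteD:
  assumes "positive_definite k" "finite F"
  shows "(\<Sum>x\<in>F. \<Sum>y\<in>F. c x * cnj (c y) * k x y) \<in> \<real>\<^sub>\<ge>\<^sub>0"
  using assms(1)[unfolded positive_definite_def, rule_format, OF assms(2)] .

lemma positive_definite_diagonal:
  assumes "positive_definite k"
  shows "k x x = complex_of_real (Re (k x x))" "Re (k x x) \<ge> 0"
proof -
  have "k x x \<in> \<real>\<^sub>\<ge>\<^sub>0"
    using positive_definiteD[OF assms, of "{x}" "\<lambda>_. 1"] by simp
  then show "k x x = complex_of_real (Re (k x x))" "Re (k x x) \<ge> 0"
    by (auto simp: complex_nonneg_Reals_iff complex_eq_iff)
qed

lemma positive_definite_hermitian:
  assumes pd: "positive_definite k"
  shows "k y x = cnj (k x y)"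
proof (cases "x = y")
  case True
  have "Im (k x x) = 0"
    using arg_cong[OF positive_definite_diagonal(1)[OF pd, of x], of Im] by simp
  then show ?thesis using True by (simp add: complex_eq_iff)
next
  case False
  have form: "a * cnj a * k x x + a * cnj b * k x y + (b * cnj a * k y x + b * cnj b * k y y) \<in> \<real>\<^sub>\<ge>\<^sub>0" for a b
  proof -
    define c where "c = (\<lambda>z. if z = x then a else b)"
    have "(\<Sum>u\<in>{x, y}. \<Sum>v\<in>{x, y}. c u * cnj (c v) * k u v) \<in> \<real>\<^sub>\<ge>\<^sub>0"
      by (rule positive_definiteD[OF pd]) simp
    then show ?thesis using False by (simp add: c_def)
  qed
  have d: "Im (k x x) = 0" "Im (k y y) = 0"
    using arg_cong[OF positive_definite_diagonal(1)[OF pd, of x], of Im]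
      arg_cong[OF positive_definite_diagonal(1)[OF pd, of y], of Im] by simp_all
  show ?thesis
    using form[of 1 1] form[of 1 \<i>] d by (simp add: complex_nonneg_Reals_iff complex_eq_iff)
qed

text \<open>The new vector is \<open>w + \<alpha> e\<close>, where \<open>w\<close> lies in the closed span of the old vectors and has the
  prescribed inner products with them, and \<open>\<alpha>\<close> corrects the norm. Positive definiteness says that the prescribed
  functional is bounded by \<open>sqrt (k x0 x0)\<close>, so \<open>w\<close> exists and is not too long.\<close>

lemma gram_extension_step:
  fixes \<phi> :: "'x \<Rightarrow> 'a::chilbert_space"
  assumes pd: "positive_definite k" and gram: "\<And>x y. x \<in> A \<Longrightarrow> y \<in> A \<Longrightarrow> cinner (\<phi> x) (\<phi> y) = k x y"
    and x0: "x0 \<notin> A" and e: "cinner e e = 1" "\<And>y. y \<in> A \<Longrightarrow> cinner (\<phi> y) e = 0"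
  obtains v where "\<And>y. y \<in> A \<Longrightarrow> cinner (\<phi> y) v = k y x0" "cinner v v = k x0 x0"
    "\<And>d. (\<And>y. y \<in> A \<Longrightarrow> cinner (\<phi> y) d = 0) \<Longrightarrow> cinner e d = 0 \<Longrightarrow> cinner v d = 0"
proof -
  define \<kappa> where "\<kappa> = Re (k x0 x0)"
  have \<kappa>: "k x0 x0 = complex_of_real \<kappa>" "\<kappa> \<ge> 0"
    using positive_definite_diagonal[OF pd, of x0] by (simp_all add: \<kappa>_def)
  have bound: "cmod (\<Sum>y\<in>F. c y * k y x0) \<le> sqrt \<kappa> * norm (\<Sum>y\<in>F. c y *\<^sub>C \<phi> y)"
    if F: "finite F" "F \<subseteq> A" for F c
  proof -
    define u where "u = (\<Sum>y\<in>F. c y *\<^sub>C \<phi> y)"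
    define l where "l = (\<Sum>y\<in>F. c y * k y x0)"
    have nF: "x0 \<notin> F" using F x0 by blast
    have uu: "(\<Sum>x\<in>F. \<Sum>y\<in>F. c x * cnj (c y) * k x y) = complex_of_real ((norm u)\<^sup>2)"
    proof -
      have "cinner u u = (\<Sum>y\<in>F. \<Sum>x\<in>F. c x * cnj (c y) * cinner (\<phi> x) (\<phi> y))"
        by (simp add: u_def cinner_sum_left cinner_sum_right cinner_scaleC_left cinner_scaleC_right
            sum_distrib_left mult_ac)
      also have "\<dots> = (\<Sum>y\<in>F. \<Sum>x\<in>F. c x * cnj (c y) * k x y)"
        using F by (intro sum.cong refl) (simp add: gram subset_iff)
      also have "\<dots> = (\<Sum>x\<in>F. \<Sum>y\<in>F. c x * cnj (c y) * k x y)" by (rule sum.swap)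
      finally show ?thesis by (simp add: cinner_norm)
    qed
    \<comment> \<open>Positive definiteness for the coefficients \<open>c\<close> on \<open>F\<close> and \<open>- s l\<close> at \<open>x0\<close>.\<close>
    have quad: "0 \<le> (norm u)\<^sup>2 - 2 * s * (cmod l)\<^sup>2 + s\<^sup>2 * (cmod l)\<^sup>2 * \<kappa>" for s :: real
    proof -
      define t where "t = - complex_of_real s * l"
      define c' where "c' = (\<lambda>y. if y = x0 then t else c y)"
      have c': "c' x0 = t" "\<And>y. y \<in> F \<Longrightarrow> c' y = c y" using nF by (auto simp: c'_def)
      have "(\<Sum>x\<in>insert x0 F. \<Sum>y\<in>insert x0 F. c' x * cnj (c' y) * k x y) \<in> \<real>\<^sub>\<ge>\<^sub>0"
        by (rule positive_definiteD[OF pd]) (simp add: F)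
      also have "(\<Sum>x\<in>insert x0 F. \<Sum>y\<in>insert x0 F. c' x * cnj (c' y) * k x y)
          = t * cnj t * k x0 x0 + (\<Sum>y\<in>F. t * cnj (c' y) * k x0 y)
            + (\<Sum>x\<in>F. c' x * cnj t * k x x0 + (\<Sum>y\<in>F. c' x * cnj (c' y) * k x y))"
        using F nF by (simp add: c'(1))
      also have "\<dots> = t * cnj t * k x0 x0 + (\<Sum>y\<in>F. t * cnj (c y) * k x0 y)
            + (\<Sum>x\<in>F. c x * cnj t * k x x0 + (\<Sum>y\<in>F. c x * cnj (c y) * k x y))"
        by (intro arg_cong2[of _ _ _ _ "(+)"] sum.cong refl) (simp_all add: c')
      also have "(\<Sum>y\<in>F. t * cnj (c y) * k x0 y) = t * cnj l"
        by (simp add: l_def sum_distrib_left mult_ac flip: positive_definite_hermitian[OF pd])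
      also have "(\<Sum>x\<in>F. c x * cnj t * k x x0 + (\<Sum>y\<in>F. c x * cnj (c y) * k x y))
          = cnj t * l + complex_of_real ((norm u)\<^sup>2)"
        unfolding sum.distrib uu by (simp add: l_def sum_distrib_left mult_ac)
      finally have "t * cnj t * k x0 x0 + t * cnj l + (cnj t * l + complex_of_real ((norm u)\<^sup>2)) \<in> \<real>\<^sub>\<ge>\<^sub>0" .
      moreover have "t * cnj t = complex_of_real (s\<^sup>2 * (cmod l)\<^sup>2)"
        "t * cnj l = - complex_of_real (s * (cmod l)\<^sup>2)" "cnj t * l = - complex_of_real (s * (cmod l)\<^sup>2)"
        unfolding t_def of_real_mult complex_norm_square by (simp_all add: power2_eq_square mult_ac)
      ultimately have "complex_of_real (s\<^sup>2 * (cmod l)\<^sup>2 * \<kappa> - s * (cmod l)\<^sup>2 + (- (s * (cmod l)\<^sup>2) + (norm u)\<^sup>2)) \<in> \<real>\<^sub>\<ge>\<^sub>0"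
        by (simp add: \<kappa>)
      then show ?thesis unfolding nonneg_Reals_of_real_iff by (simp add: algebra_simps)
    qed
    have "(cmod l)\<^sup>2 \<le> \<kappa> * (norm u)\<^sup>2"
    proof (cases "\<kappa> = 0")
      case True
      have "l = 0"
      proof (rule ccontr)
        assume "l \<noteq> 0"
        then show False
          \<comment> \<open>A large \<open>s\<close>, for which the form, linear in \<open>s\<close>, is \<open>-1\<close>.\<close>
          using quad[of "((norm u)\<^sup>2 + 1) / (2 * (cmod l)\<^sup>2)"] True by (simp add: field_simps)
      qed
      then show ?thesis using \<kappa> by simp
    next
      case False
      then have "\<kappa> > 0" using \<kappa> by simp
      then show ?thesis using quad[of "1 / \<kappa>"] by (simp add: field_simps power2_eq_square)
    qed
    also have "\<dots> = (sqrt \<kappa> * norm u)\<^sup>2" using \<kappa> by (simp add: power_mult_distrib)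
    finally have "cmod l \<le> sqrt \<kappa> * norm u" by (rule power2_le_imp_le) (use \<kappa> in simp)
    then show ?thesis by (simp add: l_def u_def)
  qed
  obtain w where w: "\<And>y. y \<in> A \<Longrightarrow> cinner (\<phi> y) w = k y x0" "norm w \<le> sqrt \<kappa>"
    "\<And>v. (\<And>y. y \<in> A \<Longrightarrow> cinner (\<phi> y) v = 0) \<Longrightarrow> cinner w v = 0"
    by (rule riesz_family[OF bound]) (use \<kappa> in auto)
  have we: "cinner w e = 0" by (rule w(3)) (rule e(2))
  then have ew: "cinner e w = 0" by (subst cinner_commute) simp
  define \<alpha> where "\<alpha> = sqrt (\<kappa> - (norm w)\<^sup>2)"
  have "(norm w)\<^sup>2 \<le> \<kappa>" using power_mono[OF w(2), of 2] \<kappa> by simp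
  then have \<alpha>: "\<alpha> * \<alpha> = \<kappa> - (norm w)\<^sup>2" by (simp add: \<alpha>_def)
  show ?thesis
  proof (rule that[of "w + complex_of_real \<alpha> *\<^sub>C e"])
    show "cinner (\<phi> y) (w + complex_of_real \<alpha> *\<^sub>C e) = k y x0" if "y \<in> A" for y
      using that by (simp add: cinner_add_right cinner_scaleC_right w(1) e(2))
    have "cinner (w + complex_of_real \<alpha> *\<^sub>C e) (w + complex_of_real \<alpha> *\<^sub>C e)
        = complex_of_real ((norm w)\<^sup>2) + complex_of_real (\<alpha> * \<alpha>)"
      by (simp add: cinner_add_right cinner_add_left cinner_scaleC_right cinner_scaleC_left we ew e(1)
          cinner_norm[of w])
    then show "cinner (w + complex_of_real \<alpha> *\<^sub>C e) (w + complex_of_real \<alpha> *\<^sub>C e) = k x0 x0"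
      by (simp add: \<kappa>(1) \<alpha> flip: of_real_add)
    show "cinner (w + complex_of_real \<alpha> *\<^sub>C e) d = 0"
      if "\<And>y. y \<in> A \<Longrightarrow> cinner (\<phi> y) d = 0" "cinner e d = 0" for d
      using w(3)[OF that(1)] that(2) by (simp add: cinner_add_left cinner_scaleC_left)
  qed
qed

text \<open>Zorn's lemma for partial assignments whose vectors are orthogonal to all \<open>d z\<close> with \<open>z\<close> not yet
  treated; \<open>d x0\<close> then serves as the new direction for \<open>x0\<close>. So no completion has to be formed, and a
  Hilbert space of the dimension of the index set is enough.\<close>

lemma gram_realization:
  fixes d :: "'x \<Rightarrow> 'a::chilbert_space"
  assumes pd: "positive_definite k" and d: "\<And>x y. cinner (d x) (d y) = (if x = y then 1 else 0)"
  obtains \<Phi> :: "'x \<Rightarrow> 'a" where "\<And>x y. cinner (\<Phi> x) (\<Phi> y) = k x y"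
proof -
  define P where "P = (\<lambda>G :: ('x \<times> 'a) set.
     (\<forall>x v y w. (x, v) \<in> G \<longrightarrow> (y, w) \<in> G \<longrightarrow> cinner v w = k x y) \<and>
     (\<forall>x v z. (x, v) \<in> G \<longrightarrow> z \<notin> Domain G \<longrightarrow> cinner v (d z) = 0))"
  have "\<exists>M\<in>Collect P. \<forall>X\<in>Collect P. M \<subseteq> X \<longrightarrow> X = M"
  proof (rule subset_Zorn')
    fix C assume "subset.chain (Collect P) C"
    then have C: "\<And>G. G \<in> C \<Longrightarrow> P G" "\<And>G G'. G \<in> C \<Longrightarrow> G' \<in> C \<Longrightarrow> G \<subseteq> G' \<or> G' \<subseteq> G"
      by (auto simp: subset_chain_def)
    have "P (\<Union>C)"
      unfolding P_def
    proof (intro conjI allI impI)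
      fix x v y w assume "(x, v) \<in> \<Union>C" "(y, w) \<in> \<Union>C"
      then obtain G G' where G: "G \<in> C" "G' \<in> C" "(x, v) \<in> G" "(y, w) \<in> G'" by blast
      then obtain G'' where "G'' \<in> C" "(x, v) \<in> G''" "(y, w) \<in> G''" using C(2)[of G G'] by blast
      then show "cinner v w = k x y" using C(1) unfolding P_def by blast
    next
      fix x v z assume "(x, v) \<in> \<Union>C" "z \<notin> Domain (\<Union>C)"
      then obtain G where "G \<in> C" "(x, v) \<in> G" "z \<notin> Domain G" by blast
      then show "cinner v (d z) = 0" using C(1) unfolding P_def by blast
    qed
    then show "\<Union>C \<in> Collect P" by simp
  qed
  then obtain M where M: "P M" and max: "\<And>X. P X \<Longrightarrow> M \<subseteq> X \<Longrightarrow> X = M" by blast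
  define \<phi> where "\<phi> = (\<lambda>x. SOME v. (x, v) \<in> M)"
  have \<phi>: "(x, \<phi> x) \<in> M" if "x \<in> Domain M" for x
    using that unfolding \<phi>_def by (meson DomainE someI)
  have gram: "cinner v w = k x y" if "(x, v) \<in> M" "(y, w) \<in> M" for x v y w
    using M that unfolding P_def by blast
  have orth: "cinner v (d z) = 0" if "(x, v) \<in> M" "z \<notin> Domain M" for x v z
    using M that unfolding P_def by blast
  have uniq: "v = \<phi> x" if "(x, v) \<in> M" for x v
  proof -
    have "(x, \<phi> x) \<in> M" using that by (intro \<phi>) blast
    then have "cinner (v - \<phi> x) (v - \<phi> x) = 0"
      using that by (simp add: cinner_diff_left cinner_diff_right gram)
    then show ?thesis by simp
  qed
  have "Domain M = UNIV"
  proof (rule ccontr)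
    assume "Domain M \<noteq> UNIV"
    then obtain x0 where x0: "x0 \<notin> Domain M" by blast
    obtain v where v: "\<And>y. y \<in> Domain M \<Longrightarrow> cinner (\<phi> y) v = k y x0" "cinner v v = k x0 x0"
      "\<And>e. (\<And>y. y \<in> Domain M \<Longrightarrow> cinner (\<phi> y) e = 0) \<Longrightarrow> cinner (d x0) e = 0 \<Longrightarrow> cinner v e = 0"
    proof (rule gram_extension_step[OF pd _ x0, of \<phi> "d x0"])
      show "cinner (\<phi> x) (\<phi> y) = k x y" if "x \<in> Domain M" "y \<in> Domain M" for x y
        by (rule gram[OF \<phi>[OF that(1)] \<phi>[OF that(2)]])
      show "cinner (d x0) (d x0) = 1" by (simp add: d)
      show "cinner (\<phi> y) (d x0) = 0" if "y \<in> Domain M" for y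
        by (rule orth[OF \<phi>[OF that] x0])
    qed blast
    have v1: "cinner w v = k y x0" if "(y, w) \<in> M" for y w
      using v(1)[of y] uniq[OF that] that by blast
    have v2: "cinner v w = k x0 y" if "(y, w) \<in> M" for y w
      using v1[OF that] by (subst cinner_commute) (simp flip: positive_definite_hermitian[OF pd])
    have "P (insert (x0, v) M)"
      unfolding P_def
    proof (intro conjI allI impI)
      fix x a y b assume "(x, a) \<in> insert (x0, v) M" "(y, b) \<in> insert (x0, v) M"
      then show "cinner a b = k x y" using v(2) v1 v2 gram by auto
    next
      fix x a z assume a: "(x, a) \<in> insert (x0, v) M" and z: "z \<notin> Domain (insert (x0, v) M)"
      have "cinner v (d z) = 0"
      proof (rule v(3))
        show "cinner (\<phi> y) (d z) = 0" if "y \<in> Domain M" for y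
          using orth[OF \<phi>[OF that]] z by auto
        show "cinner (d x0) (d z) = 0" using z by (auto simp: d)
      qed
      then show "cinner a (d z) = 0" using a z orth by auto
    qed
    from max[OF this] have "insert (x0, v) M = M" by blast
    then show False using x0 by blast
  qed
  then have "cinner (\<phi> x) (\<phi> y) = k x y" for x y
    by (intro gram \<phi>) simp_all
  then show ?thesis by (rule that)
qed

lift_definition ell2_unit_vector :: "'i \<Rightarrow> 'i ell2" is "\<lambda>x i. if i = x then 1 else 0"
  by (rule finite_nonzero_values_imp_summable_on) simp

lemma cinner_ell2_unit_vector:
  "cinner (ell2_unit_vector x) (ell2_unit_vector y) = (if x = y then 1 else 0)"
proof transfer
  fix x y :: 'a
  have "(\<Sum>\<^sub>\<infinity>i. (if i = x then 1 else 0) * cnj (if i = y then 1 else 0))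
      = (\<Sum>\<^sub>\<infinity>i\<in>{x}. (if i = x then 1 else 0) * cnj (if i = y then 1 else (0::complex)))"
    by (rule infsum_cong_neutral) auto
  then show "(\<Sum>\<^sub>\<infinity>i. (if i = x then 1 else 0) * cnj (if i = y then 1 else 0)) = (if x = y then 1 else (0::complex))"
    by simp
qed

section \<open>Unitary operators permuting a family of vectors\<close>

text \<open>The permutations of the index set that will act by unitary operators.\<close>

definition gram_preserving :: "('x \<Rightarrow> 'a::complex_inner) \<Rightarrow> ('x \<Rightarrow> 'x) \<Rightarrow> bool" where
  "gram_preserving \<Phi> s \<longleftrightarrow> bij s \<and> (\<forall>x y. cinner (\<Phi> (s x)) (\<Phi> (s y)) = cinner (\<Phi> x) (\<Phi> y))"

text \<open>Double orthogonal complement of the range, that is, its closed linear span.\<close>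

definition closed_span_range :: "('x \<Rightarrow> 'a::complex_inner) \<Rightarrow> 'a set" where
  "closed_span_range \<Phi> = {w. \<forall>v. (\<forall>x. cinner (\<Phi> x) v = 0) \<longrightarrow> cinner w v = 0}"

lemma closed_span_range_eqI:
  assumes w: "w \<in> closed_span_range \<Phi>" "w' \<in> closed_span_range \<Phi>"
    and eq: "\<And>x. cinner w (\<Phi> x) = cinner w' (\<Phi> x)"
  shows "w = w'"
proof -
  have "cinner (\<Phi> x) (w - w') = 0" for x
    using eq[of x] by (subst cinner_commute) (simp add: cinner_diff_left)
  then have "cinner w (w - w') = 0" "cinner w' (w - w') = 0"
    using w unfolding closed_span_range_def by blast+
  then have "cinner (w - w') (w - w') = 0" by (simp add: cinner_diff_left)
  then show ?thesis by simp
qed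

lemma closed_span_range_linear:
  assumes "w \<in> closed_span_range \<Phi>" "w' \<in> closed_span_range \<Phi>"
  shows "w + w' \<in> closed_span_range \<Phi>" "c *\<^sub>C w \<in> closed_span_range \<Phi>"
  using assms by (auto simp: closed_span_range_def cinner_add_left cinner_scaleC_left)

lemma range_in_closed_span_range: "\<Phi> x \<in> closed_span_range \<Phi>"
  by (simp add: closed_span_range_def)

text \<open>The partial isometry which maps \<open>\<Phi> x\<close> to \<open>\<Phi> (s x)\<close> and vanishes on the orthogonal complement
  of the range; for the identity it is the projection onto the closed span.\<close>

definition shift_isometry :: "('x \<Rightarrow> 'a::complex_inner) \<Rightarrow> ('x \<Rightarrow> 'x) \<Rightarrow> 'a \<Rightarrow> 'a" where
  "shift_isometry \<Phi> s u = (SOME w. w \<in> closed_span_range \<Phi> \<and> norm w \<le> norm u \<and>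
     (\<forall>x. cinner w (\<Phi> (s x)) = cinner u (\<Phi> x)))"

lemma shift_isometry:
  fixes \<Phi> :: "'x \<Rightarrow> 'a::chilbert_space"
  assumes s: "gram_preserving \<Phi> s"
  shows "shift_isometry \<Phi> s u \<in> closed_span_range \<Phi>" "norm (shift_isometry \<Phi> s u) \<le> norm u"
    "cinner (shift_isometry \<Phi> s u) (\<Phi> (s x)) = cinner u (\<Phi> x)"
proof -
  have bound: "cmod (\<Sum>y\<in>F. c y * cinner (\<Phi> y) u) \<le> norm u * norm (\<Sum>y\<in>F. c y *\<^sub>C \<Phi> (s y))" for F c
  proof -
    have "cinner (\<Sum>y\<in>F. c y *\<^sub>C \<Phi> (s y)) (\<Sum>y\<in>F. c y *\<^sub>C \<Phi> (s y))
        = cinner (\<Sum>y\<in>F. c y *\<^sub>C \<Phi> y) (\<Sum>y\<in>F. c y *\<^sub>C \<Phi> y)"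
      using s by (simp add: gram_preserving_def cinner_sum_left cinner_sum_right cinner_scaleC_left
          cinner_scaleC_right)
    then have "(norm (\<Sum>y\<in>F. c y *\<^sub>C \<Phi> (s y)))\<^sup>2 = (norm (\<Sum>y\<in>F. c y *\<^sub>C \<Phi> y))\<^sup>2"
      by (simp only: norm_eq_cinner)
    then have n: "norm (\<Sum>y\<in>F. c y *\<^sub>C \<Phi> (s y)) = norm (\<Sum>y\<in>F. c y *\<^sub>C \<Phi> y)"
      by (simp add: power2_eq_iff_nonneg)
    have "(\<Sum>y\<in>F. c y * cinner (\<Phi> y) u) = cinner (\<Sum>y\<in>F. c y *\<^sub>C \<Phi> y) u"
      by (simp add: cinner_sum_left cinner_scaleC_left)
    then show ?thesis using cauchy_schwarz[of "\<Sum>y\<in>F. c y *\<^sub>C \<Phi> y" u] by (simp add: n mult.commute)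
  qed
  obtain w where w: "\<And>y. y \<in> UNIV \<Longrightarrow> cinner (\<Phi> (s y)) w = cinner (\<Phi> y) u" "norm w \<le> norm u"
    "\<And>v. (\<And>y. y \<in> UNIV \<Longrightarrow> cinner (\<Phi> (s y)) v = 0) \<Longrightarrow> cinner w v = 0"
    by (rule riesz_family[where \<psi> = "\<lambda>y. \<Phi> (s y)" and A = UNIV and C = "norm u", OF bound]) auto
  have "\<exists>w. w \<in> closed_span_range \<Phi> \<and> norm w \<le> norm u \<and> (\<forall>x. cinner w (\<Phi> (s x)) = cinner u (\<Phi> x))"
  proof (intro exI[of _ w] conjI allI)
    show "w \<in> closed_span_range \<Phi>" using w(3) by (simp add: closed_span_range_def)
    show "cinner w (\<Phi> (s x)) = cinner u (\<Phi> x)" for x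
      using w(1)[of x] by (subst (1 2) cinner_commute) simp
  qed (rule w(2))
  from someI_ex[OF this]
  show "shift_isometry \<Phi> s u \<in> closed_span_range \<Phi>" "norm (shift_isometry \<Phi> s u) \<le> norm u"
    "cinner (shift_isometry \<Phi> s u) (\<Phi> (s x)) = cinner u (\<Phi> x)"
    unfolding shift_isometry_def by blast+
qed

lemma shift_isometry_eqI:
  fixes \<Phi> :: "'x \<Rightarrow> 'a::chilbert_space"
  assumes s: "gram_preserving \<Phi> s" and w: "w \<in> closed_span_range \<Phi>"
    and eq: "\<And>x. cinner w (\<Phi> (s x)) = cinner u (\<Phi> x)"
  shows "shift_isometry \<Phi> s u = w"
proof (rule closed_span_range_eqI[OF shift_isometry(1)[OF s] w])
  fix x
  obtain y where "x = s y" using s by (metis bij_pointE gram_preserving_def)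
  then show "cinner (shift_isometry \<Phi> s u) (\<Phi> x) = cinner w (\<Phi> x)"
    by (simp add: eq shift_isometry(3)[OF s])
qed

lemma gram_preserving_id: "gram_preserving \<Phi> id"
  by (simp add: gram_preserving_def)

lemma gram_preserving_comp: "gram_preserving \<Phi> s \<Longrightarrow> gram_preserving \<Phi> t \<Longrightarrow> gram_preserving \<Phi> (s \<circ> t)"
  by (simp add: gram_preserving_def bij_comp)

lemma gram_preserving_inv: 
  assumes "gram_preserving \<Phi> s" shows "gram_preserving \<Phi> (inv s)"
proof -
  have s: "bij s" using assms by (simp add: gram_preserving_def)
  have "cinner (\<Phi> (inv s x)) (\<Phi> (inv s y)) = cinner (\<Phi> (s (inv s x))) (\<Phi> (s (inv s y)))" for x y
    using assms by (simp add: gram_preserving_def)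
  then show ?thesis using s by (simp add: gram_preserving_def bij_imp_bij_inv bij_is_surj surj_f_inv_f)
qed

lemma shift_isometry_comp:
  fixes \<Phi> :: "'x \<Rightarrow> 'a::chilbert_space"
  assumes s: "gram_preserving \<Phi> s" and t: "gram_preserving \<Phi> t"
  shows "shift_isometry \<Phi> s (shift_isometry \<Phi> t u) = shift_isometry \<Phi> (s \<circ> t) u"
  by (rule shift_isometry_eqI[OF gram_preserving_comp[OF s t], symmetric])
     (simp_all add: shift_isometry[OF s] shift_isometry(3)[OF t])

lemma shift_isometry_linear:
  fixes \<Phi> :: "'x \<Rightarrow> 'a::chilbert_space"
  assumes s: "gram_preserving \<Phi> s"
  shows "clinear_map (shift_isometry \<Phi> s)"
  unfolding clinear_map_def
  by (intro conjI allI; rule shift_isometry_eqI[OF s])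
     (simp_all add: closed_span_range_linear[OF shift_isometry(1)[OF s] shift_isometry(1)[OF s]]
       shift_isometry[OF s] cinner_add_left cinner_scaleC_left)

text \<open>Outside the closed span the operator acts as the identity, which keeps it unitary and
  makes \<open>s \<mapsto> shift_unitary \<Phi> s\<close> a group homomorphism. In particular commuting permutations give commuting operators.\<close>

definition shift_unitary :: "('x \<Rightarrow> 'a::complex_inner) \<Rightarrow> ('x \<Rightarrow> 'x) \<Rightarrow> 'a \<Rightarrow> 'a" where
  "shift_unitary \<Phi> s u = shift_isometry \<Phi> s u + (u - shift_isometry \<Phi> id u)"

lemma shift_unitary_family:
  fixes \<Phi> :: "'x \<Rightarrow> 'a::chilbert_space"
  assumes s: "gram_preserving \<Phi> s"
  shows "shift_unitary \<Phi> s (\<Phi> x) = \<Phi> (s x)"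
proof -
  have "shift_isometry \<Phi> s (\<Phi> x) = \<Phi> (s x)"
    by (rule shift_isometry_eqI[OF s range_in_closed_span_range]) (use s in \<open>simp add: gram_preserving_def\<close>)
  moreover have "shift_isometry \<Phi> id (\<Phi> x) = \<Phi> x"
    by (rule shift_isometry_eqI[OF gram_preserving_id range_in_closed_span_range]) simp
  ultimately show ?thesis by (simp add: shift_unitary_def)
qed

lemma shift_unitary_id: "shift_unitary \<Phi> id u = u"
  by (simp add: shift_unitary_def)

lemma shift_unitary_comp:
  fixes \<Phi> :: "'x \<Rightarrow> 'a::chilbert_space"
  assumes s: "gram_preserving \<Phi> s" and t: "gram_preserving \<Phi> t"
  shows "shift_unitary \<Phi> s (shift_unitary \<Phi> t u) = shift_unitary \<Phi> (s \<circ> t) u"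
  by (simp add: shift_unitary_def clinear_map_add[OF shift_isometry_linear[OF s]]
      clinear_map_diff[OF shift_isometry_linear[OF s]]
      clinear_map_add[OF shift_isometry_linear[OF gram_preserving_id]]
      clinear_map_diff[OF shift_isometry_linear[OF gram_preserving_id]]
      shift_isometry_comp s t gram_preserving_id)

text \<open>By the orthogonal decomposition the operator does not increase norms; the same holds for the operator of
  the inverse permutation, so both preserve norms.\<close>

lemma shift_unitary_unitary:
  fixes \<Phi> :: "'x \<Rightarrow> 'a::chilbert_space"
  assumes s: "gram_preserving \<Phi> s"
  shows "unitary (shift_unitary \<Phi> s)"
proof -
  let ?P = "shift_isometry \<Phi> id"
  note linP = shift_isometry_linear[OF gram_preserving_id, of \<Phi>]
  have contraction: "norm (shift_unitary \<Phi> t u) \<le> norm u" if t: "gram_preserving \<Phi> t" for t u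
  proof -
    have Q: "cinner (\<Phi> x) (u - ?P u) = 0" for x
      using shift_isometry(3)[OF gram_preserving_id, of \<Phi> u x]
      by (subst cinner_commute) (simp add: cinner_diff_left)
    have orth: "cinner w (u - ?P u) = 0" if "w \<in> closed_span_range \<Phi>" for w
      using that Q unfolding closed_span_range_def by blast
    have "norm (shift_isometry \<Phi> t u) \<le> norm (?P u)"
      using shift_isometry(2)[OF t, of "?P u"] by (simp add: shift_isometry_comp[OF t gram_preserving_id])
    then have "(norm (shift_isometry \<Phi> t u))\<^sup>2 \<le> (norm (?P u))\<^sup>2" by (simp add: power_mono)
    then have "(norm (shift_unitary \<Phi> t u))\<^sup>2 \<le> (norm (?P u + (u - ?P u)))\<^sup>2"
      unfolding shift_unitary_def norm_add_square
      by (simp add: orth shift_isometry(1)[OF t] shift_isometry(1)[OF gram_preserving_id])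
    then show ?thesis by (simp add: power2_le_iff_abs_le)
  qed
  have bij: "bij s" using s by (simp add: gram_preserving_def)
  have s': "s \<circ> inv s = id" "inv s \<circ> s = id"
    using bij_is_surj[OF bij] bij_is_inj[OF bij] by (simp_all add: surj_iff inj_iff)
  note i = gram_preserving_inv[OF s]
  have lin: "clinear_map (shift_unitary \<Phi> s)"
    using shift_isometry_linear[OF s] linP
    by (auto simp: clinear_map_def shift_unitary_def scaleC_add_right scaleC_diff_right)
  have n: "norm (shift_unitary \<Phi> s u) = norm u" for u
    using contraction[OF s, of u] contraction[OF i, of "shift_unitary \<Phi> s u"]
    by (simp add: shift_unitary_comp[OF i s] s' shift_unitary_id)
  have "surj (shift_unitary \<Phi> s)"
  proof (rule surjI)
    show "shift_unitary \<Phi> s (shift_unitary \<Phi> (inv s) u) = u" for u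
      by (simp add: shift_unitary_comp[OF s i] s' shift_unitary_id)
  qed
  then show ?thesis
    using lin norm_preserving_imp_cinner_preserving[OF lin n] by (simp add: unitary_def)
qed

section \<open>The dilation\<close>

text \<open>The defect \<open>J (x + y) - J x - J y\<close> has norm zero, because its norm is determined by scalar products.\<close>

lemma cinner_preserving_imp_linear:
  fixes J :: "'a::complex_inner \<Rightarrow> 'b::complex_inner"
  assumes J: "\<And>x y. cinner (J x) (J y) = cinner x y"
  shows "clinear_map J"
  unfolding clinear_map_def
proof (intro conjI allI)
  fix x y c
  have "cinner (J (x + y) - (J x + J y)) (J (x + y) - (J x + J y)) = 0"
    by (simp add: J cinner_diff_left cinner_diff_right cinner_add_left cinner_add_right)
  then show "J (x + y) = J x + J y" by simp
  have "cinner (J (c *\<^sub>C x) - c *\<^sub>C J x) (J (c *\<^sub>C x) - c *\<^sub>C J x) = 0"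
    by (simp add: J cinner_diff_left cinner_diff_right cinner_scaleC_left cinner_scaleC_right)
  then show "J (c *\<^sub>C x) = c *\<^sub>C J x" by simp
qed

lemma fourier_coeff_0:
  assumes "two_sided_holomorphic g"
  shows "fourier_coeff 0 g = g (Fin 0)"
proof -
  have "g Infty = - g (Fin 0)"
    using assms by (simp add: two_sided_holomorphic_def eq_neg_iff_add_eq_0 add.commute)
  then show ?thesis by (simp add: fourier_coeff_def taylor_coeff_def chart_infty_def)
qed

lemma fourier_coeff2_0_0:
  assumes "two_sided_holomorphic2 g"
  shows "fourier_coeff2 0 0 g = g (Fin 0) (Fin 0)"
proof -
  have "Fin 0 \<in> Te_ext" by (simp add: Te_ext_def Te_def)
  then show ?thesis
    using assms by (simp add: fourier_coeff2_def fourier_coeff_0 fourier_coeff_two_sided_holomorphic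
        two_sided_holomorphic2_slice)
qed

text \<open>The vector \<open>\<Phi> (h, m, n)\<close> plays the role of \<open>U1\<^sup>m U2\<^sup>n h\<close>. Its Gram matrix is invariant under the shifts of
  \<open>m\<close> and of \<open>n\<close>, which therefore act by commuting unitary operators. Expanding first the second Cayley
  transform and then the first one gives the Fourier coefficients of \<open>R\<close>, hence \<open>R\<close>.\<close>

lemma conditions_imp_dilation:
  fixes R :: "complex \<Rightarrow> complex \<Rightarrow> 'a::chilbert_space \<Rightarrow> 'a"
  assumes lin: "\<And>z1 z2. z1 \<in> Te \<Longrightarrow> z2 \<in> Te \<Longrightarrow> clinear_map (R z1 z2)"
    and R: "resolvent_conditions R"
  obtains J :: "'a \<Rightarrow> ('a \<times> int \<times> int) ell2" and U1 U2 where
    "clinear_map J" "\<And>x y. cinner (J x) (J y) = cinner x y"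
    "unitary U1" "unitary U2" "U1 \<circ> U2 = U2 \<circ> U1"
    "\<And>z1 z2 h. z1 \<in> Te \<Longrightarrow> z2 \<in> Te \<Longrightarrow>
       J (R z1 z2 h) = orth_projection (range J) (cayley_factor z1 U1 (cayley_factor z2 U2 (J h)))"
proof -
  have H2: "class_H2 (extend_to_infinity (\<lambda>z1 z2. cinner (R z1 z2 w) w))" for w
    using R[unfolded resolvent_conditions_def Let_def, THEN conjunct2, THEN conjunct2, THEN spec, of w] ..
  have R0: "R 0 0 = id" using R unfolding resolvent_conditions_def ..
  define g where "g = polarized_extension R"
  have g: "two_sided_holomorphic2 (g u v)" for u v
    unfolding g_def by (rule polarized_extension_two_sided_holomorphic2[where R = R, OF H2])
  have gFin: "g u v (Fin z1) (Fin z2) = cinner (R z1 z2 u) v" if "z1 \<in> Te" "z2 \<in> Te" for u v z1 z2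
    unfolding g_def by (rule polarized_extension_Fin[where R = R, OF lin[OF that]])
  have pd: "positive_definite (moment_kernel R)"
    by (rule moment_kernel_positive_definite[where R = R, OF _ H2]) (rule lin)
  obtain \<Phi> :: "'a \<times> int \<times> int \<Rightarrow> ('a \<times> int \<times> int) ell2"
    where \<Phi>: "\<And>x y. cinner (\<Phi> x) (\<Phi> y) = moment_kernel R x y"
    by (rule gram_realization[OF pd cinner_ell2_unit_vector]) (rule that)
  define s1 :: "'a \<times> int \<times> int \<Rightarrow> 'a \<times> int \<times> int" where "s1 = (\<lambda>(h, m, n). (h, m + 1, n))"
  define s2 :: "'a \<times> int \<times> int \<Rightarrow> 'a \<times> int \<times> int" where "s2 = (\<lambda>(h, m, n). (h, m, n + 1))"
  have "bij s1" unfolding s1_def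
    by (rule bij_betw_byWitness[of _ "\<lambda>(h, m, n). (h, m - 1, n)"]) auto
  then have s1: "gram_preserving \<Phi> s1" by (auto simp: gram_preserving_def \<Phi> s1_def)
  have "bij s2" unfolding s2_def
    by (rule bij_betw_byWitness[of _ "\<lambda>(h, m, n). (h, m, n - 1)"]) auto
  then have s2: "gram_preserving \<Phi> s2" by (auto simp: gram_preserving_def \<Phi> s2_def)
  define U1 where "U1 = shift_unitary \<Phi> s1"
  define U2 where "U2 = shift_unitary \<Phi> s2"
  have U1: "unitary U1" and U2: "unitary U2"
    unfolding U1_def U2_def by (intro shift_unitary_unitary s1 s2)+
  have "s1 \<circ> s2 = s2 \<circ> s1" by (auto simp: s1_def s2_def)
  then have comm: "U1 \<circ> U2 = U2 \<circ> U1"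
    by (auto simp: U1_def U2_def shift_unitary_comp s1 s2)
  have up: "U1 (\<Phi> (h, m, n)) = \<Phi> (h, m + 1, n)" "U2 (\<Phi> (h, m, n)) = \<Phi> (h, m, n + 1)" for h m n
    by (simp_all add: U1_def U2_def shift_unitary_family s1 s2) (simp_all add: s1_def s2_def)
  have down: "inv U1 (\<Phi> (h, m, n)) = \<Phi> (h, m - 1, n)" "inv U2 (\<Phi> (h, m, n)) = \<Phi> (h, m, n - 1)" for h m n
    using unitary_inv_left[OF U1, of "\<Phi> (h, m - 1, n)"] unitary_inv_left[OF U2, of "\<Phi> (h, m, n - 1)"]
    by (simp_all add: up)
  have pow: "((if cmod z < 1 then U1 else inv U1) ^^ j) (\<Phi> (h, m, n)) = \<Phi> (h, m + circle_side z * int j, n)"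
    "((if cmod z < 1 then U2 else inv U2) ^^ j) (\<Phi> (h, m, n)) = \<Phi> (h, m, n + circle_side z * int j)" for z j h m n
    by (induction j) (auto simp: circle_side_def up down algebra_simps)
  define J where "J = (\<lambda>h. \<Phi> (h, 0, 0))"
  have "0 \<in> Te" by (simp add: Te_def)
  then have J: "cinner (J x) (J y) = cinner x y" for x y
    by (simp add: J_def \<Phi> fourier_coeff2_0_0 gFin R0 g flip: g_def)
  have key: "cinner (R z1 z2 u) v = cinner (cayley_factor z1 U1 (cayley_factor z2 U2 (J u))) (J v)"
    if z: "z1 \<in> Te" "z2 \<in> Te" for z1 z2 u v
  proof -
    let ?n = "\<lambda>j. circle_side z2 * int j"
    let ?m = "\<lambda>i. circle_side z1 * int i"
    let ?y = "cayley_factor (cnj z1) (inv U1) (J v)"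
    have inner: "cinner (\<Phi> (u, 0, ?n j)) ?y = fourier_coeff (?n j) (g u v (Fin z1))" for j
    proof -
      have "(\<lambda>i. cayley_weight z1 i * fourier_coeff2 (?m i) (?n j) (g u v))
          sums cinner (cayley_factor z1 U1 (\<Phi> (u, 0, ?n j))) (J v)"
        using cayley_factor_sums[OF U1 z(1), of "\<Phi> (u, 0, ?n j)" "J v"]
        by (simp add: pow J_def \<Phi> flip: g_def)
      moreover have "(\<lambda>i. cayley_weight z1 i * fourier_coeff2 (?m i) (?n j) (g u v))
          sums fourier_coeff (?n j) (g u v (Fin z1))"
        using two_sided_holomorphic_sums[OF fourier_coeff_two_sided_holomorphic[OF g] z(1)]
        by (simp add: fourier_coeff2_def)
      ultimately show ?thesis
        by (simp add: cayley_factor_adjoint[OF U1 z(1), symmetric] sums_unique2)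
    qed
    have "(\<lambda>j. cayley_weight z2 j * cinner (\<Phi> (u, 0, ?n j)) ?y) sums cinner (cayley_factor z2 U2 (J u)) ?y"
      using cayley_factor_sums[OF U2 z(2), of "J u" ?y] by (simp add: pow J_def)
    moreover have "Fin z1 \<in> Te_ext" using z by (simp add: Te_ext_def)
    then have "(\<lambda>j. cayley_weight z2 j * fourier_coeff (?n j) (g u v (Fin z1))) sums g u v (Fin z1) (Fin z2)"
      by (intro two_sided_holomorphic_sums two_sided_holomorphic2_slice g z)
    ultimately have "g u v (Fin z1) (Fin z2) = cinner (cayley_factor z2 U2 (J u)) ?y"
      by (simp add: inner sums_unique2)
    then show ?thesis by (simp add: gFin z cayley_factor_adjoint[OF U1 z(1)])
  qed
  show ?thesis
  proof (rule that[of J U1 U2])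
    show Jlin: "clinear_map J" by (rule cinner_preserving_imp_linear[OF J])
    show "J (R z1 z2 h) = orth_projection (range J) (cayley_factor z1 U1 (cayley_factor z2 U2 (J h)))"
      if "z1 \<in> Te" "z2 \<in> Te" for z1 z2 h
      unfolding orth_projection_range_isometry[OF Jlin J] using key[OF that] by blast
  qed (fact J U1 U2 comm)+
qed

text \<open>Every pair of commuting unitary operators extends the operator whose domain is the zero subspace.\<close>

lemma generalized_resolvent_of_some_pairI:
  fixes J :: "'a::chilbert_space \<Rightarrow> 'b::chilbert_space"
  assumes J: "clinear_map J" "\<And>x y. cinner (J x) (J y) = cinner x y"
    and U: "unitary U1" "unitary U2" "U1 \<circ> U2 = U2 \<circ> U1"
    and R: "\<And>z1 z2 h. z1 \<in> Te \<Longrightarrow> z2 \<in> Te \<Longrightarrow>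
       J (R z1 z2 h) = orth_projection (range J) (cayley_factor z1 U1 (cayley_factor z2 U2 (J h)))"
  shows "generalized_resolvent_of_some_pair TYPE('b) R"
proof -
  define V where "V = (\<lambda>h::'a. if h = 0 then Some (0::'a) else None)"
  have dom: "dom V = {0}" by (auto simp: V_def dom_def)
  have V0: "V 0 = Some 0" by (simp add: V_def)
  have "Map.graph V = {(0, 0)}" by (auto simp: Map.graph_def V_def split: if_splits)
  then have iso: "closed_isometric V"
    by (simp add: closed_isometric_def linear_operator_def csubspace_def dom V0)
  have comm: "commuting_on_common_domain V V"
    by (simp add: commuting_on_common_domain_def)
  have "generalized_resolvent TYPE('b) V V R"
    unfolding generalized_resolvent_def
  proof (rule exI[of _ J], rule exI[of _ U1], rule exI[of _ U2], intro conjI ballI allI)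
    show "U1 (J h) = J (the (V h))" if "h \<in> dom V" for h
      using that by (simp add: dom V0 clinear_map_zero J(1) unitary_clinear[OF U(1)])
    show "U2 (J h) = J (the (V h))" if "h \<in> dom V" for h
      using that by (simp add: dom V0 clinear_map_zero J(1) unitary_clinear[OF U(2)])
  qed (fact J U R)+
  then show ?thesis
    unfolding generalized_resolvent_of_some_pair_def using iso comm by blast
qed

theorem theorem3:
  fixes R :: "complex \<Rightarrow> complex \<Rightarrow> 'a::chilbert_space \<Rightarrow> 'a"
  assumes "\<forall>z1\<in>Te. \<forall>z2\<in>Te. bounded_clinear (R z1 z2)"
  shows "(generalized_resolvent_of_some_pair TYPE(('a \<times> int \<times> int) ell2) R
            \<longleftrightarrow> resolvent_conditions R) \<and>
         (generalized_resolvent_of_some_pair TYPE('b::chilbert_space) R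
            \<longrightarrow> resolvent_conditions R)"
proof (intro conjI iffI impI)
  assume R: "resolvent_conditions R"
  have lin: "clinear_map (R z1 z2)" if "z1 \<in> Te" "z2 \<in> Te" for z1 z2
    using assms that by (auto simp: bounded_clinear_def)
  show "generalized_resolvent_of_some_pair TYPE(('a \<times> int \<times> int) ell2) R"
    by (rule conditions_imp_dilation[OF _ R]) (rule lin, assumption+, rule generalized_resolvent_of_some_pairI)
qed (rule generalized_resolvent_imp_conditions, assumption)+

end
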